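(* Let $(\eta,\omega_1,\omega_2,\omega_3)$ be an $SU(2)$-structure on a $5$-manifold $N^5$. It can be lifted to a nearly Kähler structure $(F(t),\Psi_+(t),\Psi_-(t))$ on $N^5\times\mathbb{R}$ of the form $$F=\omega_1(t)+\eta(t)\wedge dt,\qquad \Psi_++i\Psi_-=(\omega_2(t)+i\omega_3(t))\wedge(\eta(t)+i\,dt),$$ where $(\eta(t),\omega_i(t))$ is a family of $SU(2)$-structures on $N^5$ depending on $t\in\mathbb{R}$ with $(\eta(0),\omega_i(0))=(\eta,\omega_i)$, if and only if $(\eta,\omega_i)$ is a nearly hypo structure which generates a one-parameter family of $SU(2)$-structures $(\eta(t),\omega_i(t))$, with $(\eta(0),\omega_i(0))=(\eta,\omega_i)$, satisfying the evolution nearly hypo equations $$\partial_t\omega_1=-d\eta-3\omega_3,\qquad \partial_t(\eta\wedge\omega_3)=d\omega_2+4\eta\wedge\omega_1,\qquad \partial_t(\eta\wedge\omega_2)=-d\omega_3 .$$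
   Context: An $SU(2)$-structure on a $5$-manifold is a quadruplet $(\eta,\omega_1,\omega_2,\omega_3)$ of a $1$-form $\eta$ and $2$-forms $\omega_i$ with $\omega_i\wedge\omega_j=\delta_{ij}v$ for some $4$-form $v$ with $v\wedge\eta$ nowhere zero, and such that $X\lrcorner\omega_1=Y\lrcorner\omega_2$ implies $\omega_3(X,Y)\ge 0$. It is nearly hypo if $d\omega_1=3\eta\wedge\omega_2$ and $d(\eta\wedge\omega_3)=-2\omega_1\wedge\omega_1$. An $SU(3)$-structure on a $6$-manifold is a triple $(F,\Psi_+,\Psi_-)$ such that locally there is a coframe $e^1,\dots,e^6$ with $F=e^{12}+e^{34}+e^{56}$, $\Psi_++i\Psi_-=(e^1+ie^2)\wedge(e^3+ie^4)\wedge(e^5+ie^6)$. It is nearly Kähler if $dF=3\Psi_+$ and $d\Psi_-=-2F\wedge F$. In the evolution equations $d$ is the exterior derivative on $N^5$ and all forms depend on $t$; $t$ is the coordinate on $\mathbb{R}$. *)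

theory Defs
  imports
    "HOL-Analysis.Analysis"
    "HOL-Combinatorics.Permutations"
    "HOL-Library.Function_Algebras"
begin

section \<open>Smooth functions and smooth manifolds\<close>

text \<open>On an open subset of a finite-dimensional space, \<open>Ck_on n\<close> is the class of
  \<open>n\<close> times continuously differentiable functions, expressed through iterated directional
  derivatives.\<close>

primrec Ck_on :: "nat \<Rightarrow> 'e::euclidean_space set \<Rightarrow> ('e \<Rightarrow> 'b::real_normed_vector) \<Rightarrow> bool" where
  "Ck_on 0 S f \<longleftrightarrow> continuous_on S f"
| "Ck_on (Suc n) S f \<longleftrightarrow>
     (\<forall>x\<in>S. f differentiable (at x)) \<and> (\<forall>v. Ck_on n S (\<lambda>x. frechet_derivative f (at x) v))"

definition smooth_on :: "'e::euclidean_space set \<Rightarrow> ('e \<Rightarrow> 'b::real_normed_vector) \<Rightarrow> bool" where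
  "smooth_on S f \<longleftrightarrow> (\<forall>n. Ck_on n S f)"

text \<open>The charts are indexed, so that \<open>N\<close> and \<open>N \<times> \<real>\<close> have atlases over the same index set.
  The atlas need not be maximal.\<close>

record ('i, 'a, 'e) atlas =
  idx :: "'i set"
  dom :: "'i \<Rightarrow> 'a set"
  chart :: "'i \<Rightarrow> 'a \<Rightarrow> 'e"

definition img :: "('i, 'a, 'e) atlas \<Rightarrow> 'i \<Rightarrow> 'e set" where
  "img M i = chart M i ` dom M i"

definition transition :: "('i, 'a, 'e) atlas \<Rightarrow> 'i \<Rightarrow> 'i \<Rightarrow> 'e \<Rightarrow> 'e" where
  "transition M i j = chart M j \<circ> inv_into (dom M i) (chart M i)"

definition smooth_manifold ::
  "('i, 'a::{t2_space, second_countable_topology}, 'e::euclidean_space) atlas \<Rightarrow> bool" where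
  "smooth_manifold M \<longleftrightarrow>
     (\<Union>i\<in>idx M. dom M i) = UNIV \<and>
     (\<forall>i\<in>idx M. open (dom M i) \<and> open (img M i) \<and>
        (\<exists>g. homeomorphism (dom M i) (img M i) (chart M i) g)) \<and>
     (\<forall>i\<in>idx M. \<forall>j\<in>idx M.
        smooth_on (chart M i ` (dom M i \<inter> dom M j)) (transition M i j))"

definition times_real :: "('i, 'a, 'e) atlas \<Rightarrow> ('i, 'a \<times> real, 'e \<times> real) atlas" where
  "times_real M = \<lparr>idx = idx M, dom = (\<lambda>i. dom M i \<times> UNIV), chart = (\<lambda>i. map_prod (chart M i) id)\<rparr>"


section \<open>Exterior algebra\<close>

text \<open>A \<open>k\<close>-covector is a function on lists of vectors that is alternating and multilinear on
  lists of length \<open>k\<close> and zero on lists of any other length.  Values are real or complex;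
  linearity is over \<open>\<real>\<close>.\<close>

definition alternating :: "nat \<Rightarrow> ('e::real_vector list \<Rightarrow> 'b::real_vector) \<Rightarrow> bool" where
  "alternating k a \<longleftrightarrow>
     (\<forall>vs. length vs \<noteq> k \<longrightarrow> a vs = 0) \<and>
     (\<forall>vs j. length vs = k \<longrightarrow> j < k \<longrightarrow> linear (\<lambda>v. a (vs[j := v]))) \<and>
     (\<forall>vs. length vs = k \<longrightarrow> \<not> distinct vs \<longrightarrow> a vs = 0)"

text \<open>The normalisation is the one with \<open>(e\<^sup>1 \<and> e\<^sup>2)(X, Y) = e\<^sup>1(X) e\<^sup>2(Y) - e\<^sup>1(Y) e\<^sup>2(X)\<close>.
  If \<open>a\<close> is homogeneous of degree \<open>k\<close>, only that summand of the outer sum survives.\<close>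

definition wedge ::
  "('e list \<Rightarrow> 'b::real_normed_field) \<Rightarrow> ('e list \<Rightarrow> 'b) \<Rightarrow> 'e list \<Rightarrow> 'b" (infixl "\<and>\<^sub>c" 70) where
  "(a \<and>\<^sub>c b) vs =
     (let n = length vs in
      \<Sum>k\<le>n. \<Sum>p | p permutes {..<n}.
        of_int (sign p) / (fact k * fact (n - k))
          * a (map (\<lambda>i. vs ! p i) [0..<k]) * b (map (\<lambda>i. vs ! p i) [k..<n]))"

definition interior_product :: "'e \<Rightarrow> ('e list \<Rightarrow> 'b) \<Rightarrow> 'e list \<Rightarrow> 'b" (infixr "\<lrcorner>" 75) where
  "X \<lrcorner> a = (\<lambda>vs. a (X # vs))"


section \<open>Differential forms\<close>

text \<open>A differential form is given by its local representatives in the charts.  Sum, difference,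
  negation and zero are the pointwise ones; the values at points outside the image of a chart are
  irrelevant, so forms are compared with \<open>form_eq\<close>.\<close>

type_synonym ('i, 'e, 'b) form = "'i \<Rightarrow> 'e \<Rightarrow> 'e list \<Rightarrow> 'b"

definition smooth_form_on ::
  "nat \<Rightarrow> 'e::euclidean_space set \<Rightarrow> ('e \<Rightarrow> 'e list \<Rightarrow> real) \<Rightarrow> bool" where
  "smooth_form_on k V a \<longleftrightarrow>
     (\<forall>x\<in>V. alternating k (a x)) \<and> (\<forall>vs. smooth_on V (\<lambda>x. a x vs))"

definition is_form ::
  "('i, 'a, 'e::euclidean_space) atlas \<Rightarrow> nat \<Rightarrow> ('i, 'e, real) form \<Rightarrow> bool" where
  "is_form M k \<alpha> \<longleftrightarrow>
     (\<forall>i\<in>idx M. smooth_form_on k (img M i) (\<alpha> i)) \<and>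
     (\<forall>i\<in>idx M. \<forall>j\<in>idx M. \<forall>p \<in> dom M i \<inter> dom M j. \<forall>vs.
        \<alpha> i (chart M i p) vs =
        \<alpha> j (chart M j p) (map (frechet_derivative (transition M i j) (at (chart M i p))) vs))"

definition form_eq ::
  "('i, 'a, 'e) atlas \<Rightarrow> ('i, 'e, 'b) form \<Rightarrow> ('i, 'e, 'b) form \<Rightarrow> bool" where
  "form_eq M \<alpha> \<beta> \<longleftrightarrow> (\<forall>i\<in>idx M. \<forall>x\<in>img M i. \<alpha> i x = \<beta> i x)"

abbreviation form_eq_syntax ::
  "('i, 'e, 'b) form \<Rightarrow> ('i, 'a, 'e) atlas \<Rightarrow> ('i, 'e, 'b) form \<Rightarrow> bool"
  ("(_ \<doteq>\<^bsub>_\<^esub> _)" [51, 0, 51] 50) where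
  "\<alpha> \<doteq>\<^bsub>M\<^esub> \<beta> \<equiv> form_eq M \<alpha> \<beta>"

definition nowhere_zero :: "('i, 'a, 'e) atlas \<Rightarrow> ('i, 'e, 'b::zero) form \<Rightarrow> bool" where
  "nowhere_zero M \<alpha> \<longleftrightarrow> (\<forall>i\<in>idx M. \<forall>x\<in>img M i. \<alpha> i x \<noteq> 0)"

definition form_scale :: "real \<Rightarrow> ('i, 'e, real) form \<Rightarrow> ('i, 'e, real) form" (infixr "*\<^sub>F" 72) where
  "c *\<^sub>F \<alpha> = (\<lambda>i x vs. c * \<alpha> i x vs)"

definition form_wedge ::
  "('i, 'e, 'b::real_normed_field) form \<Rightarrow> ('i, 'e, 'b) form \<Rightarrow> ('i, 'e, 'b) form" (infixl "\<and>\<^sub>F" 74) where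
  "\<alpha> \<and>\<^sub>F \<beta> = (\<lambda>i x. \<alpha> i x \<and>\<^sub>c \<beta> i x)"

text \<open>The complex-valued form \<open>\<alpha> + i\<beta>\<close>.\<close>

definition complex_form ::
  "('i, 'e, real) form \<Rightarrow> ('i, 'e, real) form \<Rightarrow> ('i, 'e, complex) form" where
  "complex_form \<alpha> \<beta> = (\<lambda>i x vs. Complex (\<alpha> i x vs) (\<beta> i x vs))"

text \<open>\<open>(d\<alpha>)(v\<^sub>0, \<dots>, v\<^sub>k) = \<Sum>\<^sub>j (-1)\<^sup>j D\<^bsub>v\<^sub>j\<^esub> (\<alpha>(v\<^sub>0, \<dots>, v\<^sub>j omitted, \<dots>, v\<^sub>k))\<close> in every chart.\<close>

definition ext_deriv :: "('i, 'e::euclidean_space, real) form \<Rightarrow> ('i, 'e, real) form" where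
  "ext_deriv \<alpha> = (\<lambda>i x vs. \<Sum>j<length vs.
     (-1) ^ j * frechet_derivative (\<lambda>y. \<alpha> i y (take j vs @ drop (Suc j) vs)) (at x) (vs ! j))"


section \<open>Families of forms on \<open>N\<close> and forms on \<open>N \<times> \<real>\<close>\<close>

definition is_form_family ::
  "('i, 'a, 'e::euclidean_space) atlas \<Rightarrow> nat \<Rightarrow> (real \<Rightarrow> ('i, 'e, real) form) \<Rightarrow> bool" where
  "is_form_family N k \<alpha> \<longleftrightarrow>
     (\<forall>t. is_form N k (\<alpha> t)) \<and>
     (\<forall>i\<in>idx N. \<forall>vs. smooth_on (UNIV \<times> img N i) (\<lambda>(t, x). \<alpha> t i x vs))"

definition time_deriv :: "(real \<Rightarrow> ('i, 'e, real) form) \<Rightarrow> real \<Rightarrow> ('i, 'e, real) form" where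
  "time_deriv \<alpha> t = (\<lambda>i x vs. deriv (\<lambda>s. \<alpha> s i x vs) t)"

text \<open>A family \<open>\<alpha>(t)\<close> of forms on \<open>N\<close> regarded as a form on \<open>N \<times> \<real>\<close>: at the point \<open>(x, t)\<close> it is the
  pullback of \<open>\<alpha>(t)\<close> along the projection to \<open>N\<close>.\<close>

definition lift :: "(real \<Rightarrow> ('i, 'e, 'b) form) \<Rightarrow> ('i, 'e \<times> real, 'b) form" where
  "lift \<alpha> = (\<lambda>i (x, t) vs. \<alpha> t i x (map fst vs))"

definition dt :: "('i, 'e \<times> real, real) form" where
  "dt = (\<lambda>i z vs. case vs of [v] \<Rightarrow> snd v | _ \<Rightarrow> 0)"


section \<open>\<open>SU(2)\<close>-structures on 5-manifolds\<close>

text \<open>\<open>\<omega>\<^sub>1, \<omega>\<^sub>2, \<omega>\<^sub>3\<close> are \<open>\<omega> 1, \<omega> 2, \<omega> 3\<close>; other values of \<open>\<omega>\<close> play no role.\<close>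

definition SU2_structure ::
  "('i, 'a, 'e::euclidean_space) atlas \<Rightarrow> ('i, 'e, real) form \<Rightarrow> (nat \<Rightarrow> ('i, 'e, real) form) \<Rightarrow> bool" where
  "SU2_structure N \<eta> \<omega> \<longleftrightarrow>
     DIM('e) = 5 \<and> is_form N 1 \<eta> \<and> (\<forall>a\<in>{1,2,3}. is_form N 2 (\<omega> a)) \<and>
     (\<exists>v. is_form N 4 v \<and>
        (\<forall>a\<in>{1,2,3}. \<forall>b\<in>{1,2,3}. \<omega> a \<and>\<^sub>F \<omega> b \<doteq>\<^bsub>N\<^esub> (if a = b then v else 0)) \<and>
        nowhere_zero N (v \<and>\<^sub>F \<eta>)) \<and>
     (\<forall>i\<in>idx N. \<forall>x\<in>img N i. \<forall>X Y.
        X \<lrcorner> \<omega> 1 i x = Y \<lrcorner> \<omega> 2 i x \<longrightarrow> \<omega> 3 i x [X, Y] \<ge> 0)"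

definition nearly_hypo ::
  "('i, 'a, 'e::euclidean_space) atlas \<Rightarrow> ('i, 'e, real) form \<Rightarrow> (nat \<Rightarrow> ('i, 'e, real) form) \<Rightarrow> bool" where
  "nearly_hypo N \<eta> \<omega> \<longleftrightarrow>
     SU2_structure N \<eta> \<omega> \<and>
     ext_deriv (\<omega> 1) \<doteq>\<^bsub>N\<^esub> 3 *\<^sub>F (\<eta> \<and>\<^sub>F \<omega> 2) \<and>
     ext_deriv (\<eta> \<and>\<^sub>F \<omega> 3) \<doteq>\<^bsub>N\<^esub> (-2) *\<^sub>F (\<omega> 1 \<and>\<^sub>F \<omega> 1)"

definition SU2_family ::
  "('i, 'a, 'e::euclidean_space) atlas \<Rightarrow> (real \<Rightarrow> ('i, 'e, real) form) \<Rightarrow>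
     (real \<Rightarrow> nat \<Rightarrow> ('i, 'e, real) form) \<Rightarrow> bool" where
  "SU2_family N \<eta> \<omega> \<longleftrightarrow>
     (\<forall>t. SU2_structure N (\<eta> t) (\<omega> t)) \<and>
     is_form_family N 1 \<eta> \<and> (\<forall>a\<in>{1,2,3}. is_form_family N 2 (\<lambda>t. \<omega> t a))"

definition SU2_family_from ::
  "('i, 'a, 'e::euclidean_space) atlas \<Rightarrow> ('i, 'e, real) form \<Rightarrow> (nat \<Rightarrow> ('i, 'e, real) form) \<Rightarrow>
     (real \<Rightarrow> ('i, 'e, real) form) \<Rightarrow> (real \<Rightarrow> nat \<Rightarrow> ('i, 'e, real) form) \<Rightarrow> bool" where
  "SU2_family_from N \<eta>\<^sub>0 \<omega>\<^sub>0 \<eta> \<omega> \<longleftrightarrow>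
     SU2_family N \<eta> \<omega> \<and> \<eta> 0 \<doteq>\<^bsub>N\<^esub> \<eta>\<^sub>0 \<and> (\<forall>a\<in>{1,2,3}. \<omega> 0 a \<doteq>\<^bsub>N\<^esub> \<omega>\<^sub>0 a)"

definition evolution_nearly_hypo ::
  "('i, 'a, 'e::euclidean_space) atlas \<Rightarrow> (real \<Rightarrow> ('i, 'e, real) form) \<Rightarrow>
     (real \<Rightarrow> nat \<Rightarrow> ('i, 'e, real) form) \<Rightarrow> bool" where
  "evolution_nearly_hypo N \<eta> \<omega> \<longleftrightarrow> (\<forall>t.
     time_deriv (\<lambda>s. \<omega> s 1) t \<doteq>\<^bsub>N\<^esub> - ext_deriv (\<eta> t) - 3 *\<^sub>F \<omega> t 3 \<and>
     time_deriv (\<lambda>s. \<eta> s \<and>\<^sub>F \<omega> s 3) t \<doteq>\<^bsub>N\<^esub> ext_deriv (\<omega> t 2) + 4 *\<^sub>F (\<eta> t \<and>\<^sub>F \<omega> t 1) \<and>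
     time_deriv (\<lambda>s. \<eta> s \<and>\<^sub>F \<omega> s 2) t \<doteq>\<^bsub>N\<^esub> - ext_deriv (\<omega> t 3))"


section \<open>\<open>SU(3)\<close>-structures on 6-manifolds\<close>

definition coframe :: "'e::euclidean_space set \<Rightarrow> (nat \<Rightarrow> 'e \<Rightarrow> 'e list \<Rightarrow> real) \<Rightarrow> bool" where
  "coframe V e \<longleftrightarrow>
     (\<forall>k\<in>{1..DIM('e)}. smooth_form_on 1 V (e k)) \<and>
     (\<forall>x\<in>V. \<forall>c. (\<forall>u. (\<Sum>k=1..DIM('e). c k * e k x [u]) = 0) \<longrightarrow> (\<forall>k\<in>{1..DIM('e)}. c k = 0))"

text \<open>The local coframe is taken on a neighbourhood contained in a chart, and written in that chart.\<close>

definition SU3_structure ::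
  "('i, 'a, 'e::euclidean_space) atlas \<Rightarrow>
     ('i, 'e, real) form \<Rightarrow> ('i, 'e, real) form \<Rightarrow> ('i, 'e, real) form \<Rightarrow> bool" where
  "SU3_structure M F \<Psi>\<^sub>p \<Psi>\<^sub>m \<longleftrightarrow>
     DIM('e) = 6 \<and> is_form M 2 F \<and> is_form M 3 \<Psi>\<^sub>p \<and> is_form M 3 \<Psi>\<^sub>m \<and>
     (\<forall>i\<in>idx M. \<forall>x\<in>img M i. \<exists>V e.
        open V \<and> x \<in> V \<and> V \<subseteq> img M i \<and> coframe V e \<and>
        (\<forall>y\<in>V.
           F i y = (e 1 y \<and>\<^sub>c e 2 y) + (e 3 y \<and>\<^sub>c e 4 y) + (e 5 y \<and>\<^sub>c e 6 y) \<and>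
           complex_form \<Psi>\<^sub>p \<Psi>\<^sub>m i y =
             (\<lambda>us. Complex (e 1 y us) (e 2 y us)) \<and>\<^sub>c
             (\<lambda>us. Complex (e 3 y us) (e 4 y us)) \<and>\<^sub>c
             (\<lambda>us. Complex (e 5 y us) (e 6 y us))))"

definition nearly_Kaehler ::
  "('i, 'a, 'e::euclidean_space) atlas \<Rightarrow>
     ('i, 'e, real) form \<Rightarrow> ('i, 'e, real) form \<Rightarrow> ('i, 'e, real) form \<Rightarrow> bool" where
  "nearly_Kaehler M F \<Psi>\<^sub>p \<Psi>\<^sub>m \<longleftrightarrow>
     SU3_structure M F \<Psi>\<^sub>p \<Psi>\<^sub>m \<and>
     ext_deriv F \<doteq>\<^bsub>M\<^esub> 3 *\<^sub>F \<Psi>\<^sub>p \<and>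
     ext_deriv \<Psi>\<^sub>m \<doteq>\<^bsub>M\<^esub> (-2) *\<^sub>F (F \<and>\<^sub>F F)"

end

theory Submission
  imports Defs
begin

text \<open>
  Splitting \<open>dF = 3\<Psi>\<^sub>+\<close> and \<open>d\<Psi>\<^sub>- = -2F \<and> F\<close> into the parts without and with \<open>dt\<close> gives exactly the two
  nearly hypo equations at every time and the first two evolution equations.  The third evolution
  equation is the \<open>dt\<close>-part of \<open>d\<Psi>\<^sub>+ = 0\<close>, obtained by differentiating \<open>d\<omega>\<^sub>1 = 3\<eta> \<and> \<omega>\<^sub>2\<close> in \<open>t\<close>.
  Conversely, under the evolution equations the defects \<open>d\<omega>\<^sub>1 - 3\<eta> \<and> \<omega>\<^sub>2\<close> and
  \<open>d(\<eta> \<and> \<omega>\<^sub>3) + 2\<omega>\<^sub>1 \<and> \<omega>\<^sub>1\<close> have vanishing time derivative, so the nearly hypo condition propagates from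
  \<open>t = 0\<close>.

  For the \<open>SU(3)\<close>-structure one needs a smooth local coframe adapted to \<open>(\<eta>, \<omega>\<^sub>1, \<omega>\<^sub>2, \<omega>\<^sub>3)\<close>.  Fix a
  constant vector \<open>X\<close> outside the common kernel of the \<open>\<omega>\<^sub>a\<close> and let \<open>Y\<close> solve \<open>Y \<lrcorner> \<omega>\<^sub>2 = X \<lrcorner> \<omega>\<^sub>1\<close>,
  \<open>\<eta>(Y) = 0\<close>.  Then \<open>r = \<omega>\<^sub>3(X, Y)\<close> is positive, and \<open>-Y \<lrcorner> \<omega>\<^sub>3\<close>, \<open>X \<lrcorner> \<omega>\<^sub>1\<close>, \<open>X \<lrcorner> \<omega>\<^sub>2\<close>, \<open>X \<lrcorner> \<omega>\<^sub>3\<close>,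
  divided by \<open>\<surd>r\<close>, together with \<open>\<eta>\<close> and \<open>dt\<close> form such a coframe.
\<close>

section \<open>Calculus of smooth functions\<close>

text \<open>The propagation is asymmetric. The derivative of the first defect cancels by the first
  and third evolution equations alone. That of the second is 4 d(\<eta> \<and> \<omega>1) - 4
  \<omega>1 \<and> (d\<eta> + 3 \<omega>3) = -4 \<eta> \<and> d\<omega>1 - 12 \<omega>1 \<and>
  \<omega>3. It vanishes because \<omega>1 \<and> \<omega>3 = 0 and because d\<omega>1 = 3 \<eta>
  \<and> \<omega>2, already known at all times, makes \<eta> \<and> d\<omega>1 zero. Exchanging d/dt
  with d is what requires families jointly smooth in time and space.

  In the SU(3) part the obstacle is smoothness: a normal form found separately at each point gives
  no smooth coframe. So the coframe is written as formulas in the components of \<eta> and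
  \<omega>a. With X constant the only unknown is Y, and although \<omega>2 is degenerate in
  dimension 5, the equation for Y becomes a regular linear system solvable by determinants.\<close>

abbreviation pd :: "('e::real_normed_vector \<Rightarrow> 'b::real_normed_vector) \<Rightarrow> 'e \<Rightarrow> 'e \<Rightarrow> 'b" where
  "pd f x v \<equiv> frechet_derivative f (at x) v"

text \<open>The derivatives in \<open>Ck_on\<close> are taken in the whole space at points of S, so
  agreement on S determines them because S is open. This lets each induction below replace a
  derivative by its explicit formula.\<close>

lemma Ck_on_cong:
  fixes f g :: "'e::euclidean_space \<Rightarrow> 'b::real_normed_vector"
  assumes S: "open S" and eq: "\<And>x. x \<in> S \<Longrightarrow> f x = g x" and f: "Ck_on n S f"
  shows "Ck_on n S g"
  using eq f
proof (induction n arbitrary: f g)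
  case 0
  then show ?case by (simp cong: continuous_on_cong)
next
  case (Suc n)
  have diff: "f differentiable at x" if "x \<in> S" for x using Suc.prems(2) that by simp
  have "g differentiable at x" if "x \<in> S" for x
    using diff[OF that] Suc.prems(1) that S
    unfolding differentiable_def by (metis has_derivative_transform_within_open)
  moreover have "Ck_on n S (\<lambda>x. pd g x v)" for v
  proof (rule Suc.IH)
    show "Ck_on n S (\<lambda>x. pd f x v)" using Suc.prems(2) by simp
    show "pd f x v = pd g x v" if "x \<in> S" for x
      using frechet_derivative_transform_within_open[OF diff[OF that] S that] Suc.prems(1) by metis
  qed
  ultimately show ?case by simp
qed

text \<open>At order \<open>Suc n\<close> the definition speaks about f only through its
  derivatives. The product rule also multiplies by f itself, which therefore has to be known at
  order n.\<close>

lemma Ck_on_SucD: "Ck_on (Suc n) S f \<Longrightarrow> Ck_on n S f"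
proof (induction n arbitrary: f)
  case 0
  then show ?case
    by (auto intro!: continuous_at_imp_continuous_on differentiable_imp_continuous_within)
next
  case (Suc n)
  then show ?case by (metis Ck_on.simps(2))
qed

lemma Ck_on_const: "Ck_on n S (\<lambda>x. c)"
  by (induction n arbitrary: c) simp_all

lemma Ck_on_add:
  assumes "open S" "Ck_on n S f" "Ck_on n S g"
  shows "Ck_on n S (\<lambda>x. f x + g x)"
  using assms(2,3)
proof (induction n arbitrary: f g)
  case 0
  then show ?case by (simp add: continuous_on_add)
next
  case (Suc n)
  have d: "f differentiable at x" "g differentiable at x" if "x \<in> S" for x
    using Suc.prems that by auto
  have "Ck_on n S (\<lambda>x. pd (\<lambda>x. f x + g x) x v)" for v
  proof (rule Ck_on_cong[OF assms(1)])
    show "Ck_on n S (\<lambda>x. pd f x v + pd g x v)" using Suc by simp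
    show "pd f x v + pd g x v = pd (\<lambda>x. f x + g x) x v" if "x \<in> S" for x
      using frechet_derivative_at[OF has_derivative_add[OF d[OF that, unfolded frechet_derivative_works]]]
      by metis
  qed
  then show ?case using d by auto
qed

lemma pd_mult:
  fixes f g :: "'e::real_normed_vector \<Rightarrow> real"
  assumes "f differentiable at x" "g differentiable at x"
  shows "pd (\<lambda>x. f x * g x) x v = f x * pd g x v + pd f x v * g x"
  using frechet_derivative_at[OF has_derivative_mult[OF assms[unfolded frechet_derivative_works]]]
  by metis

lemma Ck_on_mult:
  fixes f g :: "'e::euclidean_space \<Rightarrow> real"
  assumes "open S" "Ck_on n S f" "Ck_on n S g"
  shows "Ck_on n S (\<lambda>x. f x * g x)"
  using assms(2,3)
proof (induction n arbitrary: f g)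
  case 0
  then show ?case by (simp add: continuous_on_mult)
next
  case (Suc n)
  have d: "f differentiable at x" "g differentiable at x" if "x \<in> S" for x
    using Suc.prems that by auto
  have "Ck_on n S (\<lambda>x. pd (\<lambda>x. f x * g x) x v)" for v
  proof (rule Ck_on_cong[OF assms(1)])
    show "Ck_on n S (\<lambda>x. f x * pd g x v + pd f x v * g x)"
      using Suc.prems Ck_on_SucD[OF Suc.prems(1)] Ck_on_SucD[OF Suc.prems(2)]
      by (intro Ck_on_add[OF assms(1)] Suc.IH) auto
  qed (simp add: pd_mult d)
  then show ?case using d by auto
qed

text \<open>For linear L the derivative in direction v is a derivative of f in the fixed direction L
  v, composed with L, so the induction closes. It is applied to the identity, which gives
  restriction to smaller open sets, and to the swap of the time and space factors.\<close>

lemma Ck_on_compose_linear: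
  fixes L :: "'e::euclidean_space \<Rightarrow> 'f::euclidean_space"
  assumes L: "bounded_linear L" and T: "open T" "\<And>x. x \<in> T \<Longrightarrow> L x \<in> S" and f: "Ck_on n S f"
  shows "Ck_on n T (\<lambda>x. f (L x))"
  using f
proof (induction n arbitrary: f)
  case 0
  then show ?case
    using continuous_on_compose2[of S f T L] linear_continuous_on[OF L] T(2) by auto
next
  case (Suc n)
  have hd: "((\<lambda>x. f (L x)) has_derivative (\<lambda>v. pd f (L x) (L v))) (at x)" if "x \<in> T" for x
    using has_derivative_compose[OF bounded_linear_imp_has_derivative[OF L], of f _ x] Suc.prems T(2)[OF that]
    by (auto simp: frechet_derivative_works)
  have "Ck_on n T (\<lambda>x. pd (\<lambda>x. f (L x)) x v)" for v
  proof (rule Ck_on_cong[OF T(1)])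
    show "Ck_on n T (\<lambda>x. pd f (L x) (L v))"
      using Suc.IH[of "\<lambda>x. pd f x (L v)"] Suc.prems by simp
    show "pd f (L x) (L v) = pd (\<lambda>x. f (L x)) x v" if "x \<in> T" for x
      using frechet_derivative_at[OF hd[OF that]] by metis
  qed
  then show ?case using hd by (auto simp: differentiable_def)
qed

text \<open>The derivative - (1/f) f' (1/f) contains 1/f only undifferentiated, so the induction
  hypothesis covers it. The square root below works the same way, through f' / (2 \<surd>f).\<close>

lemma Ck_on_inverse:
  fixes f :: "'e::euclidean_space \<Rightarrow> real"
  assumes S: "open S" and nz: "\<And>x. x \<in> S \<Longrightarrow> f x \<noteq> 0" and f: "Ck_on n S f"
  shows "Ck_on n S (\<lambda>x. inverse (f x))"
  using f
proof (induction n)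
  case 0
  then show ?case using nz by (auto intro: continuous_on_inverse)
next
  case (Suc n)
  have hd: "((\<lambda>x. inverse (f x)) has_derivative (\<lambda>v. - (inverse (f x) * pd f x v * inverse (f x)))) (at x)"
    if "x \<in> S" for x
    using Deriv.has_derivative_inverse[of f x, OF nz[OF that]] Suc.prems that by (auto simp: frechet_derivative_works)
  have "Ck_on n S (\<lambda>x. pd (\<lambda>x. inverse (f x)) x v)" for v
  proof (rule Ck_on_cong[OF S])
    show "Ck_on n S (\<lambda>x. (- 1) * (inverse (f x) * pd f x v * inverse (f x)))"
      using Suc.prems Suc.IH[OF Ck_on_SucD[OF Suc.prems]]
      by (intro Ck_on_mult[OF S] Ck_on_const) auto
    show "(- 1) * (inverse (f x) * pd f x v * inverse (f x)) = pd (\<lambda>x. inverse (f x)) x v" if "x \<in> S" for x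
      using fun_cong[OF frechet_derivative_at[OF hd[OF that]], of v] by simp
  qed
  then show ?case using hd by (auto simp: differentiable_def)
qed

lemma Ck_on_sqrt:
  fixes f :: "'e::euclidean_space \<Rightarrow> real"
  assumes S: "open S" and pos: "\<And>x. x \<in> S \<Longrightarrow> f x > 0" and f: "Ck_on n S f"
  shows "Ck_on n S (\<lambda>x. sqrt (f x))"
  using f
proof (induction n)
  case 0
  then show ?case by (auto intro: continuous_on_real_sqrt)
next
  case (Suc n)
  have hd: "((\<lambda>x. sqrt (f x)) has_derivative (\<lambda>v. pd f x v * (inverse (sqrt (f x)) / 2))) (at x)"
    if "x \<in> S" for x
    using Suc.prems pos[OF that] that 
    by (intro has_derivative_real_sqrt) (auto simp: frechet_derivative_works)
  have "Ck_on n S (\<lambda>x. pd (\<lambda>x. sqrt (f x)) x v)" for v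
  proof (rule Ck_on_cong[OF S])
    show "Ck_on n S (\<lambda>x. pd f x v * (inverse (sqrt (f x)) * (1/2)))"
      using Suc.prems Suc.IH[OF Ck_on_SucD[OF Suc.prems]] pos
      by (intro Ck_on_mult[OF S] Ck_on_const Ck_on_inverse S) (auto dest: pos)
    show "pd f x v * (inverse (sqrt (f x)) * (1/2)) = pd (\<lambda>x. sqrt (f x)) x v" if "x \<in> S" for x
      using fun_cong[OF frechet_derivative_at[OF hd[OF that]], of v] by simp
  qed
  then show ?case using hd by (auto simp: differentiable_def)
qed

section \<open>Closure properties of smooth functions\<close>

lemma smooth_on_subset:
  assumes "smooth_on S f" "T \<subseteq> S" "open T"
  shows "smooth_on T f"
  using Ck_on_compose_linear[OF bounded_linear_ident assms(3), of S _ f] assms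
  unfolding smooth_on_def by auto

lemma smooth_on_const: "smooth_on S (\<lambda>x. c)"
  by (simp add: smooth_on_def Ck_on_const)

lemma smooth_on_add: "open S \<Longrightarrow> smooth_on S f \<Longrightarrow> smooth_on S g \<Longrightarrow> smooth_on S (\<lambda>x. f x + g x)"
  by (simp add: smooth_on_def Ck_on_add)

lemma smooth_on_mult:
  fixes f g :: "'e::euclidean_space \<Rightarrow> real"
  shows "open S \<Longrightarrow> smooth_on S f \<Longrightarrow> smooth_on S g \<Longrightarrow> smooth_on S (\<lambda>x. f x * g x)"
  by (simp add: smooth_on_def Ck_on_mult)

lemma smooth_on_minus:
  fixes f g :: "'e::euclidean_space \<Rightarrow> real"
  shows "open S \<Longrightarrow> smooth_on S f \<Longrightarrow> smooth_on S (\<lambda>x. - f x)"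
  using smooth_on_mult[OF _ smooth_on_const[of S "- 1"], of f] by simp

lemma smooth_on_diff:
  fixes f g :: "'e::euclidean_space \<Rightarrow> real"
  shows "open S \<Longrightarrow> smooth_on S f \<Longrightarrow> smooth_on S g \<Longrightarrow> smooth_on S (\<lambda>x. f x - g x)"
  using smooth_on_add[OF _ _ smooth_on_minus, of S f g] by simp

lemma smooth_on_sum:
  assumes "open S" "\<And>i. i \<in> I \<Longrightarrow> smooth_on S (f i)"
  shows "smooth_on S (\<lambda>x. \<Sum>i\<in>I. f i x)"
  using assms(2)
  by (induction I rule: infinite_finite_induct)
    (auto intro!: smooth_on_const smooth_on_add assms(1))

lemma smooth_on_prod:
  fixes f :: "'i \<Rightarrow> 'e::euclidean_space \<Rightarrow> real"
  assumes "open S" "\<And>i. i \<in> I \<Longrightarrow> smooth_on S (f i)"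
  shows "smooth_on S (\<lambda>x. \<Prod>i\<in>I. f i x)"
  using assms(2)
  by (induction I rule: infinite_finite_induct)
    (auto intro!: smooth_on_const smooth_on_mult assms(1))

lemma smooth_on_divide:
  fixes f g :: "'e::euclidean_space \<Rightarrow> real"
  shows "open S \<Longrightarrow> smooth_on S f \<Longrightarrow> smooth_on S g \<Longrightarrow> (\<And>x. x \<in> S \<Longrightarrow> g x \<noteq> 0)
    \<Longrightarrow> smooth_on S (\<lambda>x. f x / g x)"
  by (simp add: smooth_on_def Ck_on_mult Ck_on_inverse divide_inverse)

lemma smooth_on_sqrt:
  fixes f :: "'e::euclidean_space \<Rightarrow> real"
  shows "open S \<Longrightarrow> smooth_on S f \<Longrightarrow> (\<And>x. x \<in> S \<Longrightarrow> f x > 0) \<Longrightarrow> smooth_on S (\<lambda>x. sqrt (f x))"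
  by (simp add: smooth_on_def Ck_on_sqrt)

lemma smooth_on_compose_linear:
  fixes L :: "'e::euclidean_space \<Rightarrow> 'f::euclidean_space"
  assumes "bounded_linear L" "open T" "\<And>x. x \<in> T \<Longrightarrow> L x \<in> S" "smooth_on S f"
  shows "smooth_on T (\<lambda>x. f (L x))"
  using assms unfolding smooth_on_def by (blast intro: Ck_on_compose_linear)

lemma smooth_on_imp_differentiable: "smooth_on S f \<Longrightarrow> x \<in> S \<Longrightarrow> f differentiable at x"
  unfolding smooth_on_def by (metis Ck_on.simps(2))

lemma smooth_on_imp_continuous: "smooth_on S f \<Longrightarrow> continuous_on S f"
  unfolding smooth_on_def by (metis Ck_on.simps(1))

lemma smooth_on_pd: "smooth_on S f \<Longrightarrow> smooth_on S (\<lambda>x. pd f x v)"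
  unfolding smooth_on_def by (metis Ck_on.simps(2))

lemma smooth_on_det:
  fixes A :: "'e::euclidean_space \<Rightarrow> real ^ 'n ^ 'n"
  assumes "open S" "\<And>i j. smooth_on S (\<lambda>x. A x $ i $ j)"
  shows "smooth_on S (\<lambda>x. det (A x))"
  unfolding det_def
  by (intro smooth_on_sum smooth_on_mult smooth_on_prod smooth_on_const assms)

text \<open>Both mixed derivatives are limits of the same symmetric second difference quotient: the mean
  value theorem is applied to it in the two possible orders.\<close>

lemma pd_commute:
  fixes f :: "'e::euclidean_space \<Rightarrow> real"
  assumes S: "open S" "x \<in> S" and f: "smooth_on S f"
  shows "pd (\<lambda>y. pd f y u) x v = pd (\<lambda>y. pd f y v) x u"
proof -
  have key: "\<exists>y\<in>ball x e. (f (x + h *\<^sub>R u + h *\<^sub>R v) - f (x + h *\<^sub>R u) - f (x + h *\<^sub>R v) + f x) / h\<^sup>2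
        = pd (\<lambda>y. pd f y u) y v"
    if e: "ball x e \<subseteq> S" and h: "0 < h" "h * (norm u + norm v) < e" for e h u v
  proof -
    have mem: "x + a *\<^sub>R u + b *\<^sub>R v \<in> ball x e" if "0 \<le> a" "a \<le> h" "0 \<le> b" "b \<le> h" for a b
    proof -
      have "norm (a *\<^sub>R u + b *\<^sub>R v) \<le> a * norm u + b * norm v"
        using norm_triangle_ineq[of "a *\<^sub>R u" "b *\<^sub>R v"] that by simp
      also have "\<dots> \<le> h * norm u + h * norm v"
        using that by (intro add_mono mult_right_mono) auto
      finally show ?thesis using h(2) by (simp add: dist_norm algebra_simps norm_minus_commute)
    qed
    have dline: "((\<lambda>s. g (p + s *\<^sub>R w)) has_real_derivative pd g (p + s *\<^sub>R w) w) (at s)"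
      if "smooth_on S g" "p + s *\<^sub>R w \<in> S" for g :: "'e \<Rightarrow> real" and p w s
    proof -
      have "((\<lambda>s. p + s *\<^sub>R w) has_derivative (\<lambda>s. s *\<^sub>R w)) (at s)"
        by (auto intro!: derivative_eq_intros)
      moreover have gd: "(g has_derivative pd g (p + s *\<^sub>R w)) (at (p + s *\<^sub>R w))"
        using smooth_on_imp_differentiable[OF that] frechet_derivative_works by blast
      ultimately have "((\<lambda>s. g (p + s *\<^sub>R w)) has_derivative (\<lambda>r. pd g (p + s *\<^sub>R w) (r *\<^sub>R w))) (at s)"
        using has_derivative_compose by blast
      moreover have "(\<lambda>r. pd g (p + s *\<^sub>R w) (r *\<^sub>R w)) = (*) (pd g (p + s *\<^sub>R w) w)"
        using linear_cmul[OF has_derivative_linear[OF gd]] by (intro ext) simp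
      ultimately show ?thesis by (simp add: has_field_derivative_def)
    qed
    define \<phi> where "\<phi> a = f (x + h *\<^sub>R v + a *\<^sub>R u) - f (x + a *\<^sub>R u)" for a
    have "\<exists>a>0. a < h \<and> \<phi> h - \<phi> 0 = (h - 0) * (pd f (x + h *\<^sub>R v + a *\<^sub>R u) u - pd f (x + a *\<^sub>R u) u)"
    proof (rule MVT2)
      show "(\<phi> has_real_derivative pd f (x + h *\<^sub>R v + a *\<^sub>R u) u - pd f (x + a *\<^sub>R u) u) (at a)"
        if "0 \<le> a" "a \<le> h" for a
        unfolding \<phi>_def using mem[of a h] mem[of a 0] that h(1) e
        by (intro DERIV_diff dline f) (auto simp: algebra_simps)
    qed (use h in auto)
    then obtain a where a: "0 < a" "a < h"
      and a': "\<phi> h - \<phi> 0 = h * (pd f (x + h *\<^sub>R v + a *\<^sub>R u) u - pd f (x + a *\<^sub>R u) u)" by auto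
    have "\<exists>b>0. b < h \<and> pd f (x + a *\<^sub>R u + h *\<^sub>R v) u - pd f (x + a *\<^sub>R u + 0 *\<^sub>R v) u
        = (h - 0) * (pd (\<lambda>y. pd f y u) (x + a *\<^sub>R u + b *\<^sub>R v) v)"
    proof (rule MVT2)
      show "((\<lambda>b. pd f (x + a *\<^sub>R u + b *\<^sub>R v) u) has_real_derivative
          pd (\<lambda>y. pd f y u) (x + a *\<^sub>R u + b *\<^sub>R v) v) (at b)"
        if "0 \<le> b" "b \<le> h" for b
        using mem[of a b] that a e by (intro dline smooth_on_pd f) auto
    qed (use h in auto)
    then obtain b where b: "0 < b" "b < h"
      and b': "pd f (x + a *\<^sub>R u + h *\<^sub>R v) u - pd f (x + a *\<^sub>R u) u
        = h * (pd (\<lambda>y. pd f y u) (x + a *\<^sub>R u + b *\<^sub>R v) v)" by auto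
    have "f (x + h *\<^sub>R u + h *\<^sub>R v) - f (x + h *\<^sub>R u) - f (x + h *\<^sub>R v) + f x
       = h * (h * (pd (\<lambda>y. pd f y u) (x + a *\<^sub>R u + b *\<^sub>R v) v))"
      using a' b' by (simp add: \<phi>_def algebra_simps)
    moreover have "x + a *\<^sub>R u + b *\<^sub>R v \<in> ball x e" using mem a b by simp
    ultimately show ?thesis using h(1)
      by (intro bexI[of _ "x + a *\<^sub>R u + b *\<^sub>R v"]) (simp_all add: power2_eq_square)
  qed
  let ?P = "\<lambda>u v y. pd (\<lambda>y. pd f y u) y v"
  have cont: "isCont (?P u v) x" for u v
    using continuous_on_eq_continuous_at[OF S(1)] smooth_on_imp_continuous[OF smooth_on_pd[OF smooth_on_pd[OF f]]] S(2)
    by blast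
  have "\<bar>?P u v x - ?P v u x\<bar> < \<epsilon>" if \<epsilon>: "\<epsilon> > 0" for \<epsilon>
  proof -
    obtain d1 where d1: "d1 > 0" "\<And>y. dist y x < d1 \<Longrightarrow> dist (?P u v y) (?P u v x) < \<epsilon>/2"
      using cont[of u v] \<epsilon> unfolding continuous_at_eps_delta by (metis half_gt_zero)
    obtain d2 where d2: "d2 > 0" "\<And>y. dist y x < d2 \<Longrightarrow> dist (?P v u y) (?P v u x) < \<epsilon>/2"
      using cont[of v u] \<epsilon> unfolding continuous_at_eps_delta by (metis half_gt_zero)
    obtain d3 where d3: "d3 > 0" "ball x d3 \<subseteq> S" using S openE by blast
    define e where "e = min d1 (min d2 d3)"
    \<comment> \<open>The added 1 keeps the denominator positive when u = v = 0.\<close>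
    define h where "h = e / (2 * (norm u + norm v + 1))"
    have n: "norm u + norm v + 1 > 0" by (smt (verit) norm_ge_zero)
    have e: "e > 0" "ball x e \<subseteq> S" using d1 d2 d3 by (auto simp: e_def)
    have h: "h > 0" using e n by (simp add: h_def)
    have "h * (norm u + norm v) < h * (2 * (norm u + norm v + 1))"
      using h n by (intro mult_strict_left_mono) auto
    then have he: "h * (norm u + norm v) < e" "h * (norm v + norm u) < e"
      using n by (simp_all add: h_def add.commute)
    obtain y where y: "y \<in> ball x e" "(f (x + h *\<^sub>R u + h *\<^sub>R v) - f (x + h *\<^sub>R u) - f (x + h *\<^sub>R v) + f x) / h\<^sup>2 = ?P u v y"
      using key[OF e(2) h he(1)] by blast
    obtain z where z: "z \<in> ball x e" "(f (x + h *\<^sub>R v + h *\<^sub>R u) - f (x + h *\<^sub>R v) - f (x + h *\<^sub>R u) + f x) / h\<^sup>2 = ?P v u z"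
      using key[OF e(2) h he(2)] by blast
    have "?P u v y = ?P v u z"
      unfolding y(2)[symmetric] z(2)[symmetric] by (simp add: algebra_simps)
    moreover have "dist (?P u v y) (?P u v x) < \<epsilon>/2" "dist (?P v u z) (?P v u x) < \<epsilon>/2"
      using y(1) z(1) d1(2)[of y] d2(2)[of z] by (auto simp: e_def dist_commute)
    ultimately show ?thesis unfolding dist_real_def by linarith
  qed
  then show ?thesis by (metis abs_le_zero_iff eq_iff_diff_eq_0 less_irrefl not_le)
qed

section \<open>Wedge products in low degrees\<close>

lemma alternating_length: "alternating k a \<Longrightarrow> length vs \<noteq> k \<Longrightarrow> a vs = 0"
  by (simp add: alternating_def)

lemma alternating_linear:
  "alternating k a \<Longrightarrow> length vs = k \<Longrightarrow> j < k \<Longrightarrow> linear (\<lambda>v. a (vs[j := v]))"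
  by (simp add: alternating_def)

lemma alternating_1_linear: "alternating 1 a \<Longrightarrow> linear (\<lambda>v. a [v])"
  using alternating_linear[of 1 a "[0]" 0] by simp

lemma alternating_2_linear1: "alternating 2 a \<Longrightarrow> linear (\<lambda>v. a [v, w])"
  using alternating_linear[of 2 a "[0, w]" 0] by simp

lemma alternating_2_linear2: "alternating 2 a \<Longrightarrow> linear (\<lambda>v. a [w, v])"
  using alternating_linear[of 2 a "[w, 0]" 1] by simp

lemma alternating_2_same: "alternating 2 a \<Longrightarrow> a [v, v] = 0"
  by (simp add: alternating_def)

lemma alternating_2_swap:
  assumes "alternating 2 a"
  shows "a [w, v] = - a [v, w]"
proof -
  have "a [v + w, v + w] = a [v, v] + a [v, w] + (a [w, v] + a [w, w])"
    using linear_add[OF alternating_2_linear1[OF assms]] linear_add[OF alternating_2_linear2[OF assms]] by simp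
  then have "a [w, v] + a [v, w] = 0"
    using alternating_2_same[OF assms] by (simp add: add.commute)
  then show ?thesis by (simp only: eq_neg_iff_add_eq_0)
qed

text \<open>A summand with m \<noteq> k hands \<open>a\<close> a list of the wrong length; if the
  total length is not k + l, the summand with m = k hands \<open>b\<close> one.\<close>

lemma wedge_homogeneous:
  fixes a b :: "'e::real_vector list \<Rightarrow> 'b::real_normed_field"
  assumes "alternating k a" "alternating l b"
  shows "(a \<and>\<^sub>c b) vs = (if length vs = k + l then
     (\<Sum>p | p permutes {..<k + l}. of_int (sign p) * a (map (\<lambda>i. vs ! p i) [0..<k]) * b (map (\<lambda>i. vs ! p i) [k..<k + l]))
       / (fact k * fact l) else 0)"
proof -
  let ?n = "length vs"
  let ?f = "\<lambda>m p. of_int (sign p) / (fact m * fact (?n - m))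
          * a (map (\<lambda>i. vs ! p i) [0..<m]) * b (map (\<lambda>i. vs ! p i) [m..<?n])"
  have z: "?f m p = 0" if "m \<le> ?n" "m \<noteq> k \<or> ?n \<noteq> k + l" for m p
  proof (cases "m = k")
    case True
    then have "length (map (\<lambda>i. vs ! p i) [m..<?n]) \<noteq> l" using that by auto
    then show ?thesis using alternating_length[OF assms(2)] by simp
  next
    case False
    then show ?thesis using alternating_length[OF assms(1)] by simp
  qed
  show ?thesis
  proof (cases "?n = k + l")
    case True
    have "(a \<and>\<^sub>c b) vs = (\<Sum>m\<in>{k}. \<Sum>p | p permutes {..<?n}. ?f m p)"
      unfolding wedge_def Let_def
      by (rule sum.mono_neutral_right) (use True z in \<open>auto intro!: sum.neutral\<close>)
    then show ?thesis using True by (simp add: sum_divide_distrib)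
  next
    case False
    then have "(a \<and>\<^sub>c b) vs = 0"
      unfolding wedge_def Let_def by (intro sum.neutral ballI) (use z in auto)
    then show ?thesis using False by simp
  qed
qed

text \<open>The permutations are enumerated by splitting off one element at a time, as
  transpositions composed with permutations of the remaining set. Writing the summand as a function
  of the values of p leaves only index patterns, into which the components of the factors can be
  substituted.\<close>

lemma sum_permutes_2:
  fixes g :: "nat \<Rightarrow> nat \<Rightarrow> 'b::comm_ring_1"
  shows "(\<Sum>p | p permutes {..<2}. of_int (sign p) * g (p 0) (p 1)) =
    g 0 1 - g 1 0"
proof -
  have set: "{..<2::nat} = {0, 1}" by auto
  have "finite {1::nat}" "0 \<notin> {1::nat}"
    by auto
  note i = sum_over_permutations_insert[OF this(1,2)]
  show ?thesis
    unfolding set i permutes_sing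
    by (simp add: sign_swap_id permutation_swap_id permutation_compose sign_compose sign_id transpose_def)
qed

lemma sum_permutes_3:
  fixes g :: "nat \<Rightarrow> nat \<Rightarrow> nat \<Rightarrow> 'b::comm_ring_1"
  shows "(\<Sum>p | p permutes {..<3}. of_int (sign p) * g (p 0) (p 1) (p 2)) =
    g 0 1 2 - g 0 2 1 - g 1 0 2 + g 1 2 0 + g 2 0 1 - g 2 1 0"
proof -
  have set: "{..<3::nat} = {0, 1, 2}" by auto
  have "finite {1, 2::nat}" "0 \<notin> {1, 2::nat}" "finite {2::nat}" "1 \<notin> {2::nat}"
    by auto
  note i = sum_over_permutations_insert[OF this(1,2)] sum_over_permutations_insert[OF this(3,4)]
  show ?thesis
    unfolding set i permutes_sing
    by (simp add: sign_swap_id permutation_swap_id permutation_compose sign_compose sign_id transpose_def)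
qed

lemma sum_permutes_4:
  fixes g :: "nat \<Rightarrow> nat \<Rightarrow> nat \<Rightarrow> nat \<Rightarrow> 'b::comm_ring_1"
  shows "(\<Sum>p | p permutes {..<4}. of_int (sign p) * g (p 0) (p 1) (p 2) (p 3)) =
    g 0 1 2 3 - g 0 1 3 2 - g 0 2 1 3 + g 0 2 3 1 + g 0 3 1 2 - g 0 3 2 1
    - g 1 0 2 3 + g 1 0 3 2 + g 1 2 0 3 - g 1 2 3 0 - g 1 3 0 2 + g 1 3 2 0
    + g 2 0 1 3 - g 2 0 3 1 - g 2 1 0 3 + g 2 1 3 0 + g 2 3 0 1 - g 2 3 1 0
    - g 3 0 1 2 + g 3 0 2 1 + g 3 1 0 2 - g 3 1 2 0 - g 3 2 0 1 + g 3 2 1 0"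
proof -
  have set: "{..<4::nat} = {0, 1, 2, 3}" by auto
  have "finite {1, 2, 3::nat}" "0 \<notin> {1, 2, 3::nat}" "finite {2, 3::nat}" "1 \<notin> {2, 3::nat}" "finite {3::nat}" "2 \<notin> {3::nat}"
    by auto
  note i = sum_over_permutations_insert[OF this(1,2)] sum_over_permutations_insert[OF this(3,4)] sum_over_permutations_insert[OF this(5,6)]
  show ?thesis
    unfolding set i permutes_sing
    by (simp add: sign_swap_id permutation_swap_id permutation_compose sign_compose sign_id transpose_def)
qed

lemma upt_small: "[0..<1] = [0::nat]" "[1..<2] = [1::nat]" "[0..<2] = [0, 1::nat]" "[2..<3] = [2::nat]"
  "[1..<3] = [1, 2::nat]" "[2..<4] = [2, 3::nat]"
  by (simp_all add: upt_rec)

lemma wedge_1_1: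
  fixes a b :: "'e::real_vector list \<Rightarrow> 'b::real_normed_field"
  assumes "alternating 1 a" "alternating 1 b"
  shows "(a \<and>\<^sub>c b) [u, v] = a [u] * b [v] - a [v] * b [u]"
proof -
  let ?g = "\<lambda>i j. a [[u, v] ! i] * b [[u, v] ! j]"
  have eq: "(a \<and>\<^sub>c b) [u, v] = (\<Sum>p | p permutes {..<2}. of_int (sign p) * ?g (p 0) (p 1)) / (fact 1 * fact 1)"
    by (subst wedge_homogeneous[OF assms]) (simp add: upt_small mult.assoc del: One_nat_def)
  have sum: "(\<Sum>p | p permutes {..<2}. of_int (sign p) * ?g (p 0) (p 1)) = fact 1 * fact 1 * (a [u] * b [v] - a [v] * b [u])"
    unfolding sum_permutes_2[of ?g]
    by (simp add: algebra_simps)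
  show ?thesis
    unfolding eq sum by (rule nonzero_mult_div_cancel_left) simp
qed

lemma wedge_1_2:
  fixes a b :: "'e::real_vector list \<Rightarrow> 'b::real_normed_field"
  assumes "alternating 1 a" "alternating 2 b"
  shows "(a \<and>\<^sub>c b) [u, v, w] = a [u] * b [v, w] - a [v] * b [u, w] + a [w] * b [u, v]"
proof -
  let ?g = "\<lambda>i j k. a [[u, v, w] ! i] * b [[u, v, w] ! j, [u, v, w] ! k]"
  have eq: "(a \<and>\<^sub>c b) [u, v, w] = (\<Sum>p | p permutes {..<3}. of_int (sign p) * ?g (p 0) (p 1) (p 2)) / (fact 1 * fact 2)"
    by (subst wedge_homogeneous[OF assms]) (simp add: upt_small mult.assoc del: One_nat_def)
  have sum: "(\<Sum>p | p permutes {..<3}. of_int (sign p) * ?g (p 0) (p 1) (p 2)) = fact 1 * fact 2 * (a [u] * b [v, w] - a [v] * b [u, w] + a [w] * b [u, v])"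
    unfolding sum_permutes_3[of ?g]
    by (simp add: algebra_simps
      alternating_2_swap[OF assms(2), of v u] alternating_2_swap[OF assms(2), of w u]
      alternating_2_swap[OF assms(2), of w v])
  show ?thesis
    unfolding eq sum by (rule nonzero_mult_div_cancel_left) simp
qed

lemma wedge_2_1:
  fixes a b :: "'e::real_vector list \<Rightarrow> 'b::real_normed_field"
  assumes "alternating 2 a" "alternating 1 b"
  shows "(a \<and>\<^sub>c b) [u, v, w] = a [v, w] * b [u] - a [u, w] * b [v] + a [u, v] * b [w]"
proof -
  let ?g = "\<lambda>i j k. a [[u, v, w] ! i, [u, v, w] ! j] * b [[u, v, w] ! k]"
  have eq: "(a \<and>\<^sub>c b) [u, v, w] = (\<Sum>p | p permutes {..<3}. of_int (sign p) * ?g (p 0) (p 1) (p 2)) / (fact 2 * fact 1)"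
    by (subst wedge_homogeneous[OF assms]) (simp add: upt_small mult.assoc del: One_nat_def)
  have sum: "(\<Sum>p | p permutes {..<3}. of_int (sign p) * ?g (p 0) (p 1) (p 2)) = fact 2 * fact 1 * (a [v, w] * b [u] - a [u, w] * b [v] + a [u, v] * b [w])"
    unfolding sum_permutes_3[of ?g]
    by (simp add: algebra_simps
      alternating_2_swap[OF assms(1), of v u] alternating_2_swap[OF assms(1), of w u]
      alternating_2_swap[OF assms(1), of w v])
  show ?thesis
    unfolding eq sum by (rule nonzero_mult_div_cancel_left) simp
qed

text \<open>The 24 permutations form six classes of four that differ by swaps inside the two blocks.
  By antisymmetry a class contributes four equal terms, which cancels the normalisation 2! 2!. In
  degree 3 the classes have two elements.\<close>

lemma wedge_2_2:
  fixes a b :: "'e::real_vector list \<Rightarrow> 'b::real_normed_field"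
  assumes "alternating 2 a" "alternating 2 b"
  shows "(a \<and>\<^sub>c b) [u, v, w, x] = a [u, v] * b [w, x] - a [u, w] * b [v, x] + a [u, x] * b [v, w]
    + a [v, w] * b [u, x] - a [v, x] * b [u, w] + a [w, x] * b [u, v]"
proof -
  let ?g = "\<lambda>i j k m. a [[u, v, w, x] ! i, [u, v, w, x] ! j] * b [[u, v, w, x] ! k, [u, v, w, x] ! m]"
  have eq: "(a \<and>\<^sub>c b) [u, v, w, x] = (\<Sum>p | p permutes {..<4}. of_int (sign p) * ?g (p 0) (p 1) (p 2) (p 3)) / (fact 2 * fact 2)"
    by (subst wedge_homogeneous[OF assms]) (simp add: upt_small mult.assoc del: One_nat_def)
  have sum: "(\<Sum>p | p permutes {..<4}. of_int (sign p) * ?g (p 0) (p 1) (p 2) (p 3)) = fact 2 * fact 2 * (a [u, v] * b [w, x] - a [u, w] * b [v, x] + a [u, x] * b [v, w]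
    + a [v, w] * b [u, x] - a [v, x] * b [u, w] + a [w, x] * b [u, v])"
    unfolding sum_permutes_4[of ?g]
    by (simp add: algebra_simps
      alternating_2_swap[OF assms(1), of v u] alternating_2_swap[OF assms(1), of w u]
      alternating_2_swap[OF assms(1), of x u] alternating_2_swap[OF assms(1), of w v]
      alternating_2_swap[OF assms(1), of x v] alternating_2_swap[OF assms(1), of x w]
      alternating_2_swap[OF assms(2), of v u] alternating_2_swap[OF assms(2), of w u]
      alternating_2_swap[OF assms(2), of x u] alternating_2_swap[OF assms(2), of w v]
      alternating_2_swap[OF assms(2), of x v] alternating_2_swap[OF assms(2), of x w])
  show ?thesis
    unfolding eq sum by (rule nonzero_mult_div_cancel_left) simp
qed

lemma wedge_degree:
  fixes a b :: "'e::real_vector list \<Rightarrow> 'b::real_normed_field"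
  assumes "alternating k a" "alternating l b" "length vs \<noteq> k + l"
  shows "(a \<and>\<^sub>c b) vs = 0"
  using wedge_homogeneous[OF assms(1,2)] assms(3) by simp

text \<open>Linearity holds summand by summand: for a permutation p, slot j lands at position
  \<open>inv p j\<close>, which lies in exactly one of the two blocks. If two entries coincide,
  composing with their transposition keeps the arguments and flips the sign, so the sum equals its
  own negative.\<close>

lemma alternating_wedge:
  fixes a b :: "'e::real_vector list \<Rightarrow> 'b::real_normed_field"
  assumes a: "alternating k a" and b: "alternating l b"
  shows "alternating (k + l) (a \<and>\<^sub>c b)"
proof -
  let ?t = "\<lambda>vs p. of_int (sign p) * a (map (\<lambda>i. vs ! p i) [0..<k]) * b (map (\<lambda>i. vs ! p i) [k..<k + l])"
  have lin: "linear (\<lambda>v. (a \<and>\<^sub>c b) (vs[j := v]))" if vs: "length vs = k + l" and j: "j < k + l" for vs j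
  proof -
    have "linear (\<lambda>v. ?t (vs[j := v]) p)" if p: "p permutes {..<k + l}" for p
    proof -
      define m where "m = inv p j"
      have m: "p m = j" "m < k + l"
        using permutes_inverses(1)[OF p] permutes_in_image[OF permutes_inv[OF p], of j] j by (auto simp: m_def)
      have p_lt: "p i < k + l" if "i < k + l" for i
        using permutes_in_image[OF p, of i] that by simp
      have nth: "vs[j := v] ! p i = (if i = m then v else vs ! p i)" if "i < k + l" for i v
      proof -
        have "j = p i \<longleftrightarrow> i = m" using m(1) permutes_inj[OF p] by (metis injD)
        then show ?thesis using p_lt[OF that] vs m(1) j by (simp add: nth_list_update)
      qed
      show ?thesis
      proof (cases "m < k")
        case True
        have A: "map (\<lambda>i. vs[j := v] ! p i) [0..<k] = (map (\<lambda>i. vs ! p i) [0..<k])[m := v]" for v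
          using True by (auto intro!: nth_equalityI simp: nth nth_list_update)
        have B: "map (\<lambda>i. vs[j := v] ! p i) [k..<k + l] = map (\<lambda>i. vs ! p i) [k..<k + l]" for v
          using True by (auto simp: nth)
        have "linear (\<lambda>v. of_int (sign p) * (a ((map (\<lambda>i. vs ! p i) [0..<k])[m := v]) * b (map (\<lambda>i. vs ! p i) [k..<k + l])))"
          using alternating_linear[OF a, of "map (\<lambda>i. vs ! p i) [0..<k]" m] True
          by (auto simp: linear_iff algebra_simps)
        then show ?thesis unfolding A B by (simp add: mult.assoc)
      next
        case False
        have A: "map (\<lambda>i. vs[j := v] ! p i) [0..<k] = map (\<lambda>i. vs ! p i) [0..<k]" for v
          using False by (auto simp: nth)
        have B: "map (\<lambda>i. vs[j := v] ! p i) [k..<k + l] = (map (\<lambda>i. vs ! p i) [k..<k + l])[m - k := v]" for v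
          using False m(2) by (auto intro!: nth_equalityI simp: nth nth_list_update)
        have "linear (\<lambda>v. of_int (sign p) * (a (map (\<lambda>i. vs ! p i) [0..<k]) * b ((map (\<lambda>i. vs ! p i) [k..<k + l])[m - k := v])))"
          using alternating_linear[OF b, of "map (\<lambda>i. vs ! p i) [k..<k + l]" "m - k"] False m
          by (auto simp: linear_iff algebra_simps)
        then show ?thesis unfolding A B by (simp add: mult.assoc)
      qed
    qed
    then have "linear (\<lambda>v. \<Sum>p | p permutes {..<k + l}. ?t (vs[j := v]) p)"
      by (intro linear_compose_sum) auto
    then show ?thesis
      unfolding wedge_homogeneous[OF a b] using vs by (auto simp: linear_iff divide_inverse distrib_right)
  qed
  have alt: "(a \<and>\<^sub>c b) vs = 0" if vs: "length vs = k + l" "\<not> distinct vs" for vs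
  proof -
    obtain i j where ij: "i < k + l" "j < k + l" "i \<noteq> j" "vs ! i = vs ! j"
      using vs by (auto simp: distinct_conv_nth)
    have q: "Transposition.transpose i j permutes {..<k + l}" using ij by (intro permutes_swap_id) auto
    have same: "vs ! Transposition.transpose i j m = vs ! m" for m using ij by (auto simp: Transposition.transpose_def)
    have "?t vs (Transposition.transpose i j \<circ> p) = - ?t vs p" if "p permutes {..<k + l}" for p
    proof -
      have "permutation p" using that by (auto intro: permutes_imp_permutation)
      then have "sign (Transposition.transpose i j \<circ> p) = - sign p"
        using ij by (simp add: sign_compose permutation_swap_id sign_swap_id)
      then show ?thesis by (simp add: same)
    qed
    then have "(\<Sum>p | p permutes {..<k + l}. ?t vs p) = (\<Sum>p | p permutes {..<k + l}. - ?t vs p)"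
      by (subst setum_permutations_compose_left[OF q]) (auto intro!: sum.cong)
    then have "(\<Sum>p | p permutes {..<k + l}. ?t vs p) = 0"
      by (simp add: sum_negf equal_neg_zero)
    then show ?thesis unfolding wedge_homogeneous[OF a b] using vs by simp
  qed
  show ?thesis
    unfolding alternating_def using wedge_degree[OF a b] lin alt by blast
qed

text \<open>Every permutation sends u into the block of \<open>a\<close> or into that of
  \<open>b\<close>, and either factor then vanishes.\<close>

lemma wedge_annihilated:
  assumes "\<And>us. u \<in> set us \<Longrightarrow> a us = 0" "\<And>us. u \<in> set us \<Longrightarrow> b us = 0" "u \<in> set vs"
  shows "(a \<and>\<^sub>c b) vs = 0"
proof -
  let ?n = "length vs"
  obtain m where m: "m < ?n" "vs ! m = u" using assms(3) by (auto simp: in_set_conv_nth)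
  have "of_int (sign p) / (fact k * fact (?n - k)) * a (map (\<lambda>i. vs ! p i) [0..<k])
      * b (map (\<lambda>i. vs ! p i) [k..<?n]) = 0" if p: "p permutes {..<?n}" and "k \<le> ?n" for p k
  proof -
    have q: "p (inv p m) = m" "inv p m < ?n"
      using permutes_inverses(1)[OF p] permutes_in_image[OF permutes_inv[OF p], of m] m by auto
    then have "u \<in> (\<lambda>i. vs ! p i) ` {0..<k} \<or> u \<in> (\<lambda>i. vs ! p i) ` {k..<?n}"
      using m by (metis atLeastLessThan_iff image_eqI le0 not_le)
    then have "a (map (\<lambda>i. vs ! p i) [0..<k]) = 0 \<or> b (map (\<lambda>i. vs ! p i) [k..<?n]) = 0"
      using assms(1)[of "map (\<lambda>i. vs ! p i) [0..<k]"] assms(2)[of "map (\<lambda>i. vs ! p i) [k..<?n]"] by auto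
    then show ?thesis by auto
  qed
  then show ?thesis unfolding wedge_def Let_def by (intro sum.neutral ballI) auto
qed

section \<open>Linear algebra: kernels of forms and determinantal solutions\<close>

lemma alternating_top_nondegenerate:
  fixes \<Theta> :: "'e::euclidean_space list \<Rightarrow> real"
  assumes \<Theta>: "alternating DIM('e) \<Theta>" and xs: "\<Theta> xs \<noteq> 0" and zero: "\<And>vs. u \<in> set vs \<Longrightarrow> \<Theta> vs = 0"
  shows "u = 0"
proof -
  let ?n = "DIM('e)"
  have len: "length xs = ?n" using alternating_length[OF \<Theta>] xs by blast
  obtain bs :: "'e list" where bs: "set bs = Basis" "distinct bs" using finite_distinct_list[OF finite_Basis] by blast
  then have lbs: "length bs = ?n" using distinct_card by fastforce
  \<comment> \<open>Up to the factor \<open>\<Theta> xs\<close>, these are the coordinates of y in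
    the basis \<open>xs\<close>. Replacing a different entry by \<open>xs ! i\<close> creates a
    repetition, so \<phi> maps \<open>xs ! i\<close> to a nonzero multiple of a basis vector. Hence
    \<phi> is onto and therefore injective, while it kills u.\<close>
  define \<phi> where "\<phi> y = (\<Sum>j<?n. \<Theta> (xs[j := y]) *\<^sub>R bs ! j)" for y
  have lin: "linear \<phi>"
    using alternating_linear[OF \<Theta> len] unfolding \<phi>_def
    by (intro linear_compose_sum ballI) (auto simp: linear_iff scaleR_add_left)
  have "\<phi> (xs ! i) = \<Theta> xs *\<^sub>R bs ! i" if i: "i < ?n" for i
  proof -
    have "\<Theta> (xs[j := xs ! i]) = 0" if "j < ?n" "j \<noteq> i" for j
    proof -
      have "\<not> distinct (xs[j := xs ! i])"
        using that i len nth_eq_iff_index_eq[of "xs[j := xs ! i]" i j] by auto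
      then show ?thesis using \<Theta> len unfolding alternating_def by simp
    qed
    then have "\<phi> (xs ! i) = (\<Sum>j<?n. if j = i then \<Theta> xs *\<^sub>R bs ! i else 0)"
      unfolding \<phi>_def by (intro sum.cong) auto
    then show ?thesis using i by simp
  qed
  then have "bs ! i \<in> range \<phi>" if "i < ?n" for i
    using that xs linear_cmul[OF lin, of "inverse (\<Theta> xs)" "xs ! i"]
    by (intro image_eqI[of _ _ "inverse (\<Theta> xs) *\<^sub>R xs ! i"]) auto
  then have "Basis \<subseteq> range \<phi>" using bs lbs by (metis in_set_conv_nth subsetI)
  then have "surj \<phi>"
    using span_minimal[of Basis "range \<phi>"] linear_subspace_image[OF lin subspace_UNIV] by (simp add: top.extremum_unique)
  then have inj: "inj \<phi>" using lin linear_surjective_imp_injective by blast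
  have "\<phi> u = 0"
    unfolding \<phi>_def using len by (intro sum.neutral) (simp add: zero set_update_memI)
  then show ?thesis using inj lin by (metis injD linear_0)
qed

text \<open>The solution is given as a quotient of determinants, rather than merely asserted to
  exist, so that its smooth dependence on a parameter can be read off when B and \<beta> vary with
  the point.\<close>

lemma cramer_bilinear:
  fixes B :: "real ^ 'n \<Rightarrow> real ^ 'n \<Rightarrow> real"
  assumes lin: "\<And>u. linear (\<lambda>y. B y u)" "\<And>y. linear (B y)" and \<beta>: "linear \<beta>"
    and det: "det (\<chi> i j. B (axis j 1) (axis i 1)) \<noteq> 0"
  shows "B (\<chi> k. det (\<chi> i j. if j = k then \<beta> (axis i 1) else B (axis j 1) (axis i 1)) /
    det (\<chi> i j. B (axis j 1) (axis i 1))) u = \<beta> u"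
proof -
  let ?A = "\<chi> i j. B (axis j 1) (axis i 1)"
  let ?b = "\<chi> i. \<beta> (axis i 1)"
  define y where "y = (\<chi> k. det (\<chi> i j. if j = k then \<beta> (axis i 1) else B (axis j 1) (axis i 1)) / det ?A)"
  have "(\<chi> i j. if j = k then ?b $ i else ?A $ i $ j) = (\<chi> i j. if j = k then \<beta> (axis i 1) else B (axis j 1) (axis i 1))" for k
    by (simp add: vec_eq_iff)
  then have "?A *v y = ?b" unfolding cramer[OF det] y_def by simp
  moreover have "(?A *v y) $ i = B y (axis i 1)" for i
  proof -
    have "B y (axis i 1) = B (\<Sum>j\<in>UNIV. y $ j *s axis j 1) (axis i 1)" by (simp add: basis_expansion)
    also have "\<dots> = (\<Sum>j\<in>UNIV. y $ j * B (axis j 1) (axis i 1))"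
      by (simp add: linear_sum[OF lin(1)] linear_cmul[OF lin(1)] scalar_mult_eq_scaleR)
    finally show ?thesis by (simp add: matrix_vector_mult_def mult.commute)
  qed
  ultimately have eq: "B y (axis i 1) = \<beta> (axis i 1)" for i by (metis vec_lambda_beta)
  have "B y u = B y (\<Sum>j\<in>UNIV. u $ j *s axis j 1)" by (simp add: basis_expansion)
  also have "\<dots> = \<beta> (\<Sum>j\<in>UNIV. u $ j *s axis j 1)"
    by (simp add: linear_sum[OF lin(2)] linear_cmul[OF lin(2)] linear_sum[OF \<beta>] linear_cmul[OF \<beta>] eq scalar_mult_eq_scaleR)
  finally show ?thesis by (simp add: basis_expansion y_def)
qed

lemma det_nonzero_bilinear:
  fixes B :: "real ^ 'n \<Rightarrow> real ^ 'n \<Rightarrow> real"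
  assumes lin: "\<And>u. linear (\<lambda>y. B y u)" "\<And>y. linear (B y)"
  shows "det (\<chi> i j. B (axis j 1) (axis i 1)) \<noteq> 0 \<longleftrightarrow> (\<forall>y. (\<forall>u. B y u = 0) \<longrightarrow> y = 0)"
proof -
  let ?A = "\<chi> i j. B (axis j 1) (axis i 1)"
  have A: "(?A *v y) $ i = B y (axis i 1)" for i y
  proof -
    have "B y (axis i 1) = B (\<Sum>j\<in>UNIV. y $ j *s axis j 1) (axis i 1)" by (simp add: basis_expansion)
    also have "\<dots> = (\<Sum>j\<in>UNIV. y $ j * B (axis j 1) (axis i 1))"
      by (simp add: linear_sum[OF lin(1)] linear_cmul[OF lin(1)] scalar_mult_eq_scaleR)
    finally show ?thesis by (simp add: matrix_vector_mult_def mult.commute)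
  qed
  have ker: "?A *v y = 0 \<longleftrightarrow> (\<forall>u. B y u = 0)" for y
  proof
    assume "?A *v y = 0"
    then have z: "B y (axis i 1) = 0" for i using A by (metis zero_index)
    have "B y u = B y (\<Sum>j\<in>UNIV. u $ j *s axis j 1)" for u by (simp add: basis_expansion)
    then show "\<forall>u. B y u = 0"
      by (simp add: linear_sum[OF lin(2)] linear_cmul[OF lin(2)] z scalar_mult_eq_scaleR)
  qed (simp add: vec_eq_iff A)
  have "det ?A \<noteq> 0 \<longleftrightarrow> (\<forall>y. ?A *v y = 0 \<longrightarrow> y = 0)"
    by (rule trans[OF trans[OF invertible_det_nz[symmetric] invertible_left_inverse] matrix_left_invertible_ker])
  then show ?thesis by (simp only: ker)
qed

text \<open>A skew matrix A of odd size n satisfies det A = det (-A) = (-1)^n det A = - det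
  A.\<close>

lemma alternating_2_odd_degenerate:
  fixes a :: "(real ^ 'n) list \<Rightarrow> real"
  assumes a: "alternating 2 a" and odd: "odd CARD('n)"
  shows "\<exists>y. y \<noteq> 0 \<and> (\<forall>u. a [y, u] = 0)"
proof -
  let ?A = "\<chi> i j. a [axis j 1, axis i 1] :: real ^ 'n ^ 'n"
  have "transpose ?A = (\<chi> i. (- 1) *s ?A $ i)"
    by (simp add: Finite_Cartesian_Product.transpose_def vec_eq_iff) (blast intro: alternating_2_swap[OF a])
  then have "det ?A = det (\<chi> i. (- 1) *s ?A $ i)" by (metis det_transpose)
  also have "\<dots> = - det ?A"
    using odd by (subst det_rows_mul) simp
  finally have "det ?A = 0" by simp
  then show ?thesis
    using det_nonzero_bilinear[of "\<lambda>y u. a [y, u]"] alternating_2_linear1[OF a] alternating_2_linear2[OF a]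
    by blast
qed

section \<open>Pointwise \<open>SU(2)\<close>-structures\<close>

text \<open>An SU(2)-structure frozen at one point of a chart, so that the statements below are
  linear algebra. Their smooth versions come from applying the same formulas at every point.\<close>

locale su2_point =
  fixes h :: "(real ^ 5) list \<Rightarrow> real" and w :: "nat \<Rightarrow> (real ^ 5) list \<Rightarrow> real" and v
  assumes h: "alternating 1 h" and w: "a \<in> {1, 2, 3} \<Longrightarrow> alternating 2 (w a)" and v: "alternating 4 v"
    and square: "a \<in> {1, 2, 3} \<Longrightarrow> w a \<and>\<^sub>c w a = v"
    and orthogonal: "a \<in> {1, 2, 3} \<Longrightarrow> b \<in> {1, 2, 3} \<Longrightarrow> a \<noteq> b \<Longrightarrow> w a \<and>\<^sub>c w b = 0"
    and volume: "v \<and>\<^sub>c h \<noteq> 0"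
    and positive: "X \<lrcorner> w 1 = Y \<lrcorner> w 2 \<Longrightarrow> w 3 [X, Y] \<ge> 0"
begin

lemma w_lin: "a \<in> {1, 2, 3} \<Longrightarrow> linear (\<lambda>x. w a [x, y])" "a \<in> {1, 2, 3} \<Longrightarrow> linear (\<lambda>x. w a [y, x])"
  using alternating_2_linear1 alternating_2_linear2 w by blast+

lemma h_lin: "linear (\<lambda>x. h [x])"
  by (rule alternating_1_linear[OF h])

lemma w_swap: "a \<in> {1, 2, 3} \<Longrightarrow> w a [y, x] = - w a [x, y]"
  using alternating_2_swap w by blast

lemma w_same: "a \<in> {1, 2, 3} \<Longrightarrow> w a [x, x] = 0"
  using alternating_2_same w by blast

lemma v_formula:
  "a \<in> {1, 2, 3} \<Longrightarrow> v [x, y, z, u] = 2 * (w a [x, y] * w a [z, u] - w a [x, z] * w a [y, u] + w a [x, u] * w a [y, z])"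
  using wedge_2_2[OF w w, of a a x y z u] square[of a] by simp

lemma orthogonal_formula:
  "a \<in> {1, 2, 3} \<Longrightarrow> b \<in> {1, 2, 3} \<Longrightarrow> a \<noteq> b \<Longrightarrow>
    w a [x, y] * w b [z, u] - w a [x, z] * w b [y, u] + w a [x, u] * w b [y, z]
      + w a [y, z] * w b [x, u] - w a [y, u] * w b [x, z] + w a [z, u] * w b [x, y] = 0"
  using wedge_2_2[OF w w, of a b x y z u] orthogonal[of a b] by simp

text \<open>A vector killed by both \<open>v\<close> and \<open>h\<close> is killed by the volume
  form v \<and> h, which has top degree and is nonzero. This is the cancellation principle of the
  section: to show that a vector vanishes, test it against \<open>v\<close> and
  \<open>h\<close>.\<close>

lemma v_kernel:
  assumes k: "\<And>y z u. v [x, y, z, u] = 0" and "h [x] = 0"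
  shows "x = 0"
proof -
  have "v us = 0" if "x \<in> set us" for us
  proof (cases "length us = 4")
    case True
    then obtain p q r s where us: "us = [p, q, r, s]"
      by (auto simp: numeral_eq_Suc length_Suc_conv)
    have 1: "(1::nat) \<in> {1, 2, 3}" by simp
    have sw: "v [p, x, r, s] = - v [x, p, r, s]" "v [p, q, x, s] = v [x, p, q, s]" "v [p, q, r, x] = - v [x, p, q, r]"
      unfolding v_formula[OF 1]
      using w_swap[OF 1, of x p] w_swap[OF 1, of x q] w_swap[OF 1, of x r]
      by (simp_all add: algebra_simps)
    show ?thesis using that sw k unfolding us by auto
  next
    case False
    then show ?thesis using alternating_length[OF v] by blast
  qed
  moreover have "h us = 0" if "x \<in> set us" for us
  proof (cases "length us = 1")
    case True
    then have "us = [x]" using that by (cases us) auto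
    then show ?thesis using assms(2) by simp
  next
    case False
    then show ?thesis using alternating_length[OF h] by blast
  qed
  ultimately have "(v \<and>\<^sub>c h) us = 0" if "x \<in> set us" for us
    using that by (intro wedge_annihilated[of x v h us])
  moreover have "alternating DIM(real ^ 5) (v \<and>\<^sub>c h)"
    using alternating_wedge[OF v h] by simp
  moreover obtain xs where "(v \<and>\<^sub>c h) xs \<noteq> 0" using volume by (auto simp: fun_eq_iff)
  ultimately show ?thesis using alternating_top_nondegenerate[of "v \<and>\<^sub>c h" xs x] by simp
qed

lemma w_kernel:
  assumes "a \<in> {1, 2, 3}" "\<And>u. w a [x, u] = 0" "h [x] = 0"
  shows "x = 0"
  using v_kernel[of x] assms by (simp add: v_formula[OF assms(1)])

text \<open>The dimension is odd, so each \<open>w a\<close> has a kernel vector, and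
  \<open>w_kernel\<close> shows that \<open>h\<close> does not vanish on it. Kernel vectors of two
  different \<open>w a\<close> both annihilate the common square \<open>v\<close>. Rescaled to equal
  values of \<open>h\<close>, their difference is zero by \<open>v_kernel\<close>, so all three
  kernels are the same line, the Reeb direction.\<close>

lemma kernel_vector: "\<exists>\<xi>. h [\<xi>] \<noteq> 0 \<and> (\<forall>a\<in>{1, 2, 3}. \<forall>u. w a [\<xi>, u] = 0)"
proof -
  have ex: "\<exists>\<xi>. \<xi> \<noteq> 0 \<and> (\<forall>u. w a [\<xi>, u] = 0)" if "a \<in> {1, 2, 3}" for a
    using alternating_2_odd_degenerate[OF w[OF that]] by simp
  obtain \<xi> where \<xi>: "\<xi> \<noteq> 0" "\<And>u. w 1 [\<xi>, u] = 0" using ex[of 1] by auto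
  then have h\<xi>: "h [\<xi>] \<noteq> 0" using w_kernel[of 1 \<xi>] by auto
  have "w a [\<xi>, u] = 0" if a: "a \<in> {1, 2, 3}" for a u
  proof -
    obtain \<zeta> where \<zeta>: "\<zeta> \<noteq> 0" "\<And>u. w a [\<zeta>, u] = 0" using ex[OF a] by auto
    then have h\<zeta>: "h [\<zeta>] \<noteq> 0" using w_kernel[OF a] by auto
    define c where "c = h [\<xi>] / h [\<zeta>]"
    have "v [\<xi> - c *\<^sub>R \<zeta>, y, z, u] = 0" for y z u
    proof -
      have lin: "linear (\<lambda>x. v [x, y, z, u])"
        using alternating_linear[OF v, of "[0, y, z, u]" 0] by simp
      have "v [\<xi>, y, z, u] = 0" "v [\<zeta>, y, z, u] = 0"
        using v_formula[of 1 \<xi> y z u] v_formula[OF a, of \<zeta> y z u] \<xi> \<zeta> by auto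
      then show ?thesis using linear_diff[OF lin] linear_cmul[OF lin] by simp
    qed
    moreover have "h [\<xi> - c *\<^sub>R \<zeta>] = 0"
      using linear_diff[OF h_lin] linear_cmul[OF h_lin] h\<zeta> by (simp add: c_def)
    ultimately have "\<xi> - c *\<^sub>R \<zeta> = 0" by (rule v_kernel)
    then have "\<xi> = c *\<^sub>R \<zeta>" by simp
    then show ?thesis using linear_cmul[OF w_lin(1)[OF a], of c \<zeta> u] \<zeta> by simp
  qed
  then show ?thesis using h\<xi> by blast
qed

text \<open>The summand \<open>h \<otimes> h\<close> turns the degenerate form \<open>w a\<close> into an invertible bilinear form without
  changing the solutions \<open>y\<close> of \<open>w a(y, \<cdot>) = \<beta>\<close> with \<open>h(y) = 0\<close>; in a chart those solutions are then
  given by Cramer's rule and hence smooth.\<close>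

definition gram :: "nat \<Rightarrow> real ^ 5 \<Rightarrow> real ^ 5 \<Rightarrow> real" where
  "gram a y u = w a [y, u] + h [y] * h [u]"

lemma gram_lin:
  assumes "a \<in> {1, 2, 3}"
  shows "linear (\<lambda>y. gram a y u)" "linear (gram a y)"
  using w_lin[OF assms] h_lin unfolding gram_def linear_iff by (auto simp: algebra_simps)

text \<open>Evaluation at the Reeb vector \<xi> removes \<open>w a\<close> and \<beta> and leaves
  h(y) h(\<xi>) = 0. So h(y) = 0, and the added summand drops out of the equation.\<close>

lemma gram_eq_iff:
  assumes a: "a \<in> {1, 2, 3}" and \<beta>: "\<And>\<xi>. (\<forall>b\<in>{1, 2, 3}. \<forall>u. w b [\<xi>, u] = 0) \<Longrightarrow> \<beta> \<xi> = 0"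
    and eq: "\<And>u. gram a y u = \<beta> u"
  shows "w a [y, u] = \<beta> u" "h [y] = 0"
proof -
  obtain \<xi> where \<xi>: "h [\<xi>] \<noteq> 0" "\<forall>a\<in>{1, 2, 3}. \<forall>u. w a [\<xi>, u] = 0" using kernel_vector by blast
  then have "w a [y, \<xi>] = 0" using w_swap[OF a, of \<xi> y] a by auto
  then show "h [y] = 0" using eq[of \<xi>] \<beta>[OF \<xi>(2)] \<xi>(1) by (simp add: gram_def)
  then show "w a [y, u] = \<beta> u" using eq[of u] by (simp add: gram_def)
qed

lemma gram_det:
  assumes a: "a \<in> {1, 2, 3}"
  shows "det (\<chi> i j. gram a (axis j 1) (axis i 1)) \<noteq> 0"
  unfolding det_nonzero_bilinear[OF gram_lin[OF a]]
proof (intro allI impI)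
  fix y assume "\<forall>u. gram a y u = 0"
  then show "y = 0" using gram_eq_iff[OF a, of "\<lambda>_. 0" y] w_kernel[OF a, of y] by simp
qed

lemma w_solve:
  assumes a: "a \<in> {1, 2, 3}" and \<beta>: "linear \<beta>" "\<And>\<xi>. (\<forall>b\<in>{1, 2, 3}. \<forall>u. w b [\<xi>, u] = 0) \<Longrightarrow> \<beta> \<xi> = 0"
  shows "\<exists>y. h [y] = 0 \<and> (\<forall>u. w a [y, u] = \<beta> u)"
  using gram_eq_iff[OF a \<beta>(2) cramer_bilinear[OF gram_lin[OF a] \<beta>(1) gram_det[OF a]]] by blast

lemma w_transfer:
  assumes "a \<in> {1, 2, 3}" "b \<in> {1, 2, 3}"
  shows "\<exists>y. \<forall>u. w b [y, u] = w a [x, u]"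
proof -
  have "w a [x, \<xi>] = 0" if "\<forall>b\<in>{1, 2, 3}. \<forall>u. w b [\<xi>, u] = 0" for \<xi>
    using that w_swap[OF assms(1), of \<xi> x] assms(1) by auto
  then show ?thesis using w_solve[OF assms(2) w_lin(2)[OF assms(1)], of x] by blast
qed

text \<open>The endomorphism \<open>J\<close> of \<open>ker h\<close> with \<open>\<omega>\<^sub>b(J x, \<cdot>) = \<omega>\<^sub>a(x, \<cdot>)\<close> squares to \<open>-1\<close>.\<close>

lemma w_transfer_square:
  assumes a: "a \<in> {1, 2, 3}" and b: "b \<in> {1, 2, 3}" and "a \<noteq> b" and xy: "\<And>u. w b [y, u] = w a [x, u]"
  shows "w a [y, u] = - w b [x, u]"
proof -
  define \<beta> where "\<beta> u = w a [y, u] + w b [x, u]" for u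
  have lin: "linear \<beta>"
    unfolding \<beta>_def by (intro linear_compose_add w_lin a b)
  have "\<beta> \<xi> = 0" if "\<forall>b\<in>{1, 2, 3}. \<forall>u. w b [\<xi>, u] = 0" for \<xi>
  proof -
    have "w a [\<xi>, y] = 0" "w b [\<xi>, x] = 0" using that a b by blast+
    then show ?thesis using w_swap[OF a, of \<xi> y] w_swap[OF b, of \<xi> x] by (simp add: \<beta>_def)
  qed
  then obtain z where z: "h [z] = 0" "\<And>u. w a [z, u] = \<beta> u" using w_solve[OF a lin] by blast
  \<comment> \<open>Contracting \<open>w a \<and>\<^sub>c w a = w b \<and>\<^sub>c w b\<close> with
    y and \<open>w a \<and>\<^sub>c w b = 0\<close> with x gives \<beta> \<and> \<open>w a\<close> =
    0. Since \<beta> is the contraction of \<open>w a\<close> with z, this is half of the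
    contraction of \<open>v\<close> with z.\<close>
  have "v [z, p, q, r] = 0" for p q r
  proof -
    have "w a [y, p] * w a [q, r] - w a [y, q] * w a [p, r] + w a [y, r] * w a [p, q]
        = w a [x, p] * w b [q, r] - w a [x, q] * w b [p, r] + w a [x, r] * w b [p, q]"
      using v_formula[OF a, of y p q r] v_formula[OF b, of y p q r] by (simp add: xy)
    then have "\<beta> p * w a [q, r] - \<beta> q * w a [p, r] + \<beta> r * w a [p, q] = 0"
      using orthogonal_formula[OF a b \<open>a \<noteq> b\<close>, of x p q r] unfolding \<beta>_def by (simp add: algebra_simps)
    then show ?thesis unfolding v_formula[OF a] z(2) by simp
  qed
  then have "z = 0" using z(1) by (rule v_kernel)
  then show ?thesis
    using z(2)[of u] linear_0[OF w_lin(1)[OF a], of u] by (simp add: \<beta>_def)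
qed

declare One_nat_def [simp del]

text \<open>Once r > 0, r is the squared length of X modulo the Reeb direction, in the metric that
  makes the final coframe orthonormal. For the dual vectors E1, ..., E4 of that coframe, X is
  \<surd>r E1 and Y is \<surd>r E4 up to Reeb components; this is where the factor \<surd>r comes
  from.\<close>

context
  fixes X Y r
  assumes XY: "\<And>u. w 2 [Y, u] = w 1 [X, u]" and r: "r = w 3 [X, Y]"
begin

lemma w1_Y: "w 1 [Y, u] = - w 2 [X, u]"
  using w_transfer_square[of 1 2 Y X u] XY by simp

lemma w12_XY: "w 1 [X, Y] = 0" "w 2 [X, Y] = 0"
  using XY[of Y] w1_Y[of Y] w_same[of 1 Y] w_same[of 2 Y] by simp_all

text \<open>Evaluating \<open>\<omega>\<^sub>1 \<and> \<omega>\<^sub>3 = 0\<close>, \<open>\<omega>\<^sub>2 \<and> \<omega>\<^sub>3 = 0\<close> and \<open>\<omega>\<^sub>1 \<and> \<omega>\<^sub>1 = \<omega>\<^sub>3 \<and> \<omega>\<^sub>3\<close> on \<open>(X, Y, z, u)\<close> already exhibits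
  the adapted coframe \<open>- \<omega>\<^sub>3(Y, \<cdot>), \<omega>\<^sub>1(X, \<cdot>), \<omega>\<^sub>2(X, \<cdot>), \<omega>\<^sub>3(X, \<cdot>)\<close>, up to the factor \<open>\<surd>r\<close>.\<close>

lemma w1_split:
  "r * w 1 [z, u] = (- w 3 [Y, z]) * w 1 [X, u] - (- w 3 [Y, u]) * w 1 [X, z]
      + (w 2 [X, z] * w 3 [X, u] - w 2 [X, u] * w 3 [X, z])"
  using orthogonal_formula[of 1 3 X Y z u] by (simp add: w12_XY r w1_Y algebra_simps)

lemma w2_split:
  "r * w 2 [z, u] = (- w 3 [Y, z]) * w 2 [X, u] - (- w 3 [Y, u]) * w 2 [X, z]
      + (w 3 [X, z] * w 1 [X, u] - w 3 [X, u] * w 1 [X, z])"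
  using orthogonal_formula[of 2 3 X Y z u] by (simp add: w12_XY r XY algebra_simps)

lemma w3_split:
  "r * w 3 [z, u] = (- w 3 [Y, z]) * w 3 [X, u] - (- w 3 [Y, u]) * w 3 [X, z]
      + (w 1 [X, z] * w 2 [X, u] - w 1 [X, u] * w 2 [X, z])"
  using v_formula[of 1 X Y z u] v_formula[of 3 X Y z u] by (simp add: w12_XY r w1_Y algebra_simps)

text \<open>The sign condition of the SU(2)-structure enters here. Its premise compares contractions
  as functions on lists of every length; away from length one both sides are zero.\<close>

lemma length_nonneg: "r \<ge> 0"
proof -
  have "w 1 (X # vs) = w 2 (Y # vs)" for vs
  proof (cases "length vs = 1")
    case True
    then obtain u where "vs = [u]" by (auto simp: One_nat_def length_Suc_conv)
    then show ?thesis using XY by simp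
  next
    case False
    then show ?thesis
      using alternating_length[OF w[of 1], of "X # vs"] alternating_length[OF w[of 2], of "Y # vs"] by simp
  qed
  then show ?thesis using positive[of X Y] unfolding r interior_product_def by simp
qed

lemma combination_kernel:
  assumes c: "\<And>u. c1 * w 1 [X, u] + c2 * w 2 [X, u] + c3 * w 3 [X, u] = 0"
    and nz: "c1 \<noteq> 0 \<or> c2 \<noteq> 0 \<or> c3 \<noteq> 0"
  shows "w 1 [X, u] = 0"
proof -
  have v0: "v [X, p, q, s] = 0" for p q s
  proof -
    define S where "S u = c1 * w 1 [X, u] + c2 * w 2 [X, u] + c3 * w 3 [X, u]" for u
    define T where "T y u = c1 * w 1 [y, u] + c2 * w 2 [y, u] + c3 * w 3 [y, u]" for y u
    \<comment> \<open>With T the combination of the \<open>w a\<close> and S its contraction with X,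
      the target is the contraction of T \<and> T with X, that is 2 S \<and> T, and S = 0 by
      assumption. The three written zeros are placeholders, to be replaced by the relations
      \<open>w a \<and>\<^sub>c w b = 0\<close> for the mixed terms.\<close>
    have "(c1\<^sup>2 + c2\<^sup>2 + c3\<^sup>2) * v [X, p, q, s] = c1\<^sup>2 * v [X, p, q, s] + c2\<^sup>2 * v [X, p, q, s] + c3\<^sup>2 * v [X, p, q, s]
       + 2 * c1 * c2 * 0 + 2 * c1 * c3 * 0 + 2 * c2 * c3 * 0"
      by (simp add: algebra_simps)
    also have "\<dots> = c1\<^sup>2 * (2 * (w 1 [X, p] * w 1 [q, s] - w 1 [X, q] * w 1 [p, s] + w 1 [X, s] * w 1 [p, q]))
       + c2\<^sup>2 * (2 * (w 2 [X, p] * w 2 [q, s] - w 2 [X, q] * w 2 [p, s] + w 2 [X, s] * w 2 [p, q]))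
       + c3\<^sup>2 * (2 * (w 3 [X, p] * w 3 [q, s] - w 3 [X, q] * w 3 [p, s] + w 3 [X, s] * w 3 [p, q]))
       + 2 * c1 * c2 * (w 1 [X, p] * w 2 [q, s] - w 1 [X, q] * w 2 [p, s] + w 1 [X, s] * w 2 [p, q]
      + w 1 [p, q] * w 2 [X, s] - w 1 [p, s] * w 2 [X, q] + w 1 [q, s] * w 2 [X, p])
       + 2 * c1 * c3 * (w 1 [X, p] * w 3 [q, s] - w 1 [X, q] * w 3 [p, s] + w 1 [X, s] * w 3 [p, q]
      + w 1 [p, q] * w 3 [X, s] - w 1 [p, s] * w 3 [X, q] + w 1 [q, s] * w 3 [X, p])
       + 2 * c2 * c3 * (w 2 [X, p] * w 3 [q, s] - w 2 [X, q] * w 3 [p, s] + w 2 [X, s] * w 3 [p, q]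
      + w 2 [p, q] * w 3 [X, s] - w 2 [p, s] * w 3 [X, q] + w 2 [q, s] * w 3 [X, p])"
      by (subst v_formula[of 1], simp, subst v_formula[of 2], simp, subst v_formula[of 3], simp,
        subst orthogonal_formula, simp, simp, simp, subst orthogonal_formula, simp, simp, simp,
        subst orthogonal_formula, simp, simp, simp, rule refl)
    also have "\<dots> = 2 * (S p * T q s - S q * T p s + S s * T p q)"
      unfolding S_def T_def by algebra
    also have "\<dots> = 0" using c by (simp add: S_def)
    finally have "(c1\<^sup>2 + c2\<^sup>2 + c3\<^sup>2) * v [X, p, q, s] = 0" .
    moreover have "c1\<^sup>2 + c2\<^sup>2 + c3\<^sup>2 \<noteq> 0"
      using nz by (smt (verit) zero_le_power2 zero_eq_power2)
    ultimately show ?thesis by simp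
  qed
  obtain \<xi> where \<xi>: "h [\<xi>] \<noteq> 0" "\<forall>a\<in>{1, 2, 3}. \<forall>u. w a [\<xi>, u] = 0" using kernel_vector by blast
  let ?c = "h [X] / h [\<xi>]"
  have "v [X - ?c *\<^sub>R \<xi>, y, z, u] = 0" for y z u
  proof -
    have lin: "linear (\<lambda>x. v [x, y, z, u])"
      using alternating_linear[OF v, of "[0, y, z, u]" 0] by simp
    have "v [\<xi>, y, z, u] = 0"
      using v_formula[of 1 \<xi> y z u] \<xi> by auto
    then show ?thesis using v0[of y z u] linear_diff[OF lin] linear_cmul[OF lin] by simp
  qed
  moreover have "h [X - ?c *\<^sub>R \<xi>] = 0"
    using linear_diff[OF h_lin] linear_cmul[OF h_lin] \<xi>(1) by simp
  ultimately have "X - ?c *\<^sub>R \<xi> = 0" by (rule v_kernel)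
  then have "X = ?c *\<^sub>R \<xi>" by simp
  then show ?thesis using linear_cmul[OF w_lin(1), of 1 ?c \<xi> u] \<xi>(2) by simp
qed

text \<open>If \<open>r = 0\<close>, the splitting of \<open>\<omega>\<^sub>1\<close> makes \<open>X \<lrcorner> \<omega>\<^sub>1, X \<lrcorner> \<omega>\<^sub>2, X \<lrcorner> \<omega>\<^sub>3\<close> linearly dependent; but a form
  \<open>\<Sum> c\<^sub>a \<omega>\<^sub>a\<close> squares to \<open>|c|\<^sup>2 v\<close>, so that \<open>X\<close> would lie in the common kernel.\<close>

lemma length_positive:
  assumes "w 1 [X, z] \<noteq> 0"
  shows "r > 0"
proof (rule ccontr)
  assume "\<not> r > 0"
  then have "r = 0" using length_nonneg by simp
  define \<beta> \<alpha>1 \<alpha>2 \<alpha>3 where ab: "\<beta> = (\<lambda>u. - w 3 [Y, u])" "\<alpha>1 = (\<lambda>u. w 1 [X, u])" "\<alpha>2 = (\<lambda>u. w 2 [X, u])" "\<alpha>3 = (\<lambda>u. w 3 [X, u])"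
  have rel: "\<beta> y * \<alpha>1 u - \<beta> u * \<alpha>1 y + (\<alpha>2 y * \<alpha>3 u - \<alpha>2 u * \<alpha>3 y) = 0" for y u
    using w1_split[of y u] \<open>r = 0\<close> unfolding ab by simp
  \<comment> \<open>\<open>rel\<close> says \<beta> \<and> \<alpha>1 + \<alpha>2 \<and> \<alpha>3 =
    0. Wedging with \<alpha>1 removes the first term and leaves \<alpha>1 \<and> \<alpha>2 \<and>
    \<alpha>3 = 0.\<close>
  have dep: "\<alpha>1 y * (\<alpha>2 u * \<alpha>3 s - \<alpha>2 s * \<alpha>3 u) + \<alpha>1 u * (\<alpha>2 s * \<alpha>3 y - \<alpha>2 y * \<alpha>3 s)
      + \<alpha>1 s * (\<alpha>2 y * \<alpha>3 u - \<alpha>2 u * \<alpha>3 y) = 0" for y u s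
    using rel[of y u] rel[of u s] rel[of s y] by algebra
  have z: "\<alpha>1 z \<noteq> 0" using assms by (simp add: ab)
  have "\<exists>c1 c2 c3. (\<forall>u. c1 * \<alpha>1 u + c2 * \<alpha>2 u + c3 * \<alpha>3 u = 0) \<and> (c1 \<noteq> 0 \<or> c2 \<noteq> 0 \<or> c3 \<noteq> 0)"
  proof (cases "\<forall>u. \<alpha>1 z * \<alpha>2 u = \<alpha>2 z * \<alpha>1 u")
    case True
    then show ?thesis using z by (intro exI[of _ "- \<alpha>2 z"] exI[of _ "\<alpha>1 z"] exI[of _ 0]) simp
  next
    case False
    then obtain s where s: "\<alpha>1 z * \<alpha>2 s - \<alpha>2 z * \<alpha>1 s \<noteq> 0" by auto
    \<comment> \<open>The coefficients are the cofactors of the third column in the 3 x 3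
      determinant on (z, s, u); the choice of s makes the last one nonzero.\<close>
    have "(\<alpha>2 z * \<alpha>3 s - \<alpha>2 s * \<alpha>3 z) * \<alpha>1 u + (\<alpha>3 z * \<alpha>1 s - \<alpha>3 s * \<alpha>1 z) * \<alpha>2 u
        + (\<alpha>1 z * \<alpha>2 s - \<alpha>2 z * \<alpha>1 s) * \<alpha>3 u = 0" for u
      using dep[of z s u] by algebra
    then show ?thesis using s by blast
  qed
  then show False using combination_kernel z unfolding ab by blast
qed

text \<open>The vectors X, P, Q, Y are dual to the first four covectors up to the factor r and up to
  Reeb components. Testing on the Reeb vector gives c5 = 0 first, after which those components no
  longer contribute.\<close>

lemma coframe_independent:
  assumes "r > 0"
    and c: "\<And>u. c1 * (- w 3 [Y, u]) + c2 * w 1 [X, u] + c3 * w 2 [X, u] + c4 * w 3 [X, u] + c5 * h [u] = 0"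
  shows "c1 = 0 \<and> c2 = 0 \<and> c3 = 0 \<and> c4 = 0 \<and> c5 = 0"
proof -
  obtain \<xi> where \<xi>: "h [\<xi>] \<noteq> 0" "\<forall>a\<in>{1, 2, 3}. \<forall>u. w a [\<xi>, u] = 0" using kernel_vector by blast
  have c5: "c5 = 0"
    using c[of \<xi>] \<xi> w_swap[of 3 \<xi> Y] w_swap[of 1 \<xi> X] w_swap[of 2 \<xi> X] w_swap[of 3 \<xi> X] by simp
  obtain P where P: "\<And>u. w 3 [P, u] = w 2 [X, u]" using w_transfer[of 2 3 X] by auto
  have P': "w 2 [P, u] = - w 3 [X, u]" for u using w_transfer_square[of 2 3 P X] P by simp
  obtain Q where Q: "\<And>u. w 1 [Q, u] = w 3 [X, u]" using w_transfer[of 3 1 X] by auto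
  have Q': "w 3 [Q, u] = - w 1 [X, u]" for u using w_transfer_square[of 3 1 Q X] Q by simp
  have "c1 = 0"
    using c[of X] c5 w_same[of 1 X] w_same[of 2 X] w_same[of 3 X] w_swap[of 3 X Y] r \<open>r > 0\<close> by simp
  moreover have "c4 = 0"
    using c[of Y] c5 w12_XY w_same[of 3 Y] r \<open>r > 0\<close> by simp
  moreover have "c2 = 0"
  proof -
    have "w 1 [X, P] = r" using XY[of P] w_swap[of 2 Y P] P'[of Y] r by simp
    moreover have "w 2 [X, P] = 0" using P[of P] w_same[of 3 P] by simp
    moreover have "w 3 [X, P] = 0" using P'[of P] w_same[of 2 P] by simp
    moreover have "w 3 [Y, P] = 0" using w_swap[of 3 P Y] P[of Y] w12_XY by simp
    ultimately show ?thesis using c[of P] c5 \<open>r > 0\<close> by simp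
  qed
  moreover have "c3 = 0"
  proof -
    have "w 2 [X, Q] = r" using w1_Y[of Q] w_swap[of 1 Y Q] Q[of Y] r by simp
    moreover have "w 3 [X, Q] = 0" using Q[of Q] w_same[of 1 Q] by simp
    moreover have "w 1 [X, Q] = 0" using Q'[of Q] w_same[of 3 Q] by simp
    moreover have "w 3 [Y, Q] = 0" using w_swap[of 3 Q Y] Q'[of Y] w12_XY by simp
    ultimately show ?thesis using c[of Q] c5 \<open>r > 0\<close> by simp
  qed
  ultimately show ?thesis using c5 by simp
qed

end

end

section \<open>The exterior derivative of time-dependent forms\<close>

text \<open>\<open>frechet_derivative\<close> is a choice among the possible derivatives, and near x
  both functions have exactly the same ones. The equality therefore also holds at points of
  non-differentiability.\<close>

lemma pd_cong:
  assumes "open S" "x \<in> S" "\<And>y. y \<in> S \<Longrightarrow> f y = g y"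
  shows "pd f x u = pd g x u"
proof -
  have "(f has_derivative D) (at x) \<longleftrightarrow> (g has_derivative D) (at x)" for D
    using has_derivative_transform_within_open[of f D x UNIV S g]
      has_derivative_transform_within_open[of g D x UNIV S f] assms by auto
  then show ?thesis by (simp add: frechet_derivative_def)
qed

lemma pd_eq: "(f has_derivative D) (at x) \<Longrightarrow> pd f x u = D u"
  using frechet_derivative_at by metis

lemma differentiable_imp_pd: "f differentiable at x \<Longrightarrow> (f has_derivative pd f x) (at x)"
  by (simp add: frechet_derivative_works)

lemma pd_add: "f differentiable at x \<Longrightarrow> g differentiable at x \<Longrightarrow> pd (\<lambda>x. f x + g x) x u = pd f x u + pd g x u"
  by (rule pd_eq) (intro has_derivative_add differentiable_imp_pd)

lemma pd_diff: "f differentiable at x \<Longrightarrow> g differentiable at x \<Longrightarrow> pd (\<lambda>x. f x - g x) x u = pd f x u - pd g x u"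
  by (rule pd_eq) (intro has_derivative_diff differentiable_imp_pd)

lemma pd_minus: "f differentiable at x \<Longrightarrow> pd (\<lambda>x. - f x) x u = - pd f x u"
  by (rule pd_eq) (intro has_derivative_minus differentiable_imp_pd)

lemma pd_mult_const:
  fixes f :: "'e::real_normed_vector \<Rightarrow> real"
  shows "f differentiable at x \<Longrightarrow> pd (\<lambda>x. c * f x) x u = c * pd f x u"
    and "f differentiable at x \<Longrightarrow> pd (\<lambda>x. f x * c) x u = pd f x u * c"
  by (auto intro!: pd_eq derivative_intros differentiable_imp_pd)

lemma ext_deriv_2: "ext_deriv \<alpha> i x [u, v] = pd (\<lambda>y. \<alpha> i y [v]) x u - pd (\<lambda>y. \<alpha> i y [u]) x v"
  by (simp add: ext_deriv_def)

lemma ext_deriv_3: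
  "ext_deriv \<alpha> i x [u, v, w] = pd (\<lambda>y. \<alpha> i y [v, w]) x u - pd (\<lambda>y. \<alpha> i y [u, w]) x v + pd (\<lambda>y. \<alpha> i y [u, v]) x w"
  by (simp add: ext_deriv_def)

lemma ext_deriv_4:
  "ext_deriv \<alpha> i x [u, v, w, z] = pd (\<lambda>y. \<alpha> i y [v, w, z]) x u - pd (\<lambda>y. \<alpha> i y [u, w, z]) x v
     + pd (\<lambda>y. \<alpha> i y [u, v, z]) x w - pd (\<lambda>y. \<alpha> i y [u, v, w]) x z"
  by (simp add: ext_deriv_def)

lemma ext_deriv_cong:
  assumes "open S" "x \<in> S" "\<And>y. y \<in> S \<Longrightarrow> \<alpha> i y = \<beta> i y"
  shows "ext_deriv \<alpha> i x = ext_deriv \<beta> i x"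
  unfolding ext_deriv_def
  by (intro ext sum.cong refl arg_cong2[where f = "(*)"] pd_cong[OF assms(1,2)]) (simp add: assms(3))

text \<open>Omitting one entry leaves a list whose length is not k, so each differentiated function
  vanishes identically near x. Equations between forms can thus be checked on lists of a single
  length.\<close>

lemma ext_deriv_degree:
  assumes "open S" "x \<in> S" "\<And>y. y \<in> S \<Longrightarrow> alternating k (\<alpha> i y)" "length vs \<noteq> Suc k"
  shows "ext_deriv \<alpha> i x vs = 0"
proof -
  have "pd (\<lambda>y. \<alpha> i y (take j vs @ drop (Suc j) vs)) x u = pd (\<lambda>y. 0) x u" if "j < length vs" for j u
    using that assms(4) by (intro pd_cong[OF assms(1,2)] alternating_length[OF assms(3)]) auto
  then show ?thesis unfolding ext_deriv_def by simp
qed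

lemma ext_deriv_ext_deriv_3:
  assumes "open S" "x \<in> S" "\<And>vs. smooth_on S (\<lambda>y. \<alpha> i y vs)"
  shows "ext_deriv (ext_deriv \<alpha>) i x [u, v, w] = 0"
proof -
  have "(\<lambda>y. pd (\<lambda>y. \<alpha> i y vs) y p) differentiable at x" for vs p
    by (rule smooth_on_imp_differentiable[OF smooth_on_pd[OF assms(3)] assms(2)])
  then show ?thesis
    unfolding ext_deriv_3 unfolding ext_deriv_2
    using pd_commute[OF assms, of "[u]" v w] pd_commute[OF assms, of "[v]" u w] pd_commute[OF assms, of "[w]" u v]
    by (simp add: pd_diff)
qed

lemma ext_deriv_ext_deriv_4:
  assumes "open S" "x \<in> S" "\<And>vs. smooth_on S (\<lambda>y. \<alpha> i y vs)"
  shows "ext_deriv (ext_deriv \<alpha>) i x [u, v, w, z] = 0"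
proof -
  have "(\<lambda>y. pd (\<lambda>y. \<alpha> i y vs) y p) differentiable at x" for vs p
    by (rule smooth_on_imp_differentiable[OF smooth_on_pd[OF assms(3)] assms(2)])
  then show ?thesis
    unfolding ext_deriv_4 unfolding ext_deriv_3
    using pd_commute[OF assms, of "[u, v]" w z] pd_commute[OF assms, of "[u, w]" v z] pd_commute[OF assms, of "[u, z]" v w]
      pd_commute[OF assms, of "[v, w]" u z] pd_commute[OF assms, of "[v, z]" u w] pd_commute[OF assms, of "[w, z]" u v]
    by (simp add: pd_diff pd_add)
qed

text \<open>The graded Leibniz rule in components: the first six terms are d\<alpha> \<and> \<beta>,
  the bracket is \<alpha> \<and> d\<beta>, and its minus sign comes from the odd degree of
  \<alpha>.\<close>

lemma ext_deriv_wedge_1_2: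
  assumes S: "open S" "x \<in> S" and \<alpha>: "\<And>y. y \<in> S \<Longrightarrow> alternating 1 (\<alpha> i y)" "\<And>vs. smooth_on S (\<lambda>y. \<alpha> i y vs)"
    and \<beta>: "\<And>y. y \<in> S \<Longrightarrow> alternating 2 (\<beta> i y)" "\<And>vs. smooth_on S (\<lambda>y. \<beta> i y vs)"
  shows "ext_deriv (\<alpha> \<and>\<^sub>F \<beta>) i x [u, v, w, z] =
     ext_deriv \<alpha> i x [u, v] * \<beta> i x [w, z] - ext_deriv \<alpha> i x [u, w] * \<beta> i x [v, z]
     + ext_deriv \<alpha> i x [u, z] * \<beta> i x [v, w] + ext_deriv \<alpha> i x [v, w] * \<beta> i x [u, z]
     - ext_deriv \<alpha> i x [v, z] * \<beta> i x [u, w] + ext_deriv \<alpha> i x [w, z] * \<beta> i x [u, v]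
     - (\<alpha> i x [u] * ext_deriv \<beta> i x [v, w, z] - \<alpha> i x [v] * ext_deriv \<beta> i x [u, w, z]
     + \<alpha> i x [w] * ext_deriv \<beta> i x [u, v, z] - \<alpha> i x [z] * ext_deriv \<beta> i x [u, v, w])"
proof -
  have d: "(\<lambda>y. \<alpha> i y vs) differentiable at x" "(\<lambda>y. \<beta> i y vs) differentiable at x" for vs
    using smooth_on_imp_differentiable[OF \<alpha>(2) S(2)] smooth_on_imp_differentiable[OF \<beta>(2) S(2)] by blast+
  have "pd (\<lambda>y. (\<alpha> \<and>\<^sub>F \<beta>) i y [a, b, c]) x p =
      pd (\<lambda>y. \<alpha> i y [a] * \<beta> i y [b, c] - \<alpha> i y [b] * \<beta> i y [a, c] + \<alpha> i y [c] * \<beta> i y [a, b]) x p" for a b c p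
    by (rule pd_cong[OF S]) (simp add: form_wedge_def wedge_1_2[OF \<alpha>(1) \<beta>(1)])
  then have leibniz: "pd (\<lambda>y. (\<alpha> \<and>\<^sub>F \<beta>) i y [a, b, c]) x p =
     \<alpha> i x [a] * pd (\<lambda>y. \<beta> i y [b, c]) x p + pd (\<lambda>y. \<alpha> i y [a]) x p * \<beta> i x [b, c]
     - (\<alpha> i x [b] * pd (\<lambda>y. \<beta> i y [a, c]) x p + pd (\<lambda>y. \<alpha> i y [b]) x p * \<beta> i x [a, c])
     + (\<alpha> i x [c] * pd (\<lambda>y. \<beta> i y [a, b]) x p + pd (\<lambda>y. \<alpha> i y [c]) x p * \<beta> i x [a, b])" for a b c p
    by (simp add: pd_add pd_diff pd_mult d)
  show ?thesis
    unfolding ext_deriv_4 ext_deriv_3 ext_deriv_2 leibniz by (simp add: algebra_simps)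
qed

text \<open>The part of \<open>is_form_family\<close> that lives in one chart domain. Smoothness is
  joint in (t, x), so that time and space derivatives are directional derivatives of a single
  function.\<close>

definition family_on ::
  "nat \<Rightarrow> 'e::euclidean_space set \<Rightarrow> 'i \<Rightarrow> (real \<Rightarrow> ('i, 'e, real) form) \<Rightarrow> bool" where
  "family_on k S i \<alpha> \<longleftrightarrow> (\<forall>t. \<forall>x\<in>S. alternating k (\<alpha> t i x)) \<and>
     (\<forall>vs. smooth_on (UNIV \<times> S) (\<lambda>(t, x). \<alpha> t i x vs))"

lemma family_onD:
  assumes "family_on k S i \<alpha>"
  shows "x \<in> S \<Longrightarrow> alternating k (\<alpha> t i x)" "smooth_on (UNIV \<times> S) (\<lambda>(t, x). \<alpha> t i x vs)"
  using assms by (auto simp: family_on_def)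

lemma family_on_wedge:
  assumes "open S" "family_on k S i \<alpha>" "family_on l S i \<beta>"
  shows "family_on (k + l) S i (\<lambda>t. \<alpha> t \<and>\<^sub>F \<beta> t)"
proof -
  have "smooth_on (UNIV \<times> S) (\<lambda>(t, x). (\<alpha> t \<and>\<^sub>F \<beta> t) i x vs)" for vs
    using family_onD(2)[OF assms(2)] family_onD(2)[OF assms(3)]
    unfolding form_wedge_def wedge_def Let_def case_prod_unfold
    by (intro smooth_on_sum smooth_on_mult smooth_on_const open_Times assms(1) open_UNIV) 
  then show ?thesis
    using assms(2,3) by (auto simp: family_on_def form_wedge_def intro!: alternating_wedge)
qed

context
  fixes S :: "'e::euclidean_space set" and k i \<alpha> x
  assumes S: "open S" "x \<in> S" and fam: "family_on k S i \<alpha>"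
begin

lemma family_total_derivative:
  "((\<lambda>(t, x). \<alpha> t i x vs) has_derivative pd (\<lambda>(t, x). \<alpha> t i x vs) (t, x)) (at (t, x))"
  by (rule differentiable_imp_pd[OF smooth_on_imp_differentiable[OF family_onD(2)[OF fam]]]) (use S in auto)

lemma family_space_derivative:
  "((\<lambda>y. \<alpha> t i y vs) has_derivative (\<lambda>u. pd (\<lambda>(t, x). \<alpha> t i x vs) (t, x) (0, u))) (at x)"
proof -
  have "((\<lambda>y. (t, y)) has_derivative (\<lambda>u. (0, u))) (at x)" by (auto intro!: derivative_eq_intros)
  from has_derivative_compose[OF this family_total_derivative] show ?thesis by simp
qed

lemma family_time_derivative:
  "((\<lambda>s. \<alpha> s i x vs) has_real_derivative pd (\<lambda>(t, x). \<alpha> t i x vs) (t, x) (1, 0)) (at t)"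
proof -
  have "((\<lambda>s. (s, x)) has_derivative (\<lambda>s. (s, 0))) (at t)" by (auto intro!: derivative_eq_intros)
  from has_derivative_compose[OF this family_total_derivative]
  have "((\<lambda>s. \<alpha> s i x vs) has_derivative (\<lambda>s. pd (\<lambda>(t, x). \<alpha> t i x vs) (t, x) (s, 0))) (at t)" by simp
  moreover have "(\<lambda>s. pd (\<lambda>(t, x). \<alpha> t i x vs) (t, x) (s, 0)) = (*) (pd (\<lambda>(t, x). \<alpha> t i x vs) (t, x) (1, 0))"
  proof
    show "pd (\<lambda>(t, x). \<alpha> t i x vs) (t, x) (s, 0) = pd (\<lambda>(t, x). \<alpha> t i x vs) (t, x) (1, 0) * s" for s
      using linear_cmul[OF has_derivative_linear[OF family_total_derivative], of vs t s "(1, 0)"]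
      by (simp add: mult.commute)
  qed
  ultimately show ?thesis by (simp add: has_field_derivative_def)
qed

lemma family_time_deriv: "time_deriv \<alpha> t i x vs = pd (\<lambda>(t, x). \<alpha> t i x vs) (t, x) (1, 0)"
  unfolding time_deriv_def by (rule DERIV_imp_deriv[OF family_time_derivative])

lemma family_has_time_deriv: "((\<lambda>s. \<alpha> s i x vs) has_real_derivative time_deriv \<alpha> t i x vs) (at t)"
  unfolding family_time_deriv by (rule family_time_derivative)

lemma family_pd: "pd (\<lambda>y. \<alpha> t i y vs) x u = pd (\<lambda>(t, x). \<alpha> t i x vs) (t, x) (0, u)"
  by (rule pd_eq[OF family_space_derivative])

text \<open>Families carry time as first coordinate and charts of the cylinder as last, hence the
  swap. Linearity of the total derivative then splits a direction into (0, u) and s (1, 0).\<close>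

lemma lift_derivative:
  "((\<lambda>z. lift \<alpha> i z vs) has_derivative
     (\<lambda>(u, s). pd (\<lambda>y. \<alpha> t i y (map fst vs)) x u + s * time_deriv \<alpha> t i x (map fst vs))) (at (x, t))"
proof -
  let ?f = "\<lambda>(t, x). \<alpha> t i x (map fst vs)"
  have "((\<lambda>z. (snd z, fst z)) has_derivative (\<lambda>z. (snd z, fst z))) (at (x, t))"
    by (auto intro!: derivative_eq_intros)
  from has_derivative_compose[OF this, of ?f "pd ?f (t, x)"] family_total_derivative[of "map fst vs" t]
  have swap: "((\<lambda>z. lift \<alpha> i z vs) has_derivative (\<lambda>z. pd ?f (t, x) (snd z, fst z))) (at (x, t))"
    by (simp add: lift_def case_prod_unfold)
  have split: "pd ?f (t, x) (s, u) = pd ?f (t, x) (0, u) + s * pd ?f (t, x) (1, 0)" for s u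
  proof -
    have lin: "linear (pd ?f (t, x))" by (rule has_derivative_linear[OF family_total_derivative])
    show ?thesis using linear_add[OF lin, of "(0, u)" "s *\<^sub>R (1, 0)"] linear_cmul[OF lin, of s "(1, 0)"] by simp
  qed
  have "(\<lambda>z. pd ?f (t, x) (snd z, fst z)) =
      (\<lambda>(u, s). pd (\<lambda>y. \<alpha> t i y (map fst vs)) x u + s * time_deriv \<alpha> t i x (map fst vs))"
  proof
    fix z :: "'e \<times> real"
    obtain u s where z: "z = (u, s)" by (cases z)
    show "pd ?f (t, x) (snd z, fst z) =
      (case z of (u, s) \<Rightarrow> pd (\<lambda>y. \<alpha> t i y (map fst vs)) x u + s * time_deriv \<alpha> t i x (map fst vs))"
      unfolding family_time_deriv family_pd z fst_conv snd_conv prod.case by (rule split)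
  qed
  then show ?thesis using swap by (simp only:)
qed

lemma lift_differentiable: "(\<lambda>z. lift \<alpha> i z vs) differentiable at (x, t)"
  using lift_derivative differentiableI by blast

lemma pd_lift:
  "pd (\<lambda>z. lift \<alpha> i z vs) (x, t) (u, s) =
     pd (\<lambda>y. \<alpha> t i y (map fst vs)) x u + s * time_deriv \<alpha> t i x (map fst vs)"
  using pd_eq[OF lift_derivative] by simp

end

lemma smooth_on_lift:
  assumes S: "open S" and fam: "family_on k S i \<alpha>"
  shows "smooth_on (S \<times> UNIV) (\<lambda>z. lift \<alpha> i z vs)"
proof -
  have "bounded_linear (\<lambda>z :: 'a \<times> real. (snd z, fst z))"
    by (intro bounded_linear_Pair bounded_linear_snd bounded_linear_fst)
  from smooth_on_compose_linear[OF this _ _ family_onD(2)[OF fam], of "S \<times> UNIV" "map fst vs"] S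
  show ?thesis by (auto simp: open_Times lift_def case_prod_unfold)
qed

text \<open>Freezing t is composition with an affine map, outside the scope of
  \<open>Ck_on_compose_linear\<close>. The derivative in direction u is again a frozen function,
  namely the derivative of f in direction (0, u), so the induction runs over all smooth f.\<close>

lemma Ck_on_section:
  fixes f :: "real \<times> 'e::euclidean_space \<Rightarrow> real"
  assumes S: "open S" and f: "smooth_on (UNIV \<times> S) f"
  shows "Ck_on n S (\<lambda>y. f (t, y))"
  using f
proof (induction n arbitrary: f)
  case 0
  have "continuous_on S (\<lambda>y. (t, y))" by (intro continuous_intros)
  then show ?case
    using continuous_on_compose2[OF smooth_on_imp_continuous[OF 0], of S "\<lambda>y. (t, y)"] by auto
next
  case (Suc n)
  have hd: "((\<lambda>y. f (t, y)) has_derivative (\<lambda>u. pd f (t, y) (0, u))) (at y)" if "y \<in> S" for y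
  proof -
    have "((\<lambda>y. (t, y)) has_derivative (\<lambda>u. (0, u))) (at y)" by (auto intro!: derivative_eq_intros)
    from has_derivative_compose[OF this differentiable_imp_pd[OF smooth_on_imp_differentiable[OF Suc.prems]]]
    show ?thesis using that by auto
  qed
  have "Ck_on n S (\<lambda>y. pd (\<lambda>y. f (t, y)) y u)" for u
    by (rule Ck_on_cong[OF S _ Suc.IH[OF smooth_on_pd[OF Suc.prems, of "(0, u)"]]]) (simp add: pd_eq[OF hd])
  then show ?case using hd by (auto simp: differentiable_def)
qed

lemma family_smooth_at_time:
  assumes "open S" "family_on k S i \<alpha>"
  shows "smooth_on S (\<lambda>y. \<alpha> t i y vs)"
  using Ck_on_section[OF assms(1) family_onD(2)[OF assms(2)]] by (simp add: smooth_on_def)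

text \<open>This is what makes d/dt commute with the exterior derivative: the mixed derivatives of
  the joint function in the directions (1, 0) and (0, u) agree.\<close>

lemma family_pd_has_time_deriv:
  assumes S: "open S" "x \<in> S" and fam: "family_on k S i \<alpha>"
  shows "((\<lambda>s. pd (\<lambda>y. \<alpha> s i y vs) x u) has_real_derivative pd (\<lambda>y. time_deriv \<alpha> t i y vs) x u) (at t)"
proof -
  let ?f = "\<lambda>(t, x). \<alpha> t i x vs"
  let ?g = "\<lambda>v z. pd ?f z v"
  have o: "open (UNIV \<times> S)" "(t, x) \<in> UNIV \<times> S" for t using S by (auto simp: open_Times)
  have g: "smooth_on (UNIV \<times> S) (?g v)" for v by (rule smooth_on_pd[OF family_onD(2)[OF fam]])
  \<comment> \<open>The partial derivatives of a component are repackaged as families of 0-forms,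
    supported on the empty list, so that the derivative rules for families apply to them.\<close>
  have fam': "family_on 0 S i (\<lambda>t i x vs. if vs = [] then ?g v (t, x) else 0)" for v
  proof -
    have "smooth_on (UNIV \<times> S) (\<lambda>(t, y). if ws = [] then ?g v (t, y) else 0)" for ws :: "'a list"
      using g[of v] by (cases "ws = []") (simp_all add: case_prod_unfold smooth_on_const)
    then show ?thesis by (simp add: family_on_def alternating_def)
  qed
  have eta: "(\<lambda>(t, x). ?g v (t, x)) = ?g v" for v by auto
  have 1: "((\<lambda>s. ?g (0, u) (s, x)) has_real_derivative pd (?g (0, u)) (t, x) (1, 0)) (at t)"
    using family_time_derivative[OF S fam'[of "(0, u)"], of "[]" t] by (simp add: eta)
  have "pd (?g (0, u)) (t, x) (1, 0) = pd (?g (1, 0)) (t, x) (0, u)"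
    by (rule pd_commute[OF o family_onD(2)[OF fam]])
  also have "\<dots> = pd (\<lambda>y. ?g (1, 0) (t, y)) x u"
    using family_pd[OF S fam'[of "(1, 0)"], of "[]" t u] by (simp add: eta)
  also have "\<dots> = pd (\<lambda>y. time_deriv \<alpha> t i y vs) x u"
    by (rule pd_cong[OF S]) (simp add: family_time_deriv[OF S(1) _ fam])
  finally show ?thesis using 1 by (simp add: family_pd[OF S fam])
qed

section \<open>Forms on the cylinder\<close>

lemma alternating_add: "alternating k a \<Longrightarrow> alternating k b \<Longrightarrow> alternating k (a + b)"
  unfolding alternating_def by (auto simp: linear_compose_add)

lemma alternating_diff: "alternating k a \<Longrightarrow> alternating k b \<Longrightarrow> alternating k (a - b)"
  unfolding alternating_def by (auto simp: linear_compose_sub)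

lemma alternating_map:
  assumes a: "alternating k a" and L: "linear L"
  shows "alternating k (\<lambda>vs. a (map L vs))"
proof -
  have "linear (\<lambda>v. a (map L (vs[j := v])))" if "length vs = k" "j < k" for vs j
    using linear_compose[OF L alternating_linear[OF a, of "map L vs" j]] that
    by (simp add: map_update o_def)
  then show ?thesis using a unfolding alternating_def by (auto simp: distinct_map)
qed

lemma alternating_lift:
  assumes "alternating k (\<alpha> t i x)"
  shows "alternating k (lift \<alpha> i (x, t))"
  using alternating_map[OF assms linear_fst] by (simp add: lift_def)

lemma alternating_dt: "alternating 1 (dt i z)"
  by (auto simp: alternating_def dt_def length_Suc_conv linear_iff split: list.split)

lemma wedge_map:
  "(a \<and>\<^sub>c b) (map L vs) = ((\<lambda>us. a (map L us)) \<and>\<^sub>c (\<lambda>us. b (map L us))) vs"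
proof -
  have eq: "map (\<lambda>i. map L vs ! p i) [m..<n] = map L (map (\<lambda>i. vs ! p i) [m..<n])"
    if "p permutes {..<length vs}" "n \<le> length vs" for p m n
    using that permutes_in_image[OF that(1)] by auto
  show ?thesis
    unfolding wedge_def Let_def length_map
    by (intro sum.cong refl) (simp only: eq mem_Collect_eq atMost_iff le_refl)
qed

text \<open>The normalising coefficients and signs of the wedge sum are real, so each product splits
  as (a + ib)(c + id) does.\<close>

lemma wedge_Complex:
  "(\<lambda>vs. Complex (a vs) (b vs)) \<and>\<^sub>c (\<lambda>vs. Complex (c vs) (d vs)) =
    (\<lambda>vs. Complex ((a \<and>\<^sub>c c) vs - (b \<and>\<^sub>c d) vs) ((a \<and>\<^sub>c d) vs + (b \<and>\<^sub>c c) vs))"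
proof
  fix vs
  have q: "of_int s / (fact k * fact m) = complex_of_real (of_int s / (fact k * fact m))" for s k m
    by (simp add: of_real_fact)
  have prod: "complex_of_real c * Complex p q * Complex r s = Complex (c * p * r - c * q * s) (c * p * s + c * q * r)"
    for c p q r s by (simp add: complex_eq_iff algebra_simps)
  show "((\<lambda>vs. Complex (a vs) (b vs)) \<and>\<^sub>c (\<lambda>vs. Complex (c vs) (d vs))) vs =
    Complex ((a \<and>\<^sub>c c) vs - (b \<and>\<^sub>c d) vs) ((a \<and>\<^sub>c d) vs + (b \<and>\<^sub>c c) vs)"
    unfolding wedge_def Let_def q prod
    by (rule complex_eqI) (simp_all only: Re_sum Im_sum complex.sel sum_subtractf sum.distrib)
qed

lemma complex_form_wedge:
  "complex_form \<alpha> \<beta> \<and>\<^sub>F complex_form \<gamma> \<delta> =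
    complex_form (\<alpha> \<and>\<^sub>F \<gamma> - \<beta> \<and>\<^sub>F \<delta>) (\<alpha> \<and>\<^sub>F \<delta> + \<beta> \<and>\<^sub>F \<gamma>)"
  by (intro ext) (simp add: form_wedge_def complex_form_def wedge_Complex)

lemma is_form_alternating: "is_form M k \<alpha> \<Longrightarrow> i \<in> idx M \<Longrightarrow> x \<in> img M i \<Longrightarrow> alternating k (\<alpha> i x)"
  by (simp add: is_form_def smooth_form_on_def)

lemma is_form_family_family_on: "is_form_family N k \<alpha> \<Longrightarrow> i \<in> idx N \<Longrightarrow> family_on k (img N i) i \<alpha>"
  by (auto simp: is_form_family_def family_on_def intro: is_form_alternating)

lemma is_form_transition:
  assumes "is_form M k \<alpha>" "i \<in> idx M" "j \<in> idx M" "p \<in> dom M i \<inter> dom M j"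
  shows "\<alpha> i (chart M i p) =
    (\<lambda>vs. \<alpha> j (chart M j p) (map (frechet_derivative (transition M i j) (at (chart M i p))) vs))"
  by (rule ext) (use assms in \<open>unfold is_form_def, blast\<close>)

lemma is_form_add:
  assumes op: "\<And>i. i \<in> idx M \<Longrightarrow> open (img M i)" and a: "is_form M k \<alpha>" and b: "is_form M k \<beta>"
  shows "is_form M k (\<alpha> + \<beta>)"
  unfolding is_form_def smooth_form_on_def
proof (intro conjI ballI allI)
  fix i x vs assume i: "i \<in> idx M"
  have a': "\<And>x. x \<in> img M i \<Longrightarrow> alternating k (\<alpha> i x)" "smooth_on (img M i) (\<lambda>x. \<alpha> i x vs)"
    and b': "\<And>x. x \<in> img M i \<Longrightarrow> alternating k (\<beta> i x)" "smooth_on (img M i) (\<lambda>x. \<beta> i x vs)"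
    using a b i unfolding is_form_def smooth_form_on_def by blast+
  show "alternating k ((\<alpha> + \<beta>) i x)" if "x \<in> img M i"
    using alternating_add[OF a'(1) b'(1)] that by simp
  show "smooth_on (img M i) (\<lambda>x. (\<alpha> + \<beta>) i x vs)"
    using smooth_on_add[OF op[OF i] a'(2) b'(2)] by simp
next
  fix i j p vs assume ij: "i \<in> idx M" "j \<in> idx M" "p \<in> dom M i \<inter> dom M j"
  let ?us = "map (frechet_derivative (transition M i j) (at (chart M i p))) vs"
  have "\<alpha> i (chart M i p) vs = \<alpha> j (chart M j p) ?us" "\<beta> i (chart M i p) vs = \<beta> j (chart M j p) ?us"
    by (rule fun_cong[OF is_form_transition[OF a ij]] fun_cong[OF is_form_transition[OF b ij]])+
  then show "(\<alpha> + \<beta>) i (chart M i p) vs = (\<alpha> + \<beta>) j (chart M j p) ?us"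
    by (simp only: plus_fun_apply)
qed

lemma is_form_diff:
  assumes op: "\<And>i. i \<in> idx M \<Longrightarrow> open (img M i)" and a: "is_form M k \<alpha>" and b: "is_form M k \<beta>"
  shows "is_form M k (\<alpha> - \<beta>)"
  unfolding is_form_def smooth_form_on_def
proof (intro conjI ballI allI)
  fix i x vs assume i: "i \<in> idx M"
  have a': "\<And>x. x \<in> img M i \<Longrightarrow> alternating k (\<alpha> i x)" "smooth_on (img M i) (\<lambda>x. \<alpha> i x vs)"
    and b': "\<And>x. x \<in> img M i \<Longrightarrow> alternating k (\<beta> i x)" "smooth_on (img M i) (\<lambda>x. \<beta> i x vs)"
    using a b i unfolding is_form_def smooth_form_on_def by blast+
  show "alternating k ((\<alpha> - \<beta>) i x)" if "x \<in> img M i"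
    using alternating_diff[OF a'(1) b'(1)] that by simp
  show "smooth_on (img M i) (\<lambda>x. (\<alpha> - \<beta>) i x vs)"
    using smooth_on_diff[OF op[OF i] a'(2) b'(2)] by simp
next
  fix i j p vs assume ij: "i \<in> idx M" "j \<in> idx M" "p \<in> dom M i \<inter> dom M j"
  let ?us = "map (frechet_derivative (transition M i j) (at (chart M i p))) vs"
  have "\<alpha> i (chart M i p) vs = \<alpha> j (chart M j p) ?us" "\<beta> i (chart M i p) vs = \<beta> j (chart M j p) ?us"
    by (rule fun_cong[OF is_form_transition[OF a ij]] fun_cong[OF is_form_transition[OF b ij]])+
  then show "(\<alpha> - \<beta>) i (chart M i p) vs = (\<alpha> - \<beta>) j (chart M j p) ?us"
    by (simp only: minus_apply)
qed

lemma img_times_real: "img (times_real N) i = img N i \<times> UNIV"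
  unfolding img_def times_real_def by force

lemma idx_times_real: "idx (times_real N) = idx N"
  by (simp add: times_real_def)

lemma smooth_on_wedge:
  fixes a b :: "'e::euclidean_space \<Rightarrow> 'f list \<Rightarrow> real"
  assumes "open S" "\<And>vs. smooth_on S (\<lambda>x. a x vs)" "\<And>vs. smooth_on S (\<lambda>x. b x vs)"
  shows "smooth_on S (\<lambda>x. (a x \<and>\<^sub>c b x) vs)"
  unfolding wedge_def Let_def by (intro smooth_on_sum smooth_on_mult smooth_on_const assms)

lemma is_form_wedge:
  assumes op: "\<And>i. i \<in> idx M \<Longrightarrow> open (img M i)" and a: "is_form M k \<alpha>" and b: "is_form M l \<beta>"
  shows "is_form M (k + l) (\<alpha> \<and>\<^sub>F \<beta>)"
  unfolding is_form_def smooth_form_on_def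
proof (intro conjI ballI allI)
  fix i x vs assume i: "i \<in> idx M"
  show "alternating (k + l) ((\<alpha> \<and>\<^sub>F \<beta>) i x)" if "x \<in> img M i"
    using a b i that unfolding is_form_def smooth_form_on_def form_wedge_def by (blast intro: alternating_wedge)
  show "smooth_on (img M i) (\<lambda>x. (\<alpha> \<and>\<^sub>F \<beta>) i x vs)"
    using a b i unfolding is_form_def smooth_form_on_def form_wedge_def by (intro smooth_on_wedge op) auto
next
  fix i j p vs assume ij: "i \<in> idx M" "j \<in> idx M" "p \<in> dom M i \<inter> dom M j"
  let ?L = "frechet_derivative (transition M i j) (at (chart M i p))"
  have "\<alpha> i (chart M i p) = (\<lambda>vs. \<alpha> j (chart M j p) (map ?L vs))"
    "\<beta> i (chart M i p) = (\<lambda>vs. \<beta> j (chart M j p) (map ?L vs))"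
    by (rule is_form_transition[OF a ij] is_form_transition[OF b ij])+
  then show "(\<alpha> \<and>\<^sub>F \<beta>) i (chart M i p) vs = (\<alpha> \<and>\<^sub>F \<beta>) j (chart M j p) (map ?L vs)"
    by (simp only: form_wedge_def wedge_map)
qed

lemma form_wedge_index: "(\<alpha> \<and>\<^sub>F \<beta>) i x = \<alpha> i x \<and>\<^sub>c \<beta> i x"
  by (simp add: form_wedge_def)

section \<open>Charts and forms on the product with the real line\<close>

locale manifold =
  fixes N :: "('i, 'a::{t2_space, second_countable_topology}, 'e::euclidean_space) atlas"
  assumes N: "smooth_manifold N"
begin

lemma open_img: "i \<in> idx N \<Longrightarrow> open (img N i)"
  using N by (auto simp: smooth_manifold_def)

lemma open_img_times_real: "i \<in> idx (times_real N) \<Longrightarrow> open (img (times_real N) i)"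
  using open_img by (auto simp: img_times_real idx_times_real intro: open_Times)

lemma chart_inj: "i \<in> idx N \<Longrightarrow> inj_on (chart N i) (dom N i)"
  using N unfolding smooth_manifold_def homeomorphism_def by (metis inj_on_inverseI)

lemma open_chart_image:
  assumes "i \<in> idx N" "j \<in> idx N"
  shows "open (chart N i ` (dom N i \<inter> dom N j))"
proof -
  obtain g where g: "homeomorphism (dom N i) (img N i) (chart N i) g"
    using N assms by (auto simp: smooth_manifold_def)
  have "open (dom N i)" "open (dom N j)" using N assms by (auto simp: smooth_manifold_def)
  then have "openin (top_of_set (dom N i)) (dom N i \<inter> dom N j)"
    by (simp add: openin_open_Int)
  then have "openin (top_of_set (img N i)) (chart N i ` (dom N i \<inter> dom N j))"
    by (rule homeomorphism_imp_open_map[OF g])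
  then show ?thesis using open_img[OF assms(1)] openin_open_trans by blast
qed

text \<open>Off the image of \<open>dom N i\<close> the value of \<open>inv_into\<close> is
  arbitrary, so the transition map is the product of the old one with the identity only over that
  image. The overlap has open image there, which suffices to compute the derivative.\<close>

lemma transition_times_real:
  assumes ij: "i \<in> idx N" "j \<in> idx N" and p: "p \<in> dom N i \<inter> dom N j"
  shows "frechet_derivative (transition (times_real N) i j) (at (chart N i p, t)) =
    map_prod (frechet_derivative (transition N i j) (at (chart N i p))) id"
proof -
  let ?U = "chart N i ` (dom N i \<inter> dom N j)" and ?T = "transition N i j" and ?x = "chart N i p"
  have inj: "inj_on (map_prod (chart N i) id) (dom N i \<times> UNIV)"
    using chart_inj[OF ij(1)] by (intro map_prod_inj_on) auto
  have eq: "transition (times_real N) i j (chart N i q, s) = (?T (chart N i q), s)" if "q \<in> dom N i" for q s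
  proof -
    have "inv_into (dom N i \<times> UNIV) (map_prod (chart N i) id) (chart N i q, s) = (q, s)"
      using inv_into_f_f[OF inj, of "(q, s)"] that by simp
    then show ?thesis
      using inv_into_f_f[OF chart_inj[OF ij(1)] that] by (simp add: transition_def times_real_def)
  qed
  have "smooth_on ?U ?T" using N ij by (auto simp: smooth_manifold_def)
  then have "(?T has_derivative frechet_derivative ?T (at ?x)) (at (fst (?x, t)))"
    using p smooth_on_imp_differentiable frechet_derivative_works by fastforce
  from has_derivative_compose[OF has_derivative_fst[OF has_derivative_ident] this]
  have "((\<lambda>z. (?T (fst z), snd z)) has_derivative (\<lambda>z. (frechet_derivative ?T (at ?x) (fst z), snd z))) (at (?x, t))"
    by (intro has_derivative_Pair has_derivative_snd has_derivative_ident) auto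
  then have "(transition (times_real N) i j has_derivative (\<lambda>z. (frechet_derivative ?T (at ?x) (fst z), snd z))) (at (?x, t))"
  proof (rule has_derivative_transform_within_open)
    show "open (?U \<times> (UNIV :: real set))" by (intro open_Times open_chart_image ij open_UNIV)
    show "(?x, t) \<in> ?U \<times> UNIV" using p by auto
    show "(?T (fst z), snd z) = transition (times_real N) i j z" if "z \<in> ?U \<times> UNIV" for z
      using that eq by auto
  qed
  then show ?thesis using frechet_derivative_at by (force simp: map_prod_def case_prod_unfold)
qed

lemma is_form_lift:
  assumes "is_form_family N k \<alpha>"
  shows "is_form (times_real N) k (lift \<alpha>)"
  unfolding is_form_def smooth_form_on_def idx_times_real img_times_real
proof (intro conjI ballI allI)
  fix i z vs assume i: "i \<in> idx N"
  have fam: "family_on k (img N i) i \<alpha>"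
    by (rule is_form_family_family_on[OF assms i])
  show "alternating k (lift \<alpha> i z)" if "z \<in> img N i \<times> UNIV"
    using that family_onD(1)[OF fam] by (cases z) (auto intro: alternating_lift)
  show "smooth_on (img N i \<times> UNIV) (\<lambda>z. lift \<alpha> i z vs)"
    by (rule smooth_on_lift[OF open_img[OF i] fam])
next
  fix i j p and vs :: "('e \<times> real) list" assume ij: "i \<in> idx N" "j \<in> idx N" and p: "p \<in> dom (times_real N) i \<inter> dom (times_real N) j"
  obtain q t where pq: "p = (q, t)" by (cases p)
  have q: "q \<in> dom N i \<inter> dom N j" using p by (auto simp: pq times_real_def)
  have c: "chart (times_real N) i p = (chart N i q, t)" for i by (simp add: pq times_real_def)
  let ?L = "frechet_derivative (transition N i j) (at (chart N i q))"
  have "is_form N k (\<alpha> t)" using assms by (auto simp: is_form_family_def)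
  then have "\<alpha> t i (chart N i q) (map fst vs) = \<alpha> t j (chart N j q) (map ?L (map fst vs))"
    by (rule fun_cong[OF is_form_transition[OF _ ij q]])
  then show "lift \<alpha> i (chart (times_real N) i p) vs = lift \<alpha> j (chart (times_real N) j p)
      (map (frechet_derivative (transition (times_real N) i j) (at (chart (times_real N) i p))) vs)"
    unfolding c transition_times_real[OF ij q] by (simp add: lift_def o_def)
qed

lemma is_form_dt: "is_form (times_real N) 1 dt"
  unfolding is_form_def smooth_form_on_def idx_times_real img_times_real
proof (intro conjI ballI allI)
  fix i j p and vs :: "('e \<times> real) list" assume ij: "i \<in> idx N" "j \<in> idx N" and p: "p \<in> dom (times_real N) i \<inter> dom (times_real N) j"
  obtain q t where pq: "p = (q, t)" by (cases p)
  have q: "q \<in> dom N i \<inter> dom N j" using p by (auto simp: pq times_real_def)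
  have c: "chart (times_real N) i p = (chart N i q, t)" by (simp add: pq times_real_def)
  show "dt i (chart (times_real N) i p) vs = dt j (chart (times_real N) j p)
      (map (frechet_derivative (transition (times_real N) i j) (at (chart (times_real N) i p))) vs)"
    unfolding c transition_times_real[OF ij q] by (auto simp: dt_def split: list.split)
qed (rule alternating_dt, simp add: dt_def smooth_on_const)

end

section \<open>Exterior derivative on the cylinder\<close>

context
  fixes S :: "'e::euclidean_space set" and i :: 'i and x and t :: real
    and \<kappa> \<beta> :: "real \<Rightarrow> ('i, 'e, real) form"
  assumes S: "open S" "x \<in> S"
begin

text \<open>In invariant form, d(\<kappa> + \<beta> \<and> dt) = d\<kappa> + dt \<and> (d/dt
  \<kappa> + d\<beta>); the plus sign arises because dt commutes with the 2-form d\<beta>.\<close>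

lemma ext_deriv_cylinder_2:
  assumes \<omega>: "family_on 2 S i \<kappa>" and \<eta>: "family_on 1 S i \<beta>"
    and F: "\<And>z. z \<in> S \<times> UNIV \<Longrightarrow> F i z = (lift \<kappa> + lift \<beta> \<and>\<^sub>F dt) i z"
  shows "ext_deriv F i (x, t) [(u, p), (v, q), (w, r)] = ext_deriv (\<kappa> t) i x [u, v, w]
     + p * (time_deriv \<kappa> t i x [v, w] + ext_deriv (\<beta> t) i x [v, w])
     - q * (time_deriv \<kappa> t i x [u, w] + ext_deriv (\<beta> t) i x [u, w])
     + r * (time_deriv \<kappa> t i x [u, v] + ext_deriv (\<beta> t) i x [u, v])"
proof -
  have o: "open (S \<times> (UNIV :: real set))" "(x, t) \<in> S \<times> UNIV" using S by (auto intro: open_Times)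
  note d = lift_differentiable[OF S \<omega>] lift_differentiable[OF S \<eta>]
  have "pd (\<lambda>z. F i z [(a, b), (c, d)]) (x, t) (y, s) =
      pd (\<lambda>z. lift \<kappa> i z [(a, b), (c, d)] + (lift \<beta> i z [(a, b)] * d - lift \<beta> i z [(c, d)] * b)) (x, t) (y, s)" for a b c d y s
  proof (rule pd_cong[OF o])
    fix z assume z: "z \<in> S \<times> (UNIV :: real set)"
    then have "alternating 1 (lift \<beta> i z)" using family_onD(1)[OF \<eta>] by (auto intro: alternating_lift)
    from wedge_1_1[OF this alternating_dt, of i z] F[OF z]
    show "F i z [(a, b), (c, d)] = lift \<kappa> i z [(a, b), (c, d)] + (lift \<beta> i z [(a, b)] * d - lift \<beta> i z [(c, d)] * b)"
      by (simp add: form_wedge_def dt_def)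
  qed
  then have pdF: "pd (\<lambda>z. F i z [(a, b), (c, d)]) (x, t) (y, s) =
      pd (\<lambda>x. \<kappa> t i x [a, c]) x y + s * time_deriv \<kappa> t i x [a, c]
      + ((pd (\<lambda>x. \<beta> t i x [a]) x y + s * time_deriv \<beta> t i x [a]) * d
      - (pd (\<lambda>x. \<beta> t i x [c]) x y + s * time_deriv \<beta> t i x [c]) * b)" for a b c d y s
    by (simp add: pd_add pd_diff pd_mult_const d pd_lift[OF S \<omega>] pd_lift[OF S \<eta>])
  show ?thesis unfolding ext_deriv_3 ext_deriv_2 pdF by (simp add: algebra_simps)
qed

text \<open>Here d\<beta> is a 3-form, so moving dt in front of it produces the minus sign. The
  value of F is prescribed on triples, where \<omega>3 \<and> \<eta> can be rewritten as \<eta>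
  \<and> \<omega>3 by the explicit wedge formulas.\<close>

lemma ext_deriv_cylinder_3:
  assumes \<kappa>: "family_on 3 S i \<kappa>" and \<beta>: "family_on 2 S i \<beta>"
    and F: "\<And>z vs. z \<in> S \<times> UNIV \<Longrightarrow> length vs = 3 \<Longrightarrow> F i z vs = (lift \<kappa> + lift \<beta> \<and>\<^sub>F dt) i z vs"
  shows "ext_deriv F i (x, t) [(u, p), (v, q), (w, r), (y, s)] = ext_deriv (\<kappa> t) i x [u, v, w, y]
     + p * (time_deriv \<kappa> t i x [v, w, y] - ext_deriv (\<beta> t) i x [v, w, y])
     - q * (time_deriv \<kappa> t i x [u, w, y] - ext_deriv (\<beta> t) i x [u, w, y])
     + r * (time_deriv \<kappa> t i x [u, v, y] - ext_deriv (\<beta> t) i x [u, v, y])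
     - s * (time_deriv \<kappa> t i x [u, v, w] - ext_deriv (\<beta> t) i x [u, v, w])"
proof -
  have o: "open (S \<times> (UNIV :: real set))" "(x, t) \<in> S \<times> UNIV" using S by (auto intro: open_Times)
  note d = lift_differentiable[OF S \<kappa>] lift_differentiable[OF S \<beta>]
  have "pd (\<lambda>z. F i z [(a, b), (c, d), (e, f)]) (x, t) (g, h) =
      pd (\<lambda>z. lift \<kappa> i z [(a, b), (c, d), (e, f)] + (lift \<beta> i z [(c, d), (e, f)] * b
        - lift \<beta> i z [(a, b), (e, f)] * d + lift \<beta> i z [(a, b), (c, d)] * f)) (x, t) (g, h)" for a b c d e f g h
  proof (rule pd_cong[OF o])
    fix z assume z: "z \<in> S \<times> (UNIV :: real set)"
    then have "alternating 2 (lift \<beta> i z)" using family_onD(1)[OF \<beta>] by (auto intro: alternating_lift)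
    from wedge_2_1[OF this alternating_dt, of i z] F[OF z]
    show "F i z [(a, b), (c, d), (e, f)] = lift \<kappa> i z [(a, b), (c, d), (e, f)] + (lift \<beta> i z [(c, d), (e, f)] * b
        - lift \<beta> i z [(a, b), (e, f)] * d + lift \<beta> i z [(a, b), (c, d)] * f)"
      by (simp add: form_wedge_def dt_def)
  qed
  then have pdF: "pd (\<lambda>z. F i z [(a, b), (c, d), (e, f)]) (x, t) (g, h) =
      pd (\<lambda>x. \<kappa> t i x [a, c, e]) x g + h * time_deriv \<kappa> t i x [a, c, e]
      + ((pd (\<lambda>x. \<beta> t i x [c, e]) x g + h * time_deriv \<beta> t i x [c, e]) * b
      - (pd (\<lambda>x. \<beta> t i x [a, e]) x g + h * time_deriv \<beta> t i x [a, e]) * d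
      + (pd (\<lambda>x. \<beta> t i x [a, c]) x g + h * time_deriv \<beta> t i x [a, c]) * f)" for a b c d e f g h
    by (simp add: pd_add pd_diff pd_mult_const d pd_lift[OF S \<kappa>] pd_lift[OF S \<beta>])
  show ?thesis unfolding ext_deriv_4 ext_deriv_3 pdF by (simp add: algebra_simps)
qed

end

section \<open>The adapted coframe\<close>

lemma SU2_structure_point:
  assumes "SU2_structure N \<eta> \<omega>" "i \<in> idx N" "x \<in> img N i"
  shows "\<exists>v. su2_point (\<eta> i x) (\<lambda>a. \<omega> a i x) v"
proof -
  obtain v where v: "is_form N 4 v" "nowhere_zero N (v \<and>\<^sub>F \<eta>)"
    and vv: "\<And>a b. a \<in> {1,2,3} \<Longrightarrow> b \<in> {1,2,3} \<Longrightarrow> \<omega> a \<and>\<^sub>F \<omega> b \<doteq>\<^bsub>N\<^esub> (if a = b then v else 0)"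
    using assms(1) unfolding SU2_structure_def by blast
  have prod: "\<omega> a i x \<and>\<^sub>c \<omega> b i x = (if a = b then v else 0) i x" if "a \<in> {1,2,3}" "b \<in> {1,2,3}" for a b
    using vv[OF that] assms(2,3) unfolding form_eq_def form_wedge_def by blast
  have "su2_point (\<eta> i x) (\<lambda>a. \<omega> a i x) (v i x)"
  proof
    show "alternating 1 (\<eta> i x)" "alternating 4 (v i x)"
      using assms v(1) unfolding SU2_structure_def by (auto intro: is_form_alternating)
    show "alternating 2 (\<omega> a i x)" if "a \<in> {1,2,3}" for a
      using assms that unfolding SU2_structure_def by (blast intro: is_form_alternating)
    show "\<omega> a i x \<and>\<^sub>c \<omega> a i x = v i x" if "a \<in> {1,2,3}" for a
      using prod[OF that that] by simp
    show "\<omega> a i x \<and>\<^sub>c \<omega> b i x = 0" if "a \<in> {1,2,3}" "b \<in> {1,2,3}" "a \<noteq> b" for a b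
      using prod[OF that(1,2)] that(3) by simp
    show "v i x \<and>\<^sub>c \<eta> i x \<noteq> 0"
      using v(2) assms(2,3) by (simp add: nowhere_zero_def form_wedge_def)
    show "\<omega> 3 i x [X, Y] \<ge> 0" if "X \<lrcorner> \<omega> 1 i x = Y \<lrcorner> \<omega> 2 i x" for X Y
      using assms that unfolding SU2_structure_def by blast
  qed
  then show ?thesis by blast
qed

lemma (in su2_point) w1_nonzero: "\<exists>X z. w 1 [X, z] \<noteq> 0"
proof (rule ccontr)
  assume "\<not> ?thesis"
  then have z: "w 1 [x, y] = 0" for x y by blast
  have "v us = 0" for us
  proof (cases "length us = 4")
    case True
    then obtain p q r s where us: "us = [p, q, r, s]"
      by (auto simp: numeral_eq_Suc length_Suc_conv)
    show ?thesis unfolding us using v_formula[of 1 p q r s] by (simp add: z)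
  next
    case False
    then show ?thesis using alternating_length[OF v] by blast
  qed
  then have "(v \<and>\<^sub>c h) vs = 0" for vs by (simp add: wedge_def Let_def)
  then show False using volume by (auto simp: fun_eq_iff)
qed

definition covector :: "('e \<Rightarrow> 'b) \<Rightarrow> 'e list \<Rightarrow> 'b::zero" where
  "covector f us = (case us of [u] \<Rightarrow> f u | _ \<Rightarrow> 0)"

lemma covector_single [simp]: "covector f [u] = f u"
  by (simp add: covector_def)

lemma alternating_covector: "linear f \<Longrightarrow> alternating 1 (covector f)"
  by (auto simp: alternating_def covector_def length_Suc_conv split: list.split)

lemma smooth_on_covector: "(\<And>u. smooth_on S (\<lambda>x. f x u)) \<Longrightarrow> smooth_on S (\<lambda>x. covector (f x) us)"
  by (cases us rule: remdups_adj.cases) (simp_all add: covector_def smooth_on_const)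

lemma alternating_2_eqI:
  assumes "alternating 2 a" "alternating 2 b" "\<And>u v. a [u, v] = b [u, v]"
  shows "a = b"
proof
  fix us
  show "a us = b us"
  proof (cases "length us = 2")
    case True
    then obtain u v where "us = [u, v]" by (auto simp: numeral_eq_Suc length_Suc_conv)
    then show ?thesis using assms(3) by simp
  next
    case False
    then show ?thesis using assms(1,2)[THEN alternating_length] by simp
  qed
qed

lemma SU2_family_family_on:
  assumes "SU2_family N \<eta> \<omega>" "i \<in> idx N"
  shows "family_on 1 (img N i) i \<eta>" "a \<in> {1,2,3} \<Longrightarrow> family_on 2 (img N i) i (\<lambda>t. \<omega> t a)"
  using assms unfolding SU2_family_def by (blast intro: is_form_family_family_on)+

lemma atLeastAtMost_6: "{1..6::nat} = {1, 2, 3, 4, 5, 6}"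
  by auto

lemma SU3_coframe:
  fixes N :: "('i, 'a::{t2_space, second_countable_topology}, real ^ 5) atlas"
  assumes N: "smooth_manifold N" and fam: "SU2_family N \<eta> \<omega>" and i: "i \<in> idx N" and x: "x \<in> img N i"
  shows "\<exists>V e. open V \<and> (x, t) \<in> V \<and> V \<subseteq> img N i \<times> UNIV \<and> coframe V e \<and>
    (\<forall>y\<in>V. e 5 y = lift \<eta> i y \<and> e 6 y = dt i y \<and>
      lift (\<lambda>t. \<omega> t 1) i y = e 1 y \<and>\<^sub>c e 2 y + e 3 y \<and>\<^sub>c e 4 y \<and>
      lift (\<lambda>t. \<omega> t 2) i y = e 1 y \<and>\<^sub>c e 3 y - e 2 y \<and>\<^sub>c e 4 y \<and>
      lift (\<lambda>t. \<omega> t 3) i y = e 1 y \<and>\<^sub>c e 4 y + e 2 y \<and>\<^sub>c e 3 y)"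
proof -
  define S where "S = img N i"
  interpret manifold N by standard (rule N)
  have S: "open S" using open_img[OF i] by (simp add: S_def)
  have S': "open (S \<times> (UNIV :: real set))" using S by (auto intro: open_Times)
  define h where "h z = \<eta> (snd z) i (fst z)" for z
  define w where "w z a = \<omega> (snd z) a i (fst z)" for z a
  have point: "\<exists>v. su2_point (h z) (w z) v" if "z \<in> S \<times> UNIV" for z
  proof -
    have "SU2_structure N (\<eta> (snd z)) (\<omega> (snd z))" using fam by (simp add: SU2_family_def)
    from SU2_structure_point[OF this i, of "fst z"] show ?thesis
      using that by (auto simp: h_def w_def[abs_def] S_def)
  qed
  \<comment> \<open>Smoothness of components with fixed vectors u of N is read off from the lifted
    forms by evaluating these at (u, 0).\<close>
  have map_fst: "map fst (map (\<lambda>u. (u, 0 :: real)) us) = us" for us :: "(real ^ 5) list" by (induction us) auto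
  have hs: "smooth_on (S \<times> UNIV) (\<lambda>z. h z us)" for us
    using smooth_on_lift[OF S SU2_family_family_on(1)[OF fam i, folded S_def], of "map (\<lambda>u. (u, 0)) us"]
    unfolding lift_def case_prod_unfold map_fst h_def .
  have ws: "smooth_on (S \<times> UNIV) (\<lambda>z. w z a us)" if "a \<in> {1,2,3}" for us a
    using smooth_on_lift[OF S SU2_family_family_on(2)[OF fam i that, folded S_def], of "map (\<lambda>u. (u, 0)) us"]
    unfolding lift_def case_prod_unfold map_fst w_def .
  \<comment> \<open>X is chosen at the single point (x, t) and then kept constant nearby.
    Nonvanishing of its contraction with \<omega>1 at this point is what will give r > 0
    there.\<close>
  obtain X z0 where X: "w (x, t) 1 [X, z0] \<noteq> 0"
    using point[of "(x, t)"] su2_point.w1_nonzero x unfolding S_def by blast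
  define B where "B z y u = w z 2 [y, u] + h z [y] * h z [u]" for z y u
  define Y where "Y z = (\<chi> k. det (\<chi> i j. if j = k then w z 1 [X, axis i 1] else B z (axis j 1) (axis i 1)) /
    det (\<chi> i j. B z (axis j 1) (axis i 1)))" for z
  have Y: "w z 2 [Y z, u] = w z 1 [X, u]" "det (\<chi> i j. B z (axis j 1) (axis i 1)) \<noteq> 0" if "z \<in> S \<times> UNIV" for z u
  proof -
    note zS = that
    obtain v where "su2_point (h z) (w z) v" using point[OF zS] by blast
    then interpret su2_point "h z" "w z" v .
    have B: "B z = gram 2" by (intro ext) (simp add: B_def gram_def)
    show "det (\<chi> i j. B z (axis j 1) (axis i 1)) \<noteq> 0" unfolding B by (rule gram_det) simp
    have "gram 2 (Y z) u = w z 1 [X, u]" for u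
      unfolding Y_def B by (rule cramer_bilinear[OF gram_lin w_lin(2) gram_det]) simp_all
    moreover have "w z 1 [X, \<xi>] = 0" if "\<forall>b\<in>{1, 2, 3}. \<forall>u. w z b [\<xi>, u] = 0" for \<xi>
      using that w_swap[of 1 \<xi> X] by simp
    ultimately show "w z 2 [Y z, u] = w z 1 [X, u]"
      using gram_eq_iff(1)[of 2 "\<lambda>u. w z 1 [X, u]" "Y z" u] by simp
  qed
  \<comment> \<open>The component \<omega>3(Y, u) is expanded in the coordinates of Y, since
    smoothness of \<omega>3 is available for constant vectors only.\<close>
  define wY where "wY z u = (\<Sum>k\<in>UNIV. Y z $ k * w z 3 [axis k 1, u])" for z u
  have wY: "wY z u = w z 3 [Y z, u]" if "z \<in> S \<times> UNIV" for z u
  proof -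
    note zS = that
    obtain v where "su2_point (h z) (w z) v" using point[OF zS] by blast
    then interpret su2_point "h z" "w z" v .
    have "w z 3 [Y z, u] = w z 3 [\<Sum>k\<in>UNIV. Y z $ k *s axis k 1, u]" by (simp add: basis_expansion)
    also have "\<dots> = wY z u"
      by (simp add: wY_def linear_sum[OF w_lin(1)] linear_cmul[OF w_lin(1)] scalar_mult_eq_scaleR)
    finally show ?thesis ..
  qed
  have Bs: "smooth_on (S \<times> UNIV) (\<lambda>z. B z y u)" for y u
    unfolding B_def by (intro smooth_on_add smooth_on_mult S' ws hs) simp
  have Ys: "smooth_on (S \<times> UNIV) (\<lambda>z. Y z $ k)" for k
  proof -
    have "smooth_on (S \<times> UNIV) (\<lambda>z. if j = k then w z 1 [X, axis i 1] else B z (axis j 1) (axis i 1))" for i j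
      using ws[of 1 "[X, axis i 1]"] Bs[of "axis j 1" "axis i 1"] by (cases "j = k") simp_all
    then show ?thesis
      unfolding Y_def vec_lambda_beta
      by (intro smooth_on_divide smooth_on_det S' Y(2)) (simp_all add: Bs)
  qed
  have wYs: "smooth_on (S \<times> UNIV) (\<lambda>z. wY z u)" for u
    unfolding wY_def by (intro smooth_on_sum smooth_on_mult S' Ys ws) simp
  define r where "r z = - wY z X" for z
  have rs: "smooth_on (S \<times> UNIV) r"
    unfolding r_def by (intro smooth_on_minus S' wYs)
  have r: "r z = w z 3 [X, Y z]" if "z \<in> S \<times> UNIV" for z
  proof -
    note zS = that
    obtain v where "su2_point (h z) (w z) v" using point[OF zS] by blast
    then interpret su2_point "h z" "w z" v .
    show ?thesis using wY[OF that, of X] w_swap[of 3 X "Y z"] by (simp add: r_def)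
  qed
  define V where "V = {z \<in> S \<times> UNIV. r z > 0}"
  have VS: "V \<subseteq> S \<times> UNIV" by (auto simp: V_def)
  have V: "open V"
  proof -
    have "V = (S \<times> UNIV) \<inter> r -` {0<..}" by (auto simp: V_def)
    then show ?thesis
      using continuous_open_preimage[OF smooth_on_imp_continuous[OF rs] S', of "{0<..}"] by simp
  qed
  have xV: "(x, t) \<in> V"
  proof -
    have z: "(x, t) \<in> S \<times> UNIV" using x by (simp add: S_def)
    obtain v where "su2_point (h (x, t)) (w (x, t)) v" using point[OF z] by blast
    then interpret su2_point "h (x, t)" "w (x, t)" v .
    show ?thesis using length_positive[OF Y(1)[OF z] refl X] r[OF z] z by (simp add: V_def)
  qed
  \<comment> \<open>For k = 2, 3, 4 the covector comes from \<omega>1, \<omega>2, \<omega>3, which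
    is the shift k - 1. All four covectors of this kind factor through \<open>fst\<close> and so
    vanish on the time direction.\<close>
  define e where "e k z = (if k = 5 then lift \<eta> i z else if k = 6 then dt i z else
    covector (\<lambda>u. (if k = 1 then - wY z (fst u) else w z (k - 1) [X, fst u]) / sqrt (r z)))" for k :: nat and z
  have wi: "k - 1 \<in> {1,2,3}" if "k \<in> {2,3,4}" for k :: nat using that by auto
  have lin_e: "alternating 1 (e k z)" if z: "z \<in> V" and k: "k \<in> {1..6}" for k z
  proof -
    have zS: "z \<in> S \<times> UNIV" using z VS by auto
    obtain v where "su2_point (h z) (w z) v" using point[OF zS] by blast
    then interpret su2_point "h z" "w z" v .
    have eta: "alternating 1 (lift \<eta> i z)"
      using alternating_lift[of 1 \<eta> "snd z" i "fst z"] h by (simp add: h_def)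
    have lw: "linear (\<lambda>u :: (real ^ 5) \<times> real. w z a [y, fst u] / c)" if "a \<in> {1,2,3}" for a y c
    proof -
      have "linear (\<lambda>u :: (real ^ 5) \<times> real. w z a [y, fst u])"
        using linear_compose[OF linear_fst w_lin(2)[OF that, of y]] by (simp add: o_def)
      then show ?thesis by (auto simp: linear_iff add_divide_distrib)
    qed
    have k': "k \<in> {1, 2, 3, 4, 5, 6}" using k by auto
    have "linear (\<lambda>u :: (real ^ 5) \<times> real. - wY z (fst u) / sqrt (r z))"
      using lw[of 3 "Y z" "- sqrt (r z)"] by (simp add: wY[OF zS])
    then show ?thesis
      using k' eta alternating_dt[of i z] lw[of 1 X, unfolded One_nat_def] lw[of 2 X] lw[of 3 X]
      unfolding e_def by (auto intro!: alternating_covector)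
  qed
  have smooth_e: "smooth_on V (\<lambda>z. e k z us)" if "k \<in> {1..6}" for k us
  proof -
    have k': "k = 5 \<or> k = 6 \<or> k = 1 \<or> k \<in> {2, 3, 4}" using that by auto
    have rp: "smooth_on V (\<lambda>z. sqrt (r z))" "\<And>z. z \<in> V \<Longrightarrow> sqrt (r z) \<noteq> 0"
      using smooth_on_sqrt[OF V smooth_on_subset[OF rs VS V]] by (auto simp: V_def)
    have 1: "smooth_on V (\<lambda>z. - wY z u / sqrt (r z))" for u
      by (intro smooth_on_divide V rp smooth_on_minus smooth_on_subset[OF wYs VS V])
    have 2: "smooth_on V (\<lambda>z. w z (k - 1) [X, u] / sqrt (r z))" if "k \<in> {2, 3, 4}" for k u
      by (intro smooth_on_divide V rp smooth_on_subset[OF ws[OF wi[OF that]] VS V])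
    have 5: "smooth_on V (\<lambda>z. lift \<eta> i z us)"
      using smooth_on_subset[OF smooth_on_lift[OF S SU2_family_family_on(1)[OF fam i, folded S_def]] VS V] .
    from k' show ?thesis
    proof (elim disjE)
      assume "k = 1"
      then have "e k z = covector (\<lambda>u. - wY z (fst u) / sqrt (r z))" for z by (simp add: e_def)
      then show ?thesis using smooth_on_covector[OF 1] by simp
    next
      assume "k \<in> {2, 3, 4}"
      then have "e k z = covector (\<lambda>u. w z (k - 1) [X, fst u] / sqrt (r z))" for z by (auto simp: e_def)
      then show ?thesis using smooth_on_covector[OF 2[OF \<open>k \<in> {2, 3, 4}\<close>]] by simp
    qed (use 5 in \<open>simp_all add: e_def dt_def smooth_on_const\<close>)
  qed
  have e_simps: "e 5 z = lift \<eta> i z" "e 6 z = dt i z" "e 1 z [u] = - wY z (fst u) / sqrt (r z)"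
    "e 2 z [u] = w z 1 [X, fst u] / sqrt (r z)" "e 3 z [u] = w z 2 [X, fst u] / sqrt (r z)"
    "e 4 z [u] = w z 3 [X, fst u] / sqrt (r z)" for z u
    by (simp_all add: e_def)
  have "coframe V e"
    unfolding coframe_def smooth_form_on_def
  proof (intro conjI ballI allI impI)
    fix k z us assume "k \<in> {1..DIM((real ^ 5) \<times> real)}"
    then have k: "k \<in> {1..6}" by simp
    then show "smooth_on V (\<lambda>z. e k z us)" by (rule smooth_e)
    show "alternating 1 (e k z)" if "z \<in> V" using lin_e[OF that k] .
  next
    fix z c k assume z: "z \<in> V" and c: "\<forall>u. (\<Sum>k = 1..DIM((real ^ 5) \<times> real). c k * e k z [u]) = 0"
      and k: "k \<in> {1..DIM((real ^ 5) \<times> real)}"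
    have zS: "z \<in> S \<times> UNIV" using z VS by auto
    obtain v where "su2_point (h z) (w z) v" using point[OF zS] by blast
    then interpret su2_point "h z" "w z" v .
    have rp: "r z > 0" using z by (simp add: V_def)
    have c': "c 1 * (- w z 3 [Y z, a] / sqrt (r z)) + c 2 * (w z 1 [X, a] / sqrt (r z)) + c 3 * (w z 2 [X, a] / sqrt (r z))
        + c 4 * (w z 3 [X, a] / sqrt (r z)) + c 5 * h z [a] + c 6 * s = 0" for a s
    proof -
      have "(\<Sum>k\<in>{1, 2, 3, 4, 5, 6}. c k * e k z [(a, s)]) = 0"
        using c by (simp add: atLeastAtMost_6[symmetric])
      then show ?thesis
        by (simp add: e_simps wY[OF zS] lift_def case_prod_unfold h_def dt_def add.assoc)
    qed
    \<comment> \<open>On the vector (0, 1) all covectors except \<open>dt\<close> vanish.\<close>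
    have c6: "c 6 = 0"
      using c'[of 0 1] linear_0[OF h_lin] linear_0[OF w_lin(2)[of 1]] linear_0[OF w_lin(2)[of 2]] linear_0[OF w_lin(2)[of 3]]
      by simp
    \<comment> \<open>\<open>coframe_independent\<close> concerns the unnormalised covectors.
      Multiplying by \<surd>r clears their denominators and turns the coefficient of
      \<open>h\<close> into c5 \<surd>r.\<close>
    have "c 1 * (- w z 3 [Y z, u]) + c 2 * w z 1 [X, u] + c 3 * w z 2 [X, u] + c 4 * w z 3 [X, u]
        + (c 5 * sqrt (r z)) * h z [u] = 0" for u
    proof -
      have "sqrt (r z) \<noteq> 0" using rp by simp
      then show ?thesis
        using arg_cong[OF c'[of u 0], of "\<lambda>y. sqrt (r z) * y"] c6 by (simp add: algebra_simps)
    qed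
    from coframe_independent[OF Y(1)[OF zS] r[OF zS] rp this]
    have "c 1 = 0" "c 2 = 0" "c 3 = 0" "c 4 = 0" "c 5 = 0" using rp by auto
    moreover have "k \<in> {1, 2, 3, 4, 5, 6}" using k by (simp add: atLeastAtMost_6)
    ultimately show "c k = 0" using c6 by auto
  qed
  moreover have "lift (\<lambda>t. \<omega> t 1) i z = e 1 z \<and>\<^sub>c e 2 z + e 3 z \<and>\<^sub>c e 4 z"
      "lift (\<lambda>t. \<omega> t 2) i z = e 1 z \<and>\<^sub>c e 3 z - e 2 z \<and>\<^sub>c e 4 z"
      "lift (\<lambda>t. \<omega> t 3) i z = e 1 z \<and>\<^sub>c e 4 z + e 2 z \<and>\<^sub>c e 3 z" if z: "z \<in> V" for z
  proof -
    have zS: "z \<in> S \<times> UNIV" using z VS by auto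
    obtain v where "su2_point (h z) (w z) v" using point[OF zS] by blast
    then interpret su2_point "h z" "w z" v .
    have rp: "r z > 0" using z by (simp add: V_def)
    have al: "alternating 2 (lift (\<lambda>t. \<omega> t a) i z)" if "a \<in> {1,2,3}" for a
      using alternating_lift[of 2 "\<lambda>t. \<omega> t a" "snd z" i "fst z"] w[OF that] by (simp add: w_def)
    have lw: "lift (\<lambda>t. \<omega> t a) i z [p, q] = w z a [fst p, fst q]" for a p q
      by (simp add: lift_def case_prod_unfold w_def)
    have ae: "alternating 1 (e 1 z)" "alternating 1 (e 2 z)" "alternating 1 (e 3 z)" "alternating 1 (e 4 z)"
      using lin_e[OF z] by auto
    have aw: "alternating 2 (a \<and>\<^sub>c b)" if "alternating 1 a" "alternating 1 b" for a b :: "((real ^ 5) \<times> real) list \<Rightarrow> real"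
      using alternating_wedge[OF that] by (simp add: numeral_2_eq_2)
    have sq: "\<bar>r z\<bar> = r z" using rp by simp
    note split = w1_split[OF Y(1)[OF zS] r[OF zS]] w2_split[OF Y(1)[OF zS] r[OF zS]] w3_split[OF Y(1)[OF zS] r[OF zS]]
    have div: "a = b / r z" if "r z * a = b" for a b using that rp by (simp add: field_simps)
    show "lift (\<lambda>t. \<omega> t 1) i z = e 1 z \<and>\<^sub>c e 2 z + e 3 z \<and>\<^sub>c e 4 z"
    proof (intro alternating_2_eqI al alternating_add aw ae)
      fix p q
      show "lift (\<lambda>t. \<omega> t 1) i z [p, q] = (e 1 z \<and>\<^sub>c e 2 z + e 3 z \<and>\<^sub>c e 4 z) [p, q]"
        unfolding lw
        by (subst div[OF split(1)]) (simp add: wedge_1_1 ae e_simps wY[OF zS] sq times_divide_times_eq diff_divide_distrib add_divide_distrib mult.commute)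
    qed simp_all
    show "lift (\<lambda>t. \<omega> t 2) i z = e 1 z \<and>\<^sub>c e 3 z - e 2 z \<and>\<^sub>c e 4 z"
    proof (intro alternating_2_eqI al alternating_diff aw ae)
      fix p q
      show "lift (\<lambda>t. \<omega> t 2) i z [p, q] = (e 1 z \<and>\<^sub>c e 3 z - e 2 z \<and>\<^sub>c e 4 z) [p, q]"
        unfolding lw
        by (subst div[OF split(2)]) (simp add: wedge_1_1 ae e_simps wY[OF zS] sq times_divide_times_eq diff_divide_distrib add_divide_distrib mult.commute)
    qed simp_all
    show "lift (\<lambda>t. \<omega> t 3) i z = e 1 z \<and>\<^sub>c e 4 z + e 2 z \<and>\<^sub>c e 3 z"
    proof (intro alternating_2_eqI al alternating_add aw ae)
      fix p q
      show "lift (\<lambda>t. \<omega> t 3) i z [p, q] = (e 1 z \<and>\<^sub>c e 4 z + e 2 z \<and>\<^sub>c e 3 z) [p, q]"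
        unfolding lw
        by (subst div[OF split(3)]) (simp add: wedge_1_1 ae e_simps wY[OF zS] sq times_divide_times_eq diff_divide_distrib add_divide_distrib mult.commute)
    qed simp_all
  qed
  ultimately show ?thesis
    using V xV VS unfolding S_def by (intro exI[of _ V] exI[of _ e]) (auto simp: e_simps)
qed

text \<open>The three forms are \<omega>1 + \<eta> \<and> dt and the real and imaginary parts of
  (\<omega>2 + i \<omega>3) \<and> (\<eta> + i dt).\<close>

lemma SU3_structure_cylinder:
  fixes N :: "('i, 'a::{t2_space, second_countable_topology}, real ^ 5) atlas"
  assumes N: "smooth_manifold N" and fam: "SU2_family N \<eta> \<omega>"
  shows "SU3_structure (times_real N) (lift (\<lambda>t. \<omega> t 1) + lift \<eta> \<and>\<^sub>F dt)
    (lift (\<lambda>t. \<omega> t 2) \<and>\<^sub>F lift \<eta> - lift (\<lambda>t. \<omega> t 3) \<and>\<^sub>F dt)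
    (lift (\<lambda>t. \<omega> t 2) \<and>\<^sub>F dt + lift (\<lambda>t. \<omega> t 3) \<and>\<^sub>F lift \<eta>)"
proof -
  interpret manifold N by standard (rule N)
  have \<eta>: "is_form (times_real N) 1 (lift \<eta>)" and \<omega>: "\<And>a. a \<in> {1,2,3} \<Longrightarrow> is_form (times_real N) 2 (lift (\<lambda>t. \<omega> t a))"
    using fam is_form_lift unfolding SU2_family_def by blast+
  note op = open_img_times_real
  have F: "is_form (times_real N) 2 (lift (\<lambda>t. \<omega> t 1) + lift \<eta> \<and>\<^sub>F dt)"
    using is_form_add[OF op \<omega>[of 1], of "lift \<eta> \<and>\<^sub>F dt"] is_form_wedge[OF op \<eta> is_form_dt] by (simp add: numeral_2_eq_2)
  have P: "is_form (times_real N) 3 (lift (\<lambda>t. \<omega> t 2) \<and>\<^sub>F lift \<eta> - lift (\<lambda>t. \<omega> t 3) \<and>\<^sub>F dt)"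
    using is_form_diff[OF op is_form_wedge[OF op \<omega>[of 2] \<eta>] is_form_wedge[OF op \<omega>[of 3] is_form_dt]] by simp
  have M: "is_form (times_real N) 3 (lift (\<lambda>t. \<omega> t 2) \<and>\<^sub>F dt + lift (\<lambda>t. \<omega> t 3) \<and>\<^sub>F lift \<eta>)"
    using is_form_add[OF op is_form_wedge[OF op \<omega>[of 2] is_form_dt] is_form_wedge[OF op \<omega>[of 3] \<eta>]] by simp
  show ?thesis
    unfolding SU3_structure_def idx_times_real img_times_real
  proof (intro conjI ballI F P M)
    show "DIM((real ^ 5) \<times> real) = 6" by simp
    fix i z assume i: "i \<in> idx N" and z: "z \<in> img N i \<times> (UNIV :: real set)"
    obtain x t where xt: "z = (x, t)" "x \<in> img N i" using z by auto
    obtain V e where V: "open V" "(x, t) \<in> V" "V \<subseteq> img N i \<times> UNIV" "coframe V e"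
      and e: "\<And>y. y \<in> V \<Longrightarrow> e 5 y = lift \<eta> i y \<and> e 6 y = dt i y \<and>
      lift (\<lambda>t. \<omega> t 1) i y = e 1 y \<and>\<^sub>c e 2 y + e 3 y \<and>\<^sub>c e 4 y \<and>
      lift (\<lambda>t. \<omega> t 2) i y = e 1 y \<and>\<^sub>c e 3 y - e 2 y \<and>\<^sub>c e 4 y \<and>
      lift (\<lambda>t. \<omega> t 3) i y = e 1 y \<and>\<^sub>c e 4 y + e 2 y \<and>\<^sub>c e 3 y"
      using SU3_coframe[OF N fam i xt(2), of t] by blast
    have "(lift (\<lambda>t. \<omega> t 1) + lift \<eta> \<and>\<^sub>F dt) i y = (e 1 y \<and>\<^sub>c e 2 y) + (e 3 y \<and>\<^sub>c e 4 y) + (e 5 y \<and>\<^sub>c e 6 y)"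
      if "y \<in> V" for y
      using e[OF that] by (simp add: form_wedge_def)
    moreover have "complex_form (lift (\<lambda>t. \<omega> t 2) \<and>\<^sub>F lift \<eta> - lift (\<lambda>t. \<omega> t 3) \<and>\<^sub>F dt)
        (lift (\<lambda>t. \<omega> t 2) \<and>\<^sub>F dt + lift (\<lambda>t. \<omega> t 3) \<and>\<^sub>F lift \<eta>) i y =
      (\<lambda>us. Complex (e 1 y us) (e 2 y us)) \<and>\<^sub>c
             (\<lambda>us. Complex (e 3 y us) (e 4 y us)) \<and>\<^sub>c
             (\<lambda>us. Complex (e 5 y us) (e 6 y us))" if "y \<in> V" for y
    proof -
      \<comment> \<open>Since \<omega>2 = e13 - e24 and \<omega>3 = e14 + e23, the product of the
        first two complex covectors is \<omega>2 + i \<omega>3.\<close>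
      have prod: "(\<lambda>us. Complex (e 1 y us) (e 2 y us)) \<and>\<^sub>c (\<lambda>us. Complex (e 3 y us) (e 4 y us)) =
        (\<lambda>us. Complex (lift (\<lambda>t. \<omega> t 2) i y us) (lift (\<lambda>t. \<omega> t 3) i y us))"
        unfolding wedge_Complex using e[OF that] by simp
      have "e 5 y = lift \<eta> i y" "e 6 y = dt i y" using e[OF that] by blast+
      then show ?thesis
        unfolding prod by (simp add: wedge_Complex complex_form_def form_wedge_def)
    qed
    ultimately show "\<exists>V e. open V \<and> z \<in> V \<and> V \<subseteq> img N i \<times> UNIV \<and> coframe V e \<and>
        (\<forall>y\<in>V. (lift (\<lambda>t. \<omega> t 1) + lift \<eta> \<and>\<^sub>F dt) i y = (e 1 y \<and>\<^sub>c e 2 y) + (e 3 y \<and>\<^sub>c e 4 y) + (e 5 y \<and>\<^sub>c e 6 y) \<and>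
           complex_form (lift (\<lambda>t. \<omega> t 2) \<and>\<^sub>F lift \<eta> - lift (\<lambda>t. \<omega> t 3) \<and>\<^sub>F dt)
             (lift (\<lambda>t. \<omega> t 2) \<and>\<^sub>F dt + lift (\<lambda>t. \<omega> t 3) \<and>\<^sub>F lift \<eta>) i y =
             (\<lambda>us. Complex (e 1 y us) (e 2 y us)) \<and>\<^sub>c
             (\<lambda>us. Complex (e 3 y us) (e 4 y us)) \<and>\<^sub>c
             (\<lambda>us. Complex (e 5 y us) (e 6 y us)))"
      using V unfolding xt(1) by (intro exI[of _ V] exI[of _ e]) simp
  qed
qed

section \<open>The structure equations on the cylinder\<close>

lemma length_3E: "length us = 3 \<Longrightarrow> (\<And>u v w. us = [u, v, w] \<Longrightarrow> P) \<Longrightarrow> P"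
  by (auto simp: numeral_eq_Suc length_Suc_conv)

lemma length_4E: "length us = 4 \<Longrightarrow> (\<And>u v w z. us = [u, v, w, z] \<Longrightarrow> P) \<Longrightarrow> P"
  by (auto simp: numeral_eq_Suc length_Suc_conv)

lemma length_2E: "length us = 2 \<Longrightarrow> (\<And>u v. us = [u, v] \<Longrightarrow> P) \<Longrightarrow> P"
  by (auto simp: numeral_eq_Suc length_Suc_conv)

text \<open>One chart with everything the differential equations need. The algebra of the
  SU(2)-structure is represented by \<omega>1 \<and> \<omega>3 = 0, the relation behind the
  propagation of the second nearly hypo equation.\<close>

locale su2_chart =
  fixes S :: "(real ^ 5) set" and i :: 'i
    and \<eta> :: "real \<Rightarrow> ('i, real ^ 5, real) form" and \<omega> :: "real \<Rightarrow> nat \<Rightarrow> ('i, real ^ 5, real) form"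
  assumes S: "open S" and \<eta>: "family_on 1 S i \<eta>"
    and \<omega>: "a \<in> {1, 2, 3} \<Longrightarrow> family_on 2 S i (\<lambda>t. \<omega> t a)"
    and orthogonal: "x \<in> S \<Longrightarrow> \<omega> t 1 i x \<and>\<^sub>c \<omega> t 3 i x = 0"
begin

declare One_nat_def [simp del]

lemmas \<omega>2 = \<omega>[of 2, simplified] and \<omega>3 = \<omega>[of 3, simplified]

lemma \<omega>1: "family_on 2 S i (\<lambda>t. \<omega> t 1)"
  by (rule \<omega>) simp

lemma alt:
  assumes "x \<in> S"
  shows "alternating 1 (\<eta> t i x)" "alternating 2 (\<omega> t 1 i x)" "alternating 2 (\<omega> t 2 i x)" "alternating 2 (\<omega> t 3 i x)"
  using family_onD(1)[OF \<eta> assms] family_onD(1)[OF \<omega>1 assms] family_onD(1)[OF \<omega>2 assms] family_onD(1)[OF \<omega>3 assms]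
  by blast+

lemma alt_lift:
  assumes "z \<in> S \<times> UNIV"
  shows "alternating 1 (lift \<eta> i z)" "alternating 2 (lift (\<lambda>t. \<omega> t 1) i z)" "alternating 2 (lift (\<lambda>t. \<omega> t 2) i z)"
    "alternating 2 (lift (\<lambda>t. \<omega> t 3) i z)"
  using assms alt by (auto intro!: alternating_lift)

lemma smooth:
  "smooth_on S (\<lambda>y. \<eta> t i y vs)" "smooth_on S (\<lambda>y. \<omega> t 1 i y vs)" "smooth_on S (\<lambda>y. \<omega> t 2 i y vs)" "smooth_on S (\<lambda>y. \<omega> t 3 i y vs)"
  using family_smooth_at_time[OF S \<eta>] family_smooth_at_time[OF S \<omega>1] family_smooth_at_time[OF S \<omega>2] family_smooth_at_time[OF S \<omega>3]
  by blast+

lemma \<eta>\<omega>: "a \<in> {1, 2, 3} \<Longrightarrow> family_on 3 S i (\<lambda>t. \<eta> t \<and>\<^sub>F \<omega> t a)"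
  using family_on_wedge[OF S \<eta> \<omega>, of a] by simp

lemma form_wedge_formulas:
  assumes "x \<in> S" "a \<in> {1, 2, 3}"
  shows "(\<eta> t \<and>\<^sub>F \<omega> t a) i x [u, v, w] =
    \<eta> t i x [u] * \<omega> t a i x [v, w] - \<eta> t i x [v] * \<omega> t a i x [u, w] + \<eta> t i x [w] * \<omega> t a i x [u, v]"
  unfolding form_wedge_def using wedge_1_2 family_onD(1)[OF \<eta> assms(1)] family_onD(1)[OF \<omega>[OF assms(2)] assms(1)] by blast

lemma \<omega>1_squared:
  assumes "x \<in> S"
  shows "(\<omega> t 1 \<and>\<^sub>F \<omega> t 1) i x [u, v, w, z] = 2 * (\<omega> t 1 i x [u, v] * \<omega> t 1 i x [w, z]
    - \<omega> t 1 i x [u, w] * \<omega> t 1 i x [v, z] + \<omega> t 1 i x [u, z] * \<omega> t 1 i x [v, w])"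
  unfolding form_wedge_def wedge_2_2[OF alt(2)[OF assms] alt(2)[OF assms]] by simp

text \<open>The dt-part of 3 \<Psi>+ is -3 \<omega>3 \<and> dt = -3 dt \<and> \<omega>3, which is
  the source of the term -3 \<omega>3. F is prescribed near the point because it is differentiated,
  P only at the point.\<close>

lemma dF_iff:
  assumes x: "x \<in> S"
    and F: "\<And>z. z \<in> S \<times> UNIV \<Longrightarrow> F i z = (lift (\<lambda>t. \<omega> t 1) + lift \<eta> \<and>\<^sub>F dt) i z"
    and P: "P i (x, t) = (lift (\<lambda>t. \<omega> t 2) \<and>\<^sub>F lift \<eta> - lift (\<lambda>t. \<omega> t 3) \<and>\<^sub>F dt) i (x, t)"
  shows "ext_deriv F i (x, t) = (3 *\<^sub>F P) i (x, t) \<longleftrightarrow>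
    ext_deriv (\<omega> t 1) i x = (3 *\<^sub>F (\<eta> t \<and>\<^sub>F \<omega> t 2)) i x \<and>
    time_deriv (\<lambda>s. \<omega> s 1) t i x = (- ext_deriv (\<eta> t) - 3 *\<^sub>F \<omega> t 3) i x" (is "?L = (?A \<and> ?E)")
proof -
  have z: "(x, t) \<in> S \<times> UNIV" using x by simp
  have o: "open (S \<times> (UNIV :: real set))" using S by (auto intro: open_Times)
  have aF: "ext_deriv F i (x, t) [(u, p), (v, q), (w, r)] = ext_deriv (\<omega> t 1) i x [u, v, w]
     + p * (time_deriv (\<lambda>t. \<omega> t 1) t i x [v, w] + ext_deriv (\<eta> t) i x [v, w])
     - q * (time_deriv (\<lambda>t. \<omega> t 1) t i x [u, w] + ext_deriv (\<eta> t) i x [u, w])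
     + r * (time_deriv (\<lambda>t. \<omega> t 1) t i x [u, v] + ext_deriv (\<eta> t) i x [u, v])" for u v w p q r
    by (rule ext_deriv_cylinder_2[OF S x \<omega>1 \<eta>]) (rule F)
  have aF2: "alternating 2 (F i y)" if "y \<in> S \<times> UNIV" for y
    using alternating_add[OF alt_lift(2)[OF that] alternating_wedge[OF alt_lift(1)[OF that] alternating_dt, simplified], of i y] F[OF that]
    by (simp add: form_wedge_def)
  have P3: "P i (x, t) [(u, p), (v, q), (w, r)] = \<omega> t 2 i x [v, w] * \<eta> t i x [u] - \<omega> t 2 i x [u, w] * \<eta> t i x [v]
      + \<omega> t 2 i x [u, v] * \<eta> t i x [w]
      - (\<omega> t 3 i x [v, w] * p - \<omega> t 3 i x [u, w] * q + \<omega> t 3 i x [u, v] * r)" for u v w p q r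
    unfolding P using wedge_2_1[OF alt_lift(3)[OF z] alt_lift(1)[OF z]] wedge_2_1[OF alt_lift(4)[OF z] alternating_dt, of i "(x, t)"]
    by (simp add: form_wedge_def) (simp add: lift_def dt_def)
  have L3: "ext_deriv F i (x, t) us = (3 *\<^sub>F P) i (x, t) us" if "length us \<noteq> 3" for us
  proof -
    have "ext_deriv F i (x, t) us = 0"
      by (rule ext_deriv_degree[OF o z, where k = 2]) (use aF2 that in auto)
    moreover have "P i (x, t) us = 0"
      unfolding P using wedge_degree[OF alt_lift(3)[OF z] alt_lift(1)[OF z]] wedge_degree[OF alt_lift(4)[OF z] alternating_dt, of us i "(x, t)"] that
      by (simp add: form_wedge_def)
    ultimately show ?thesis by (simp add: form_scale_def)
  qed
  have A3: "ext_deriv (\<omega> t 1) i x us = (3 *\<^sub>F (\<eta> t \<and>\<^sub>F \<omega> t 2)) i x us" if "length us \<noteq> 3" for us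
  proof -
    have "ext_deriv (\<omega> t 1) i x us = 0" by (rule ext_deriv_degree[OF S x, where k = 2]) (use alt that in auto)
    moreover have "(\<eta> t \<and>\<^sub>F \<omega> t 2) i x us = 0"
      unfolding form_wedge_def using wedge_degree[OF alt(1)[OF x] alt(3)[OF x]] that by simp
    ultimately show ?thesis by (simp add: form_scale_def)
  qed
  have E2: "time_deriv (\<lambda>s. \<omega> s 1) t i x us = (- ext_deriv (\<eta> t) - 3 *\<^sub>F \<omega> t 3) i x us" if "length us \<noteq> 2" for us
  proof -
    have "ext_deriv (\<eta> t) i x us = 0" by (rule ext_deriv_degree[OF S x, where k = 1]) (use alt that in auto)
    moreover have "time_deriv (\<lambda>s. \<omega> s 1) t i x us = 0"
      unfolding time_deriv_def using alternating_length[OF alt(2)[OF x] that] by simp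
    ultimately show ?thesis using alternating_length[OF alt(4)[OF x] that] by (simp add: form_scale_def)
  qed
  let ?a = "\<lambda>u v w. ext_deriv (\<omega> t 1) i x [u, v, w] - (3 *\<^sub>F (\<eta> t \<and>\<^sub>F \<omega> t 2)) i x [u, v, w]"
  let ?e = "\<lambda>u v. time_deriv (\<lambda>s. \<omega> s 1) t i x [u, v] - (- ext_deriv (\<eta> t) - 3 *\<^sub>F \<omega> t 3) i x [u, v]"
  have decomp: "ext_deriv F i (x, t) [(u, p), (v, q), (w, r)] - (3 *\<^sub>F P) i (x, t) [(u, p), (v, q), (w, r)] =
      ?a u v w + p * ?e v w - q * ?e u w + r * ?e u v" for u v w p q r
    unfolding aF form_scale_def P3 by (simp add: form_wedge_formulas[OF x] algebra_simps)
  show ?thesis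
  proof
    assume L: ?L
    have d: "?a u v w + p * ?e v w - q * ?e u w + r * ?e u v = 0" for u v w p q r
      using decomp[of u p v q w r] L by simp
    have a: "?a u v w = 0" for u v w using d[of u v w 0 0 0] by simp
    \<comment> \<open>Space component 0 with time component 1 is the coordinate vector of time,
      whose contraction isolates the dt-part.\<close>
    have e: "?e v w = 0" for v w using d[of 0 v w 1 0 0] a[of 0 v w] by simp
    have ?A
    proof
      show "ext_deriv (\<omega> t 1) i x us = (3 *\<^sub>F (\<eta> t \<and>\<^sub>F \<omega> t 2)) i x us" for us
        using A3[of us] a by (cases "length us = 3") (auto elim!: length_3E)
    qed
    moreover have ?E
    proof
      show "time_deriv (\<lambda>s. \<omega> s 1) t i x us = (- ext_deriv (\<eta> t) - 3 *\<^sub>F \<omega> t 3) i x us" for us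
        using E2[of us] e by (cases "length us = 2") (auto elim!: length_2E)
    qed
    ultimately show "?A \<and> ?E" ..
  next
    assume "?A \<and> ?E"
    then have "?a u v w = 0" "?e u v = 0" for u v w by simp_all
    then have "ext_deriv F i (x, t) [y, y', y''] = (3 *\<^sub>F P) i (x, t) [y, y', y'']" for y y' y''
      using decomp[of "fst y" "snd y" "fst y'" "snd y'" "fst y''" "snd y''"] by simp
    then show ?L
      using L3 by (intro ext, case_tac "length xa = 3") (auto elim!: length_3E)
  qed
qed

text \<open>Origin of the constant 4: F \<and> F = \<omega>1 \<and> \<omega>1 + 2 \<omega>1 \<and>
  \<eta> \<and> dt, and moving dt to the front past a 3-form changes the sign, so -2 F \<and> F has
  the dt-part +4 dt \<and> (\<eta> \<and> \<omega>1).\<close>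

lemma dPsi_iff:
  assumes x: "x \<in> S"
    and F: "\<And>z. z \<in> S \<times> UNIV \<Longrightarrow> F i z = (lift (\<lambda>t. \<omega> t 1) + lift \<eta> \<and>\<^sub>F dt) i z"
    and M: "\<And>z. z \<in> S \<times> UNIV \<Longrightarrow> M i z = (lift (\<lambda>t. \<omega> t 2) \<and>\<^sub>F dt + lift (\<lambda>t. \<omega> t 3) \<and>\<^sub>F lift \<eta>) i z"
  shows "ext_deriv M i (x, t) = ((- 2) *\<^sub>F (F \<and>\<^sub>F F)) i (x, t) \<longleftrightarrow>
    ext_deriv (\<eta> t \<and>\<^sub>F \<omega> t 3) i x = ((- 2) *\<^sub>F (\<omega> t 1 \<and>\<^sub>F \<omega> t 1)) i x \<and>
    time_deriv (\<lambda>s. \<eta> s \<and>\<^sub>F \<omega> s 3) t i x = (ext_deriv (\<omega> t 2) + 4 *\<^sub>F (\<eta> t \<and>\<^sub>F \<omega> t 1)) i x" (is "?L = (?A \<and> ?E)")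
proof -
  have z: "(x, t) \<in> S \<times> UNIV" using x by simp
  have o: "open (S \<times> (UNIV :: real set))" using S by (auto intro: open_Times)
  have \<kappa>: "family_on 3 S i (\<lambda>t. \<eta> t \<and>\<^sub>F \<omega> t 3)" by (rule \<eta>\<omega>) simp
  have M': "M i y vs = (lift (\<lambda>t. \<eta> t \<and>\<^sub>F \<omega> t 3) + lift (\<lambda>t. \<omega> t 2) \<and>\<^sub>F dt) i y vs" if y: "y \<in> S \<times> UNIV" and len: "length vs = 3" for y vs
  proof -
    obtain a b c where vs: "vs = [a, b, c]" using len by (rule length_3E)
    obtain x' s where y': "y = (x', s)" "x' \<in> S" using y by auto
    show ?thesis
      unfolding M[OF y] vs using wedge_2_1[OF alt_lift(4)[OF y] alt_lift(1)[OF y], of a b c]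
      by (simp add: form_wedge_index) (simp add: y' lift_def form_wedge_formulas[OF y'(2)] )
  qed
  have aM: "ext_deriv M i (x, t) [(u, p), (v, q), (w, r), (y, s)] = ext_deriv (\<eta> t \<and>\<^sub>F \<omega> t 3) i x [u, v, w, y]
     + p * (time_deriv (\<lambda>t. \<eta> t \<and>\<^sub>F \<omega> t 3) t i x [v, w, y] - ext_deriv (\<omega> t 2) i x [v, w, y])
     - q * (time_deriv (\<lambda>t. \<eta> t \<and>\<^sub>F \<omega> t 3) t i x [u, w, y] - ext_deriv (\<omega> t 2) i x [u, w, y])
     + r * (time_deriv (\<lambda>t. \<eta> t \<and>\<^sub>F \<omega> t 3) t i x [u, v, y] - ext_deriv (\<omega> t 2) i x [u, v, y])
     - s * (time_deriv (\<lambda>t. \<eta> t \<and>\<^sub>F \<omega> t 3) t i x [u, v, w] - ext_deriv (\<omega> t 2) i x [u, v, w])" for u v w y p q r s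
    by (rule ext_deriv_cylinder_3[OF S x \<kappa> \<omega>2]) (rule M')
  have aM3: "alternating 3 (M i y)" if "y \<in> S \<times> UNIV" for y
    using alternating_add[OF alternating_wedge[OF alt_lift(3)[OF that] alternating_dt, of i y] alternating_wedge[OF alt_lift(4)[OF that] alt_lift(1)[OF that]]] M[OF that]
    by (simp add: form_wedge_def)
  have aF2: "alternating 2 (F i (x, t))"
    using alternating_add[OF alt_lift(2)[OF z] alternating_wedge[OF alt_lift(1)[OF z] alternating_dt, simplified], of i "(x, t)"] F[OF z]
    by (simp add: form_wedge_def)
  have F2: "F i (x, t) [(u, p), (v, q)] = \<omega> t 1 i x [u, v] + (\<eta> t i x [u] * q - \<eta> t i x [v] * p)" for u v p q
    unfolding F[OF z] using wedge_1_1[OF alt_lift(1)[OF z] alternating_dt, of i "(x, t)"]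
    by (simp add: form_wedge_def) (simp add: lift_def dt_def)
  have FF: "(F \<and>\<^sub>F F) i (x, t) [(u, p), (v, q), (w, r), (y, s)] = (\<omega> t 1 \<and>\<^sub>F \<omega> t 1) i x [u, v, w, y]
     + 2 * (- p * (\<eta> t \<and>\<^sub>F \<omega> t 1) i x [v, w, y] + q * (\<eta> t \<and>\<^sub>F \<omega> t 1) i x [u, w, y]
       - r * (\<eta> t \<and>\<^sub>F \<omega> t 1) i x [u, v, y] + s * (\<eta> t \<and>\<^sub>F \<omega> t 1) i x [u, v, w])" for u v w y p q r s
    unfolding \<omega>1_squared[OF x] form_wedge_index[of F] wedge_2_2[OF aF2 aF2] F2
    by (simp add: form_wedge_formulas[OF x] algebra_simps)
  have L4: "ext_deriv M i (x, t) us = ((- 2) *\<^sub>F (F \<and>\<^sub>F F)) i (x, t) us" if "length us \<noteq> 4" for us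
  proof -
    have "ext_deriv M i (x, t) us = 0"
      by (rule ext_deriv_degree[OF o z, where k = 3]) (use aM3 that in auto)
    moreover have "(F \<and>\<^sub>F F) i (x, t) us = 0"
      unfolding form_wedge_def using wedge_degree[OF aF2 aF2] that by simp
    ultimately show ?thesis by (simp add: form_scale_def)
  qed
  have A4: "ext_deriv (\<eta> t \<and>\<^sub>F \<omega> t 3) i x us = ((- 2) *\<^sub>F (\<omega> t 1 \<and>\<^sub>F \<omega> t 1)) i x us" if "length us \<noteq> 4" for us
  proof -
    have "ext_deriv (\<eta> t \<and>\<^sub>F \<omega> t 3) i x us = 0" by (rule ext_deriv_degree[OF S x, where k = 3]) (use family_onD(1)[OF \<kappa>] that in auto)
    moreover have "(\<omega> t 1 \<and>\<^sub>F \<omega> t 1) i x us = 0"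
      unfolding form_wedge_def using wedge_degree[OF alt(2)[OF x] alt(2)[OF x]] that by simp
    ultimately show ?thesis by (simp add: form_scale_def)
  qed
  have E3: "time_deriv (\<lambda>s. \<eta> s \<and>\<^sub>F \<omega> s 3) t i x us = (ext_deriv (\<omega> t 2) + 4 *\<^sub>F (\<eta> t \<and>\<^sub>F \<omega> t 1)) i x us" if "length us \<noteq> 3" for us
  proof -
    have "ext_deriv (\<omega> t 2) i x us = 0" by (rule ext_deriv_degree[OF S x, where k = 2]) (use alt that in auto)
    moreover have "time_deriv (\<lambda>s. \<eta> s \<and>\<^sub>F \<omega> s 3) t i x us = 0"
      unfolding time_deriv_def using alternating_length[OF family_onD(1)[OF \<kappa> x] that] by simp
    moreover have "(\<eta> t \<and>\<^sub>F \<omega> t 1) i x us = 0"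
      unfolding form_wedge_def using wedge_degree[OF alt(1)[OF x] alt(2)[OF x]] that by simp
    ultimately show ?thesis by (simp add: form_scale_def)
  qed
  let ?a = "\<lambda>u v w y. ext_deriv (\<eta> t \<and>\<^sub>F \<omega> t 3) i x [u, v, w, y] - ((- 2) *\<^sub>F (\<omega> t 1 \<and>\<^sub>F \<omega> t 1)) i x [u, v, w, y]"
  let ?e = "\<lambda>u v w. time_deriv (\<lambda>s. \<eta> s \<and>\<^sub>F \<omega> s 3) t i x [u, v, w] - (ext_deriv (\<omega> t 2) + 4 *\<^sub>F (\<eta> t \<and>\<^sub>F \<omega> t 1)) i x [u, v, w]"
  have decomp: "ext_deriv M i (x, t) [(u, p), (v, q), (w, r), (y, s)] - ((- 2) *\<^sub>F (F \<and>\<^sub>F F)) i (x, t) [(u, p), (v, q), (w, r), (y, s)] =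
      ?a u v w y + p * ?e v w y - q * ?e u w y + r * ?e u v y - s * ?e u v w" for u v w y p q r s
    unfolding aM form_scale_def FF by (simp add: algebra_simps)
  show ?thesis
  proof
    assume L: ?L
    have d: "?a u v w y + p * ?e v w y - q * ?e u w y + r * ?e u v y - s * ?e u v w = 0" for u v w y p q r s
      using decomp[of u p v q w r y s] L by simp
    have a: "?a u v w y = 0" for u v w y using d[of u v w y 0 0 0 0] by simp
    have e: "?e v w y = 0" for v w y using d[of 0 v w y 1 0 0 0] a[of 0 v w y] by simp
    have ?A
    proof
      show "ext_deriv (\<eta> t \<and>\<^sub>F \<omega> t 3) i x us = ((- 2) *\<^sub>F (\<omega> t 1 \<and>\<^sub>F \<omega> t 1)) i x us" for us
        using A4[of us] a by (cases "length us = 4") (auto elim!: length_4E)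
    qed
    moreover have ?E
    proof
      show "time_deriv (\<lambda>s. \<eta> s \<and>\<^sub>F \<omega> s 3) t i x us = (ext_deriv (\<omega> t 2) + 4 *\<^sub>F (\<eta> t \<and>\<^sub>F \<omega> t 1)) i x us" for us
        using E3[of us] e by (cases "length us = 3") (auto elim!: length_3E)
    qed
    ultimately show "?A \<and> ?E" ..
  next
    assume "?A \<and> ?E"
    then have "?a u v w y = 0" "?e u v w = 0" for u v w y by simp_all
    then have "ext_deriv M i (x, t) [y, y', y'', y'''] = ((- 2) *\<^sub>F (F \<and>\<^sub>F F)) i (x, t) [y, y', y'', y''']" for y y' y'' y'''
      using decomp[of "fst y" "snd y" "fst y'" "snd y'" "fst y''" "snd y''" "fst y'''" "snd y'''"] by simp
    then show ?L
      using L4 by (intro ext, case_tac "length xa = 4") (auto elim!: length_4E)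
  qed
qed

end

section \<open>Time evolution of the nearly hypo equations\<close>

context su2_chart
begin

lemma smooth_ext_deriv_eta: "smooth_on S (\<lambda>y. ext_deriv (\<eta> t) i y [u, v])"
  unfolding ext_deriv_2 by (intro smooth_on_diff S smooth_on_pd smooth)

lemma smooth_ext_deriv_omega2: "smooth_on S (\<lambda>y. ext_deriv (\<omega> t 2) i y [u, v, w])"
  unfolding ext_deriv_3 by (intro smooth_on_diff smooth_on_add S smooth_on_pd smooth)

text \<open>Commuting d/dt with d turns the derivative into d(-d\<eta> - 3 \<omega>3), and dd\<eta>
  = 0. Both directions of the equivalence rest on this: it yields the third evolution equation and
  keeps the first nearly hypo equation.\<close>

lemma ext_deriv_\<omega>1_has_derivative:
  assumes x: "x \<in> S"
    and E1: "\<And>y. y \<in> S \<Longrightarrow> time_deriv (\<lambda>s. \<omega> s 1) t i y = (- ext_deriv (\<eta> t) - 3 *\<^sub>F \<omega> t 3) i y"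
  shows "((\<lambda>s. ext_deriv (\<omega> s 1) i x [u, v, w]) has_real_derivative - 3 * ext_deriv (\<omega> t 3) i x [u, v, w]) (at t)"
proof -
  have "pd (\<lambda>y. time_deriv (\<lambda>s. \<omega> s 1) t i y [a, b]) x c =
      pd (\<lambda>y. - ext_deriv (\<eta> t) i y [a, b] - 3 * \<omega> t 3 i y [a, b]) x c" for a b c
    by (rule pd_cong[OF S x]) (simp add: E1 form_scale_def)
  then have pdE: "pd (\<lambda>y. time_deriv (\<lambda>s. \<omega> s 1) t i y [a, b]) x c =
      - pd (\<lambda>y. ext_deriv (\<eta> t) i y [a, b]) x c - 3 * pd (\<lambda>y. \<omega> t 3 i y [a, b]) x c" for a b c
    using smooth_on_imp_differentiable[OF smooth_ext_deriv_eta x] smooth_on_imp_differentiable[OF smooth(4) x]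
    by (simp add: pd_diff pd_minus pd_mult_const)
  note d = family_pd_has_time_deriv[OF S x \<omega>1, of _ _ t]
  have "((\<lambda>s. ext_deriv (\<omega> s 1) i x [u, v, w]) has_real_derivative
      - ext_deriv (ext_deriv (\<eta> t)) i x [u, v, w] - 3 * ext_deriv (\<omega> t 3) i x [u, v, w]) (at t)"
    unfolding ext_deriv_3
    by (rule DERIV_cong[OF DERIV_add[OF DERIV_diff[OF d d] d]]) (simp add: pdE algebra_simps)
  moreover have "ext_deriv (ext_deriv (\<eta> t)) i x [u, v, w] = 0"
    by (rule ext_deriv_ext_deriv_3[OF S x]) (rule smooth)
  ultimately show ?thesis by simp
qed

text \<open>This is the \<open>dt\<close>-component of \<open>d(dF) = 0\<close>.\<close>

lemma evolution_third:
  assumes x: "x \<in> S"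
    and A: "\<And>t. ext_deriv (\<omega> t 1) i x = (3 *\<^sub>F (\<eta> t \<and>\<^sub>F \<omega> t 2)) i x"
    and E1: "\<And>y. y \<in> S \<Longrightarrow> time_deriv (\<lambda>s. \<omega> s 1) t i y = (- ext_deriv (\<eta> t) - 3 *\<^sub>F \<omega> t 3) i y"
  shows "time_deriv (\<lambda>s. \<eta> s \<and>\<^sub>F \<omega> s 2) t i x = (- ext_deriv (\<omega> t 3)) i x"
proof
  fix us
  show "time_deriv (\<lambda>s. \<eta> s \<and>\<^sub>F \<omega> s 2) t i x us = (- ext_deriv (\<omega> t 3)) i x us"
  proof (cases "length us = 3")
    case True
    then obtain u v w where us: "us = [u, v, w]" by (rule length_3E)
    have "(\<lambda>s. (\<eta> s \<and>\<^sub>F \<omega> s 2) i x us) = (\<lambda>s. (1 / 3) * ext_deriv (\<omega> s 1) i x [u, v, w])"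
      unfolding A us form_scale_def by simp
    moreover have "((\<lambda>s. (1 / 3) * ext_deriv (\<omega> s 1) i x [u, v, w]) has_real_derivative
        (1 / 3) * (- 3 * ext_deriv (\<omega> t 3) i x [u, v, w])) (at t)"
      by (intro DERIV_cmult ext_deriv_\<omega>1_has_derivative x E1)
    ultimately show ?thesis
      unfolding time_deriv_def us by (simp add: DERIV_imp_deriv)
  next
    case False
    have "(\<eta> s \<and>\<^sub>F \<omega> s 2) i x us = 0" for s
      unfolding form_wedge_def using wedge_degree[OF alt(1)[OF x] alt(3)[OF x]] False by simp
    moreover have "ext_deriv (\<omega> t 3) i x us = 0"
      by (rule ext_deriv_degree[OF S x, where k = 2]) (use alt False in auto)
    ultimately show ?thesis by (simp add: time_deriv_def)
  qed
qed

text \<open>Both sides have time derivative -3 d\<omega>3: the left one by the first evolution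
  equation, the right one by the third. Their difference is constant in t and zero at t = 0.\<close>

lemma preserve_first:
  assumes x: "x \<in> S"
    and A: "ext_deriv (\<omega> 0 1) i x = (3 *\<^sub>F (\<eta> 0 \<and>\<^sub>F \<omega> 0 2)) i x"
    and E1: "\<And>t y. y \<in> S \<Longrightarrow> time_deriv (\<lambda>s. \<omega> s 1) t i y = (- ext_deriv (\<eta> t) - 3 *\<^sub>F \<omega> t 3) i y"
    and E3: "\<And>t. time_deriv (\<lambda>s. \<eta> s \<and>\<^sub>F \<omega> s 2) t i x = (- ext_deriv (\<omega> t 3)) i x"
  shows "ext_deriv (\<omega> t 1) i x = (3 *\<^sub>F (\<eta> t \<and>\<^sub>F \<omega> t 2)) i x"
proof
  fix us
  show "ext_deriv (\<omega> t 1) i x us = (3 *\<^sub>F (\<eta> t \<and>\<^sub>F \<omega> t 2)) i x us"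
  proof (cases "length us = 3")
    case True
    then obtain u v w where us: "us = [u, v, w]" by (rule length_3E)
    define \<delta> where "\<delta> s = ext_deriv (\<omega> s 1) i x us - 3 * (\<eta> s \<and>\<^sub>F \<omega> s 2) i x us" for s
    have "(\<delta> has_real_derivative 0) (at s)" for s
    proof -
      have "((\<lambda>s. (\<eta> s \<and>\<^sub>F \<omega> s 2) i x us) has_real_derivative - ext_deriv (\<omega> s 3) i x us) (at s)"
        using family_has_time_deriv[OF S x \<eta>\<omega>[of 2], of us s] E3[of s] by simp
      from DERIV_diff[OF ext_deriv_\<omega>1_has_derivative[OF x E1, of u v w s] DERIV_cmult[OF this, of 3]]
      show ?thesis unfolding \<delta>_def[abs_def] us by simp
    qed
    then have "\<delta> t = \<delta> 0" using DERIV_isconst_all by blast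
    moreover have "\<delta> 0 = 0" using A by (simp add: \<delta>_def form_scale_def)
    ultimately show ?thesis by (simp add: \<delta>_def form_scale_def)
  next
    case False
    have "(\<eta> t \<and>\<^sub>F \<omega> t 2) i x us = 0"
      unfolding form_wedge_def using wedge_degree[OF alt(1)[OF x] alt(3)[OF x]] False by simp
    moreover have "ext_deriv (\<omega> t 1) i x us = 0"
      by (rule ext_deriv_degree[OF S x, where k = 2]) (use alt False in auto)
    ultimately show ?thesis by (simp add: form_scale_def)
  qed
qed

lemma preserve_second:
  assumes x: "x \<in> S"
    and A1: "\<And>t. ext_deriv (\<omega> t 1) i x = (3 *\<^sub>F (\<eta> t \<and>\<^sub>F \<omega> t 2)) i x"
    and A2: "ext_deriv (\<eta> 0 \<and>\<^sub>F \<omega> 0 3) i x = ((- 2) *\<^sub>F (\<omega> 0 1 \<and>\<^sub>F \<omega> 0 1)) i x"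
    and E1: "\<And>t. time_deriv (\<lambda>s. \<omega> s 1) t i x = (- ext_deriv (\<eta> t) - 3 *\<^sub>F \<omega> t 3) i x"
    and E2: "\<And>t y. y \<in> S \<Longrightarrow> time_deriv (\<lambda>s. \<eta> s \<and>\<^sub>F \<omega> s 3) t i y = (ext_deriv (\<omega> t 2) + 4 *\<^sub>F (\<eta> t \<and>\<^sub>F \<omega> t 1)) i y"
  shows "ext_deriv (\<eta> t \<and>\<^sub>F \<omega> t 3) i x = ((- 2) *\<^sub>F (\<omega> t 1 \<and>\<^sub>F \<omega> t 1)) i x"
proof
  fix us
  have \<kappa>: "family_on 3 S i (\<lambda>t. \<eta> t \<and>\<^sub>F \<omega> t 3)" by (rule \<eta>\<omega>) simp
  show "ext_deriv (\<eta> t \<and>\<^sub>F \<omega> t 3) i x us = ((- 2) *\<^sub>F (\<omega> t 1 \<and>\<^sub>F \<omega> t 1)) i x us"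
  proof (cases "length us = 4")
    case True
    then obtain u v w z where us: "us = [u, v, w, z]" by (rule length_4E)
    define \<delta> where "\<delta> s = ext_deriv (\<eta> s \<and>\<^sub>F \<omega> s 3) i x us + 2 * (\<omega> s 1 \<and>\<^sub>F \<omega> s 1) i x us" for s
    have "(\<delta> has_real_derivative 0) (at s)" for s
    proof -
      have "pd (\<lambda>y. time_deriv (\<lambda>s. \<eta> s \<and>\<^sub>F \<omega> s 3) s i y [a, b, c]) x e =
          pd (\<lambda>y. ext_deriv (\<omega> s 2) i y [a, b, c] + 4 * (\<eta> s \<and>\<^sub>F \<omega> s 1) i y [a, b, c]) x e" for a b c e
        by (rule pd_cong[OF S x]) (simp add: E2 form_scale_def)
      then have pdE: "pd (\<lambda>y. time_deriv (\<lambda>s. \<eta> s \<and>\<^sub>F \<omega> s 3) s i y [a, b, c]) x e =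
          pd (\<lambda>y. ext_deriv (\<omega> s 2) i y [a, b, c]) x e + 4 * pd (\<lambda>y. (\<eta> s \<and>\<^sub>F \<omega> s 1) i y [a, b, c]) x e" for a b c e
        using smooth_on_imp_differentiable[OF smooth_ext_deriv_omega2 x]
          smooth_on_imp_differentiable[OF family_smooth_at_time[OF S \<eta>\<omega>[of 1]] x]
        by (simp add: pd_add pd_mult_const)
      note d = family_pd_has_time_deriv[OF S x \<kappa>, of _ _ s]
      have "((\<lambda>s. ext_deriv (\<eta> s \<and>\<^sub>F \<omega> s 3) i x us) has_real_derivative
          ext_deriv (ext_deriv (\<omega> s 2)) i x us + 4 * ext_deriv (\<eta> s \<and>\<^sub>F \<omega> s 1) i x us) (at s)"
        unfolding us ext_deriv_4
        by (rule DERIV_cong[OF DERIV_diff[OF DERIV_add[OF DERIV_diff[OF d d] d] d]]) (simp add: pdE algebra_simps)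
      moreover have "ext_deriv (ext_deriv (\<omega> s 2)) i x us = 0"
        unfolding us by (rule ext_deriv_ext_deriv_4[OF S x]) (rule smooth)
      ultimately have d1: "((\<lambda>s. ext_deriv (\<eta> s \<and>\<^sub>F \<omega> s 3) i x us) has_real_derivative
          4 * ext_deriv (\<eta> s \<and>\<^sub>F \<omega> s 1) i x us) (at s)"
        by simp
      let ?w = "\<lambda>s p q. \<omega> s 1 i x [p, q]" and ?w3 = "\<lambda>p q. \<omega> s 3 i x [p, q]" and ?dh = "\<lambda>p q. ext_deriv (\<eta> s) i x [p, q]"
      have dw: "((\<lambda>s. ?w s p q) has_real_derivative (- ?dh p q - 3 * ?w3 p q)) (at s)" for p q
        using family_has_time_deriv[OF S x \<omega>1, of "[p, q]" s] E1[of s] by (simp add: form_scale_def)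
      have d2: "((\<lambda>s. (\<omega> s 1 \<and>\<^sub>F \<omega> s 1) i x us) has_real_derivative
          2 * (?w s u v * (- ?dh w z - 3 * ?w3 w z) + (- ?dh u v - 3 * ?w3 u v) * ?w s w z
          - (?w s u w * (- ?dh v z - 3 * ?w3 v z) + (- ?dh u w - 3 * ?w3 u w) * ?w s v z)
          + (?w s u z * (- ?dh v w - 3 * ?w3 v w) + (- ?dh u z - 3 * ?w3 u z) * ?w s v w))) (at s)"
        unfolding us \<omega>1_squared[OF x]
        by (rule DERIV_cong[OF DERIV_cmult[OF DERIV_add[OF DERIV_diff[OF DERIV_mult[OF dw dw] DERIV_mult[OF dw dw]] DERIV_mult[OF dw dw]]]])
          (simp add: algebra_simps)
      \<comment> \<open>The term \<eta> \<and> d\<omega>1 of the Leibniz rule is missing: by the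
        first nearly hypo equation it is 3 \<eta> \<and> \<eta> \<and> \<omega>2 = 0.\<close>
      have leibniz: "ext_deriv (\<eta> s \<and>\<^sub>F \<omega> s 1) i x us =
          ?dh u v * ?w s w z - ?dh u w * ?w s v z + ?dh u z * ?w s v w + ?dh v w * ?w s u z - ?dh v z * ?w s u w + ?dh w z * ?w s u v"
        unfolding us by (subst ext_deriv_wedge_1_2[OF S x], (rule alt smooth, assumption?)+)
          (simp add: A1 form_scale_def form_wedge_formulas[OF x] algebra_simps)
      \<comment> \<open>This disposes of the term -12 \<omega>1 \<and> \<omega>3 that comes from
        differentiating 2 \<omega>1 \<and> \<omega>1.\<close>
      have ort: "?w s u v * ?w3 w z - ?w s u w * ?w3 v z + ?w s u z * ?w3 v w
          + ?w s v w * ?w3 u z - ?w s v z * ?w3 u w + ?w s w z * ?w3 u v = 0"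
        using wedge_2_2[OF alt(2)[OF x, of s] alt(4)[OF x, of s], of u v w z] orthogonal[OF x, of s] by simp
      show ?thesis
        unfolding \<delta>_def[abs_def]
        by (rule DERIV_cong[OF DERIV_add[OF d1 DERIV_cmult[OF d2]]]) (use ort in \<open>simp add: leibniz algebra_simps\<close>)
    qed
    then have "\<delta> t = \<delta> 0" using DERIV_isconst_all by blast
    moreover have "\<delta> 0 = 0" using A2 by (simp add: \<delta>_def form_scale_def)
    ultimately show ?thesis by (simp add: \<delta>_def form_scale_def)
  next
    case False
    have "(\<omega> t 1 \<and>\<^sub>F \<omega> t 1) i x us = 0"
      unfolding form_wedge_def using wedge_degree[OF alt(2)[OF x] alt(2)[OF x]] False by simp
    moreover have "ext_deriv (\<eta> t \<and>\<^sub>F \<omega> t 3) i x us = 0"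
      by (rule ext_deriv_degree[OF S x, where k = 3]) (use family_onD(1)[OF \<kappa>] False in auto)
    ultimately show ?thesis by (simp add: form_scale_def)
  qed
qed

end

section \<open>From single charts to the manifold\<close>

lemma SU2_family_chart:
  fixes N :: "('i, 'a::{t2_space, second_countable_topology}, real ^ 5) atlas"
  assumes N: "smooth_manifold N" and fam: "SU2_family N \<eta> \<omega>" and i: "i \<in> idx N"
  shows "su2_chart (img N i) i \<eta> \<omega>"
proof
  show "open (img N i)" using N i by (simp add: smooth_manifold_def)
  show "family_on 1 (img N i) i \<eta>" by (rule SU2_family_family_on(1)[OF fam i])
  show "family_on 2 (img N i) i (\<lambda>t. \<omega> t a)" if "a \<in> {1, 2, 3}" for a
    by (rule SU2_family_family_on(2)[OF fam i that])
  show "\<omega> t 1 i x \<and>\<^sub>c \<omega> t 3 i x = 0" if x: "x \<in> img N i" for x t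
  proof -
    have "SU2_structure N (\<eta> t) (\<omega> t)" using fam by (simp add: SU2_family_def)
    from SU2_structure_point[OF this i x] obtain v where "su2_point (\<eta> t i x) (\<lambda>a. \<omega> t a i x) v" by (rule exE)
    from su2_point.orthogonal[OF this, of 1 3] show ?thesis by simp
  qed
qed

lemma complex_form_eq_iff: "complex_form a b i z = complex_form c d i z \<longleftrightarrow> a i z = c i z \<and> b i z = d i z"
  by (auto simp: complex_form_def fun_eq_iff)

lemma form_eqD: "\<alpha> \<doteq>\<^bsub>M\<^esub> \<beta> \<Longrightarrow> i \<in> idx M \<Longrightarrow> x \<in> img M i \<Longrightarrow> \<alpha> i x = \<beta> i x"
  by (simp add: form_eq_def)

text \<open>The family at t = 0 agrees with the given forms only on the chart images. These are
  open, so the exterior derivatives agree there too, and the condition becomes one about the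
  family.\<close>

lemma nearly_hypo_initial:
  fixes N :: "('i, 'a::{t2_space, second_countable_topology}, real ^ 5) atlas"
  assumes N: "smooth_manifold N" and "SU2_structure N \<eta>\<^sub>0 \<omega>\<^sub>0" and fam: "SU2_family_from N \<eta>\<^sub>0 \<omega>\<^sub>0 \<eta> \<omega>"
  shows "nearly_hypo N \<eta>\<^sub>0 \<omega>\<^sub>0 \<longleftrightarrow> (\<forall>i\<in>idx N. \<forall>x\<in>img N i.
    ext_deriv (\<omega> 0 1) i x = (3 *\<^sub>F (\<eta> 0 \<and>\<^sub>F \<omega> 0 2)) i x \<and>
    ext_deriv (\<eta> 0 \<and>\<^sub>F \<omega> 0 3) i x = ((- 2) *\<^sub>F (\<omega> 0 1 \<and>\<^sub>F \<omega> 0 1)) i x)"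
proof -
  have "ext_deriv (\<omega> 0 1) i x = ext_deriv (\<omega>\<^sub>0 1) i x"
    "(3 *\<^sub>F (\<eta> 0 \<and>\<^sub>F \<omega> 0 2)) i x = (3 *\<^sub>F (\<eta>\<^sub>0 \<and>\<^sub>F \<omega>\<^sub>0 2)) i x"
    "ext_deriv (\<eta> 0 \<and>\<^sub>F \<omega> 0 3) i x = ext_deriv (\<eta>\<^sub>0 \<and>\<^sub>F \<omega>\<^sub>0 3) i x"
    "((- 2) *\<^sub>F (\<omega> 0 1 \<and>\<^sub>F \<omega> 0 1)) i x = ((- 2) *\<^sub>F (\<omega>\<^sub>0 1 \<and>\<^sub>F \<omega>\<^sub>0 1)) i x"
    if i: "i \<in> idx N" and x: "x \<in> img N i" for i x
  proof -
    have S: "open (img N i)" using N i by (simp add: smooth_manifold_def)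
    have eq: "\<eta> 0 i y = \<eta>\<^sub>0 i y" "a \<in> {1, 2, 3} \<Longrightarrow> \<omega> 0 a i y = \<omega>\<^sub>0 a i y" if "y \<in> img N i" for y a
      using fam i that by (auto simp: SU2_family_from_def form_eq_def)
    show "ext_deriv (\<omega> 0 1) i x = ext_deriv (\<omega>\<^sub>0 1) i x"
      "ext_deriv (\<eta> 0 \<and>\<^sub>F \<omega> 0 3) i x = ext_deriv (\<eta>\<^sub>0 \<and>\<^sub>F \<omega>\<^sub>0 3) i x"
      by (rule ext_deriv_cong[OF S x], simp add: eq form_wedge_def)+
    show "(3 *\<^sub>F (\<eta> 0 \<and>\<^sub>F \<omega> 0 2)) i x = (3 *\<^sub>F (\<eta>\<^sub>0 \<and>\<^sub>F \<omega>\<^sub>0 2)) i x"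
      "((- 2) *\<^sub>F (\<omega> 0 1 \<and>\<^sub>F \<omega> 0 1)) i x = ((- 2) *\<^sub>F (\<omega>\<^sub>0 1 \<and>\<^sub>F \<omega>\<^sub>0 1)) i x"
      using eq[OF x] by (simp_all add: form_scale_def form_wedge_def)
  qed
  then show ?thesis using assms(2) unfolding nearly_hypo_def form_eq_def by auto
qed

theorem proposition3p2:
  fixes N :: "('i, 'a::{t2_space, second_countable_topology}, real ^ 5) atlas"
    and \<eta>\<^sub>0 :: "('i, real ^ 5, real) form"
    and \<omega>\<^sub>0 :: "nat \<Rightarrow> ('i, real ^ 5, real) form"
  assumes "smooth_manifold N"
    and "SU2_structure N \<eta>\<^sub>0 \<omega>\<^sub>0"
  shows "(\<exists>\<eta> \<omega> F \<Psi>\<^sub>p \<Psi>\<^sub>m.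
            SU2_family_from N \<eta>\<^sub>0 \<omega>\<^sub>0 \<eta> \<omega> \<and>
            nearly_Kaehler (times_real N) F \<Psi>\<^sub>p \<Psi>\<^sub>m \<and>
            F \<doteq>\<^bsub>times_real N\<^esub> lift (\<lambda>t. \<omega> t 1) + lift \<eta> \<and>\<^sub>F dt \<and>
            complex_form \<Psi>\<^sub>p \<Psi>\<^sub>m \<doteq>\<^bsub>times_real N\<^esub>
              complex_form (lift (\<lambda>t. \<omega> t 2)) (lift (\<lambda>t. \<omega> t 3)) \<and>\<^sub>F complex_form (lift \<eta>) dt)
     \<longleftrightarrow>
         nearly_hypo N \<eta>\<^sub>0 \<omega>\<^sub>0 \<and>
         (\<exists>\<eta> \<omega>. SU2_family_from N \<eta>\<^sub>0 \<omega>\<^sub>0 \<eta> \<omega> \<and> evolution_nearly_hypo N \<eta> \<omega>)" (is "?L \<longleftrightarrow> ?R")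
proof
  assume ?L
  then obtain \<eta> \<omega> F P M where from0: "SU2_family_from N \<eta>\<^sub>0 \<omega>\<^sub>0 \<eta> \<omega>"
    and nK: "nearly_Kaehler (times_real N) F P M"
    and F: "F \<doteq>\<^bsub>times_real N\<^esub> lift (\<lambda>t. \<omega> t 1) + lift \<eta> \<and>\<^sub>F dt"
    and PM: "complex_form P M \<doteq>\<^bsub>times_real N\<^esub>
              complex_form (lift (\<lambda>t. \<omega> t 2)) (lift (\<lambda>t. \<omega> t 3)) \<and>\<^sub>F complex_form (lift \<eta>) dt" by blast
  have fam: "SU2_family N \<eta> \<omega>" using from0 by (simp add: SU2_family_from_def)
  have F': "F i z = (lift (\<lambda>t. \<omega> t 1) + lift \<eta> \<and>\<^sub>F dt) i z"
    and P': "P i z = (lift (\<lambda>t. \<omega> t 2) \<and>\<^sub>F lift \<eta> - lift (\<lambda>t. \<omega> t 3) \<and>\<^sub>F dt) i z"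
    and M': "M i z = (lift (\<lambda>t. \<omega> t 2) \<and>\<^sub>F dt + lift (\<lambda>t. \<omega> t 3) \<and>\<^sub>F lift \<eta>) i z"
    and dF: "ext_deriv F i z = (3 *\<^sub>F P) i z" and dM: "ext_deriv M i z = ((- 2) *\<^sub>F (F \<and>\<^sub>F F)) i z"
    if "i \<in> idx N" "z \<in> img N i \<times> UNIV" for i z
    using form_eqD[OF F, of i z] form_eqD[OF PM, of i z] nK that
    unfolding complex_form_wedge complex_form_eq_iff idx_times_real img_times_real nearly_Kaehler_def form_eq_def
    by blast+
  \<comment> \<open>The nearly hypo equations are obtained at every t, not just at 0: deriving the
    third evolution equation differentiates the first of them in time.\<close>
  have eqs: "ext_deriv (\<omega> t 1) i x = (3 *\<^sub>F (\<eta> t \<and>\<^sub>F \<omega> t 2)) i x"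
    "time_deriv (\<lambda>s. \<omega> s 1) t i x = (- ext_deriv (\<eta> t) - 3 *\<^sub>F \<omega> t 3) i x"
    "ext_deriv (\<eta> t \<and>\<^sub>F \<omega> t 3) i x = ((- 2) *\<^sub>F (\<omega> t 1 \<and>\<^sub>F \<omega> t 1)) i x"
    "time_deriv (\<lambda>s. \<eta> s \<and>\<^sub>F \<omega> s 3) t i x = (ext_deriv (\<omega> t 2) + 4 *\<^sub>F (\<eta> t \<and>\<^sub>F \<omega> t 1)) i x"
    if i: "i \<in> idx N" and x: "x \<in> img N i" for i x t
  proof -
    interpret su2_chart "img N i" i \<eta> \<omega> by (rule SU2_family_chart[OF assms(1) fam i])
    have z: "(x, t) \<in> img N i \<times> UNIV" using x by simp
    show "ext_deriv (\<omega> t 1) i x = (3 *\<^sub>F (\<eta> t \<and>\<^sub>F \<omega> t 2)) i x"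
      "time_deriv (\<lambda>s. \<omega> s 1) t i x = (- ext_deriv (\<eta> t) - 3 *\<^sub>F \<omega> t 3) i x"
      using iffD1[OF dF_iff[where F = F and P = P and t = t, OF x F'[OF i] P'[OF i z]] dF[OF i z]] by blast+
    show "ext_deriv (\<eta> t \<and>\<^sub>F \<omega> t 3) i x = ((- 2) *\<^sub>F (\<omega> t 1 \<and>\<^sub>F \<omega> t 1)) i x"
      "time_deriv (\<lambda>s. \<eta> s \<and>\<^sub>F \<omega> s 3) t i x = (ext_deriv (\<omega> t 2) + 4 *\<^sub>F (\<eta> t \<and>\<^sub>F \<omega> t 1)) i x"
      using iffD1[OF dPsi_iff[where F = F and M = M and t = t, OF x F'[OF i] M'[OF i]] dM[OF i z]] by blast+
  qed
  have "time_deriv (\<lambda>s. \<eta> s \<and>\<^sub>F \<omega> s 2) t i x = (- ext_deriv (\<omega> t 3)) i x"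
    if i: "i \<in> idx N" and x: "x \<in> img N i" for i x t
    by (rule su2_chart.evolution_third[OF SU2_family_chart[OF assms(1) fam i] x eqs(1)[OF i x] eqs(2)[OF i]])
  then have "evolution_nearly_hypo N \<eta> \<omega>"
    using eqs unfolding evolution_nearly_hypo_def form_eq_def by blast
  then show ?R
    using from0 eqs nearly_hypo_initial[OF assms from0] by blast
next
  assume ?R
  then obtain \<eta> \<omega> where nh: "nearly_hypo N \<eta>\<^sub>0 \<omega>\<^sub>0" and from0: "SU2_family_from N \<eta>\<^sub>0 \<omega>\<^sub>0 \<eta> \<omega>"
    and ev: "evolution_nearly_hypo N \<eta> \<omega>" by blast
  have fam: "SU2_family N \<eta> \<omega>" using from0 by (simp add: SU2_family_from_def)
  have E1: "time_deriv (\<lambda>s. \<omega> s 1) t i x = (- ext_deriv (\<eta> t) - 3 *\<^sub>F \<omega> t 3) i x"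
    and E2: "time_deriv (\<lambda>s. \<eta> s \<and>\<^sub>F \<omega> s 3) t i x = (ext_deriv (\<omega> t 2) + 4 *\<^sub>F (\<eta> t \<and>\<^sub>F \<omega> t 1)) i x"
    and E3: "time_deriv (\<lambda>s. \<eta> s \<and>\<^sub>F \<omega> s 2) t i x = (- ext_deriv (\<omega> t 3)) i x"
    if "i \<in> idx N" "x \<in> img N i" for i x t
    using ev that unfolding evolution_nearly_hypo_def form_eq_def by blast+
  let ?F = "lift (\<lambda>t. \<omega> t 1) + lift \<eta> \<and>\<^sub>F dt"
  let ?P = "lift (\<lambda>t. \<omega> t 2) \<and>\<^sub>F lift \<eta> - lift (\<lambda>t. \<omega> t 3) \<and>\<^sub>F dt"
  let ?M = "lift (\<lambda>t. \<omega> t 2) \<and>\<^sub>F dt + lift (\<lambda>t. \<omega> t 3) \<and>\<^sub>F lift \<eta>"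
  have "ext_deriv ?F i (x, t) = (3 *\<^sub>F ?P) i (x, t) \<and> ext_deriv ?M i (x, t) = ((- 2) *\<^sub>F (?F \<and>\<^sub>F ?F)) i (x, t)"
    if i: "i \<in> idx N" and x: "x \<in> img N i" for i x t
  proof -
    interpret su2_chart "img N i" i \<eta> \<omega> by (rule SU2_family_chart[OF assms(1) fam i])
    have init: "ext_deriv (\<omega> 0 1) i x = (3 *\<^sub>F (\<eta> 0 \<and>\<^sub>F \<omega> 0 2)) i x"
      "ext_deriv (\<eta> 0 \<and>\<^sub>F \<omega> 0 3) i x = ((- 2) *\<^sub>F (\<omega> 0 1 \<and>\<^sub>F \<omega> 0 1)) i x"
      using nh nearly_hypo_initial[OF assms from0] i x by blast+
    note A1 = preserve_first[OF x init(1) E1[OF i] E3[OF i x]]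
    note A2 = preserve_second[OF x A1 init(2) E1[OF i x] E2[OF i]]
    show ?thesis
      using dF_iff[where F = ?F and P = ?P and t = t, OF x refl refl] dPsi_iff[where F = ?F and M = ?M and t = t, OF x refl refl] A1 A2 E1[OF i x] E2[OF i x] by blast
  qed
  then have "nearly_Kaehler (times_real N) ?F ?P ?M"
    using SU3_structure_cylinder[OF assms(1) fam]
    unfolding nearly_Kaehler_def form_eq_def idx_times_real img_times_real by auto
  moreover have "complex_form ?P ?M = complex_form (lift (\<lambda>t. \<omega> t 2)) (lift (\<lambda>t. \<omega> t 3)) \<and>\<^sub>F complex_form (lift \<eta>) dt"
    by (simp add: complex_form_wedge)
  ultimately show ?L
    using from0 by (intro exI[of _ \<eta>] exI[of _ \<omega>] exI[of _ ?F] exI[of _ ?P] exI[of _ ?M]) (simp add: form_eq_def)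
qed

end
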